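(* Let $d\ge 1$, let $\Omega\subset\mathbb{R}^d$ be a bounded domain, and let $0<\lambda_1\le\lambda_2\le\cdots$ be the eigenvalues of the Dirichlet Laplacian on $\Omega$. For all positive integers $j,k$ with $$k\ \ge\ j\,\frac{1+\frac d2}{1+\frac d4},$$ the means of the eigenvalues satisfy $$\frac{\overline{\lambda_k}}{\overline{\lambda_j}}\ \le\ 2\left(\frac{1+\frac d4}{1+\frac d2}\right)^{1+\frac2d}\left(\frac kj\right)^{\frac2d}.$$
   Context: $\{\lambda_k\}_{k\ge1}$ are the eigenvalues, in nondecreasing order and repeated according to multiplicity, of $-\Delta$ on $\Omega$ with Dirichlet boundary conditions on $\partial\Omega$. $\overline{\lambda_k}:=\frac1k\sum_{\ell\le k}\lambda_\ell$ is the mean of the first $k$ eigenvalues. *)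

theory Defs
  imports "HOL-Analysis.Analysis"
begin

text \<open>Functions in the Lebesgue and Sobolev spaces below are total functions on the ambient
  Euclidean space; only their values almost everywhere on \<open>\<Omega>\<close> matter.\<close>

definition bounded_domain :: "'a::euclidean_space set \<Rightarrow> bool" where
  "bounded_domain \<Omega> \<longleftrightarrow> open \<Omega> \<and> connected \<Omega> \<and> \<Omega> \<noteq> {} \<and> bounded \<Omega>"

primrec C_k :: "nat \<Rightarrow> ('a::euclidean_space \<Rightarrow> real) \<Rightarrow> bool" where
  "C_k 0 f \<longleftrightarrow> continuous_on UNIV f"
| "C_k (Suc n) f \<longleftrightarrow>
     (\<forall>x. f differentiable (at x)) \<and> (\<forall>b\<in>Basis. C_k n (\<lambda>x. frechet_derivative f (at x) b))"

definition test_functions :: "'a::euclidean_space set \<Rightarrow> ('a \<Rightarrow> real) set" where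
  "test_functions \<Omega> =
     {\<phi>. (\<forall>n. C_k n \<phi>) \<and> compact (closure {x. \<phi> x \<noteq> 0}) \<and> closure {x. \<phi> x \<noteq> 0} \<subseteq> \<Omega>}"

definition grad :: "('a::euclidean_space \<Rightarrow> real) \<Rightarrow> 'a \<Rightarrow> 'a" where
  "grad f x = (\<Sum>b\<in>Basis. frechet_derivative f (at x) b *\<^sub>R b)"

definition square_integrable ::
  "'a::euclidean_space set \<Rightarrow> ('a \<Rightarrow> 'b::euclidean_space) \<Rightarrow> bool" where
  "square_integrable \<Omega> u \<longleftrightarrow>
     u \<in> borel_measurable (lebesgue_on \<Omega>) \<and> integrable (lebesgue_on \<Omega>) (\<lambda>x. (norm (u x))\<^sup>2)"

definition weak_gradient :: "'a::euclidean_space set \<Rightarrow> ('a \<Rightarrow> real) \<Rightarrow> ('a \<Rightarrow> 'a) \<Rightarrow> bool" where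
  "weak_gradient \<Omega> u g \<longleftrightarrow>
     (\<forall>\<phi>\<in>test_functions \<Omega>. \<forall>b\<in>Basis.
        (LINT x|lebesgue_on \<Omega>. u x * frechet_derivative \<phi> (at x) b) =
        - (LINT x|lebesgue_on \<Omega>. (g x \<bullet> b) * \<phi> x))"

text \<open>\<open>H1_0 \<Omega> u g\<close>: \<open>u\<close> belongs to \<open>H\<^sup>1\<^sub>0(\<Omega>)\<close>, the closure of the test functions in the norm
  of \<open>H\<^sup>1(\<Omega>)\<close>, and \<open>g\<close> is (a representative of) its weak gradient. No regularity of the
  boundary is needed.\<close>

definition H1_0 :: "'a::euclidean_space set \<Rightarrow> ('a \<Rightarrow> real) \<Rightarrow> ('a \<Rightarrow> 'a) \<Rightarrow> bool" where
  "H1_0 \<Omega> u g \<longleftrightarrow>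
     square_integrable \<Omega> u \<and> square_integrable \<Omega> g \<and> weak_gradient \<Omega> u g \<and>
     (\<exists>\<phi>. (\<forall>n::nat. \<phi> n \<in> test_functions \<Omega>) \<and>
          (\<lambda>n. (LINT x|lebesgue_on \<Omega>. (\<phi> n x - u x)\<^sup>2)
              + (LINT x|lebesgue_on \<Omega>. (norm (grad (\<phi> n) x - g x))\<^sup>2)) \<longlonglongrightarrow> 0)"

text \<open>The graph of the Dirichlet Laplacian: \<open>u \<in> H\<^sup>1\<^sub>0(\<Omega>)\<close>, \<open>f \<in> L\<^sup>2(\<Omega>)\<close> and \<open>- \<Delta> u = f\<close>
  in the weak sense.\<close>

definition dirichlet_laplacian ::
  "'a::euclidean_space set \<Rightarrow> ('a \<Rightarrow> real) \<Rightarrow> ('a \<Rightarrow> real) \<Rightarrow> bool" where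
  "dirichlet_laplacian \<Omega> u f \<longleftrightarrow>
     square_integrable \<Omega> f \<and>
     (\<exists>g. H1_0 \<Omega> u g \<and>
        (\<forall>\<phi>\<in>test_functions \<Omega>.
           (LINT x|lebesgue_on \<Omega>. g x \<bullet> grad \<phi> x) = (LINT x|lebesgue_on \<Omega>. f x * \<phi> x)))"

definition dirichlet_eigenspace :: "'a::euclidean_space set \<Rightarrow> real \<Rightarrow> ('a \<Rightarrow> real) set" where
  "dirichlet_eigenspace \<Omega> \<mu> = {u. dirichlet_laplacian \<Omega> u (\<lambda>x. \<mu> * u x)}"

text \<open>The subspace \<open>V\<close> has dimension \<open>m\<close> after functions that agree almost everywhere on \<open>\<Omega>\<close>
  are identified: \<open>u 0, \<dots>, u (m - 1)\<close> is a basis. Library dimension does not apply, since it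
  would distinguish such functions.\<close>

definition has_ae_dim :: "'a::euclidean_space set \<Rightarrow> ('a \<Rightarrow> real) set \<Rightarrow> nat \<Rightarrow> bool" where
  "has_ae_dim \<Omega> V m \<longleftrightarrow>
     (\<exists>u. (\<forall>i<m. u i \<in> V) \<and>
        (\<forall>c. (AE x in lebesgue_on \<Omega>. (\<Sum>i<m. c i * u i x) = 0) \<longrightarrow> (\<forall>i<m. c i = 0)) \<and>
        (\<forall>v\<in>V. \<exists>c. AE x in lebesgue_on \<Omega>. v x = (\<Sum>i<m. c i * u i x)))"

text \<open>\<open>lam 1 \<le> lam 2 \<le> \<dots>\<close> lists the eigenvalues repeated according to multiplicity: every real
  \<open>\<mu>\<close> occurs exactly as often as the dimension of its eigenspace (which is \<open>0\<close> if \<open>\<mu>\<close> is not an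
  eigenvalue). This determines \<open>lam\<close> on the positive indices; \<open>lam 0\<close> is irrelevant.\<close>

definition dirichlet_eigenvalues :: "'a::euclidean_space set \<Rightarrow> (nat \<Rightarrow> real) \<Rightarrow> bool" where
  "dirichlet_eigenvalues \<Omega> lam \<longleftrightarrow>
     mono_on {1..} lam \<and>
     (\<forall>\<mu>. finite {k. 1 \<le> k \<and> lam k = \<mu>} \<and>
          has_ae_dim \<Omega> (dirichlet_eigenspace \<Omega> \<mu>) (card {k. 1 \<le> k \<and> lam k = \<mu>}))"

definition eigenvalue_mean :: "(nat \<Rightarrow> real) \<Rightarrow> nat \<Rightarrow> real" where
  "eigenvalue_mean lam k = (1 / real k) * (\<Sum>l=1..k. lam l)"

end

theory Submission
  imports Defs "HOL-Library.Function_Algebras"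
begin

text \<open>
  Let $u_i$ be orthonormal eigenfunctions. Inserting the trial functions
  $x_b u_i - \sum_j \langle x_b u_i, u_j\rangle u_j$ into the Rayleigh quotient yields Yang's
  inequality $\sum_{i\le n} (z - \lambda_i)^2 \le \frac4d \sum_{i\le n} (z - \lambda_i) \lambda_i$
  for $\lambda_n \le z \le \lambda_{n+1}$. With the Riesz means
  $R_\sigma(z) = \sum_i (z - \lambda_i)_+^\sigma$ it says $z R_1 \ge (1 + d/4) R_2$, and since
  $R_2' = 2 R_1$ the quotient $R_2(z) / z^{2 + d/2}$ is nondecreasing. Bounding $R_2$ from below at
  $z_0 = (1 + 4/d)\,\overline{\lambda_j}$ by convexity gives a lower bound for $R_1$ of order
  $z^{1 + d/2}$, and its Legendre transform is an upper bound for $k \overline{\lambda_k}$.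

  The Rayleigh quotient on the orthogonal complement of finitely many eigenfunctions attains its
  infimum: a Poincare inequality on small cells controls the $L^2$ norm by finitely many functionals
  up to a small multiple of the energy, which makes suitable minimizing sequences Cauchy sequences in $H^1_0$.
\<close>

section \<open>Semi-inner products and the variational characterization of eigenvalues\<close>

text \<open>The eigenvalues are given only through their multiplicities, so no basis of
  eigenfunctions and no min-max principle is at hand. Yang's inequality requires that the Rayleigh
  quotient on the complement of the first \<open>n\<close> eigenfunctions be at least
  \<open>lam (Suc n)\<close>. This holds because a minimizer there is itself an eigenfunction, and
  the multiplicity count leaves it no smaller eigenvalue. The trial functions work because the
  commutator of the negative Laplacian with x_b is -2 times the partial derivative. The terms
  produced by the subtracted projections are antisymmetric in the two indices after weighting with
  \<open>z - l i\<close>, hence cancel in the double sum. The point z_0 maximizes (z - m)^2 / z^(2 +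
  d/2), where m is the mean of the first j eigenvalues, so it gives the largest constant in the
  lower bound. Functions that agree almost everywhere remain distinct objects. Therefore all forms
  are only semidefinite, and independence, span and dimension are meant up to null vectors.\<close>

instantiation "fun" :: (type, scaleR) scaleR
begin
definition "scaleR c f = (\<lambda>x. c *\<^sub>R f x)"
instance ..
end

lemma scaleR_fun_apply [simp]: "(c *\<^sub>R f) x = c *\<^sub>R f x"
  by (simp add: scaleR_fun_def)

text \<open>Makes function spaces admissible as carriers of the abstract locales below, with
  pointwise operations.\<close>

instance "fun" :: (type, real_vector) real_vector
  by standard (auto simp: fun_eq_iff algebra_simps)

lemma sum_fun_apply: "(\<Sum>i\<in>I. f i) x = (\<Sum>i\<in>I. f i x)"
  by (induction I rule: infinite_finite_induct) auto

text \<open>Gaussian elimination by induction on the equations: a nonzero pivot removes one equation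
  and one unknown, and an equation without pivot holds for every choice of \<open>c\<close>.\<close>

lemma homogeneous_system_nontrivial:
  fixes M :: "'i \<Rightarrow> 'j \<Rightarrow> real"
  assumes "finite I" "finite A" "card I < card A"
  shows "\<exists>c. (\<exists>j\<in>A. c j \<noteq> 0) \<and> (\<forall>i\<in>I. (\<Sum>j\<in>A. c j * M i j) = 0)"
  using assms
proof (induction I arbitrary: A M rule: finite_induct)
  case empty
  then obtain j where "j \<in> A" by fastforce
  then show ?case by (intro exI[of _ "\<lambda>_. 1"]) auto
next
  case (insert i0 I)
  show ?case
  proof (cases "\<forall>j\<in>A. M i0 j = 0")
    case True
    with insert.IH[of A M] insert.prems insert.hyps show ?thesis by auto
  next
    case False
    then obtain p where p: "p \<in> A" "M i0 p \<noteq> 0" by auto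
    define A' where "A' = A - {p}"
    have A': "finite A'" "card I < card A'" "p \<notin> A'" "A = insert p A'"
      using insert p by (auto simp: A'_def)
    from insert.IH[OF A'(1,2), of "\<lambda>i j. M i j - M i p * M i0 j / M i0 p"]
    obtain c where c: "\<exists>j\<in>A'. c j \<noteq> 0"
      and eq: "\<And>i. i \<in> I \<Longrightarrow> (\<Sum>j\<in>A'. c j * (M i j - M i p * M i0 j / M i0 p)) = 0" by blast
    define T where "T = (\<Sum>j\<in>A'. c j * M i0 j)"
    \<comment> \<open>The value at the pivot index is the one that solves equation
      \<open>i0\<close>.\<close>
    define c' where "c' = c(p := - T / M i0 p)"
    have S: "(\<Sum>j\<in>A. c' j * M i j) = (\<Sum>j\<in>A'. c j * M i j) - T / M i0 p * M i p" for i
    proof -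
      have "(\<Sum>j\<in>A'. c' j * M i j) = (\<Sum>j\<in>A'. c j * M i j)"
        by (rule sum.cong) (use A' in \<open>auto simp: c'_def\<close>)
      then show ?thesis using A' by (simp add: c'_def)
    qed
    have "(\<Sum>j\<in>A. c' j * M i j) = 0" if "i \<in> insert i0 I" for i
    proof (cases "i = i0")
      case True
      then show ?thesis using p by (simp add: S T_def)
    next
      case False
      then have "i \<in> I" using that by auto
      from eq[OF this] have "(\<Sum>j\<in>A'. c j * M i j) = (\<Sum>j\<in>A'. (M i p / M i0 p) * (c j * M i0 j))"
        by (simp add: algebra_simps sum_subtractf)
      also have "\<dots> = M i p / M i0 p * T" by (simp add: T_def sum_distrib_left)
      finally show ?thesis by (simp add: S)
    qed
    moreover have "\<exists>j\<in>A. c' j \<noteq> 0"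
    proof -
      from c obtain j where "j \<in> A'" "c j \<noteq> 0" by blast
      then show ?thesis using A' by (intro bexI[of _ j]) (auto simp: c'_def)
    qed
    ultimately show ?thesis by blast
  qed
qed

text \<open>The carrier is a set, so that subspaces such as orthogonal complements inherit the
  theory. Definiteness is not demanded because functions vanishing almost everywhere have square
  0.\<close>

locale semi_inner =
  fixes S :: "'h::real_vector set" and s :: "'h \<Rightarrow> 'h \<Rightarrow> real"
  assumes subspace: "subspace S"
    and add_left: "\<lbrakk>x \<in> S; y \<in> S; z \<in> S\<rbrakk> \<Longrightarrow> s (x + y) z = s x z + s y z"
    and scale_left: "\<lbrakk>x \<in> S; z \<in> S\<rbrakk> \<Longrightarrow> s (c *\<^sub>R x) z = c * s x z"
    and commute: "\<lbrakk>x \<in> S; y \<in> S\<rbrakk> \<Longrightarrow> s x y = s y x"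
    and nonneg: "x \<in> S \<Longrightarrow> 0 \<le> s x x"
begin

lemma mem [simp]:
  "0 \<in> S" "x \<in> S \<Longrightarrow> y \<in> S \<Longrightarrow> x + y \<in> S" "x \<in> S \<Longrightarrow> y \<in> S \<Longrightarrow> x - y \<in> S"
  "x \<in> S \<Longrightarrow> c *\<^sub>R x \<in> S"
  using subspace by (auto simp: subspace_0 subspace_add subspace_diff subspace_scale)

lemma mem_sum [simp]: "(\<And>i. i \<in> I \<Longrightarrow> f i \<in> S) \<Longrightarrow> (\<Sum>i\<in>I. f i) \<in> S"
  using subspace by (rule subspace_sum)

lemma add_right: "\<lbrakk>x \<in> S; y \<in> S; z \<in> S\<rbrakk> \<Longrightarrow> s z (x + y) = s z x + s z y"
  by (simp add: add_left commute[of z])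

lemma scale_right: "\<lbrakk>x \<in> S; z \<in> S\<rbrakk> \<Longrightarrow> s z (c *\<^sub>R x) = c * s z x"
  by (simp add: scale_left commute[of z])

lemma diff_left: "\<lbrakk>x \<in> S; y \<in> S; z \<in> S\<rbrakk> \<Longrightarrow> s (x - y) z = s x z - s y z"
  using add_left[of x "(-1) *\<^sub>R y" z] scale_left[of y z "-1"] mem(4)[of y "-1"] by simp

lemma diff_right: "\<lbrakk>x \<in> S; y \<in> S; z \<in> S\<rbrakk> \<Longrightarrow> s z (x - y) = s z x - s z y"
  by (simp add: diff_left commute[of z])

lemma zero_left [simp]: "z \<in> S \<Longrightarrow> s 0 z = 0"
  using scale_left[of 0 z 0] by simp

lemma zero_right [simp]: "z \<in> S \<Longrightarrow> s z 0 = 0"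
  using scale_right[of 0 z 0] by simp

lemma sum_left:
  "\<lbrakk>\<And>i. i \<in> I \<Longrightarrow> f i \<in> S; z \<in> S\<rbrakk> \<Longrightarrow> s (\<Sum>i\<in>I. f i) z = (\<Sum>i\<in>I. s (f i) z)"
proof (induction I rule: infinite_finite_induct)
  case (insert i I)
  then show ?case by (simp add: add_left mem_sum)
qed auto

lemma sum_right:
  "\<lbrakk>\<And>i. i \<in> I \<Longrightarrow> f i \<in> S; z \<in> S\<rbrakk> \<Longrightarrow> s z (\<Sum>i\<in>I. f i) = (\<Sum>i\<in>I. s z (f i))"
proof (induction I rule: infinite_finite_induct)
  case (insert i I)
  then show ?case by (simp add: add_right mem_sum)
qed auto

lemma square_add:
  "\<lbrakk>x \<in> S; y \<in> S\<rbrakk> \<Longrightarrow> s (x + y) (x + y) = s x x + 2 * s x y + s y y"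
  by (simp add: add_left add_right commute[of y x])

lemma square_diff:
  "\<lbrakk>x \<in> S; y \<in> S\<rbrakk> \<Longrightarrow> s (x - y) (x - y) = s x x - 2 * s x y + s y y"
  by (simp add: diff_left diff_right commute[of y x])

lemma square_scale: "x \<in> S \<Longrightarrow> s (c *\<^sub>R x) (c *\<^sub>R x) = c\<^sup>2 * s x x"
  by (simp add: scale_left scale_right power2_eq_square)

lemma Cauchy_Schwarz:
  assumes x: "x \<in> S" and y: "y \<in> S"
  shows "(s x y)\<^sup>2 \<le> s x x * s y y"
proof -
  have q: "0 \<le> s x x + 2 * (t * s x y) + t\<^sup>2 * s y y" for t
    using nonneg[of "x + t *\<^sub>R y"] x y
    by (simp add: square_add scale_left scale_right power2_eq_square mult.assoc)
  show ?thesis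
  proof (cases "s y y = 0")
    case True
    have "s x y = 0"
    proof (rule ccontr)
      assume "s x y \<noteq> 0"
      \<comment> \<open>With \<open>s y y = 0\<close> the quadratic is affine in \<open>t\<close>,
        so a nonzero slope would make it negative; this \<open>t\<close> yields the value
        -1.\<close>
      then have "2 * (- (s x x + 1) / (2 * s x y) * s x y) = - (s x x + 1)" by simp
      with q[of "- (s x x + 1) / (2 * s x y)"] True show False by simp
    qed
    then show ?thesis using True by simp
  next
    case False
    then have pos: "s y y > 0" using nonneg[OF y] by simp
    with q[of "- s x y / s y y"] show ?thesis
      by (simp add: power2_eq_square field_simps)
  qed
qed

text \<open>The substitute for definiteness: null vectors are invisible to the form. Applied to
  \<open>a - \<mu> s\<close> it becomes the Euler-Lagrange equation of a minimizer.\<close>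

lemma null_orthogonal: "\<lbrakk>x \<in> S; s x x = 0; y \<in> S\<rbrakk> \<Longrightarrow> s x y = 0"
  using Cauchy_Schwarz[of x y] by simp

text \<open>Parallelogram identity for \<open>x - z\<close> and \<open>y - z\<close>, with the
  square of their sum dropped.\<close>

lemma square_diff_le:
  assumes "x \<in> S" "y \<in> S" "z \<in> S"
  shows "s (x - y) (x - y) \<le> 2 * s (x - z) (x - z) + 2 * s (y - z) (y - z)"
proof -
  have "0 \<le> s ((x - z) + (y - z)) ((x - z) + (y - z))" using assms by (intro nonneg) auto
  also have "\<dots> = 2 * s (x - z) (x - z) + 2 * s (y - z) (y - z) - s (x - y) (x - y)"
    using assms square_add[of "x - z" "y - z"] square_diff[of "x - z" "y - z"] by simp
  finally show ?thesis by simp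
qed

lemma square_add_le:
  assumes "x \<in> S" "y \<in> S"
  shows "s (x + y) (x + y) \<le> 2 * s x x + 2 * s y y"
  using nonneg[of "x - y"] assms by (simp add: square_add square_diff)

lemma tendsto_inner:
  assumes v: "\<And>n. v n \<in> S" and w: "w \<in> S" and y: "y \<in> S"
    and lim: "(\<lambda>n. s (v n - w) (v n - w)) \<longlonglongrightarrow> 0"
  shows "(\<lambda>n. s (v n) y) \<longlonglongrightarrow> s w y"
proof -
  have "s (v n) y - s w y = s (v n - w) y" for n
    using v w y by (simp add: diff_left)
  then have bound: "norm (s (v n) y - s w y) \<le> sqrt (s (v n - w) (v n - w) * s y y)" for n
    using Cauchy_Schwarz[of "v n - w" y] v w y by (simp add: real_le_rsqrt)
  have "(\<lambda>n. sqrt (s (v n - w) (v n - w) * s y y)) \<longlonglongrightarrow> sqrt (0 * s y y)"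
    by (intro tendsto_intros lim)
  then have "(\<lambda>n. s (v n) y - s w y) \<longlonglongrightarrow> 0"
    by (intro Lim_null_comparison[OF always_eventually[OF allI[OF bound]]]) simp
  then show ?thesis by (rule LIM_zero_cancel)
qed

lemma tendsto_square:
  assumes v: "\<And>n. v n \<in> S" and w: "w \<in> S"
    and lim: "(\<lambda>n. s (v n - w) (v n - w)) \<longlonglongrightarrow> 0"
  shows "(\<lambda>n. s (v n) (v n)) \<longlonglongrightarrow> s w w"
proof -
  have "s (v n) (v n) = s (v n - w) (v n - w) + 2 * s (v n) w - s w w" for n
    using v w by (simp add: square_diff)
  moreover have "(\<lambda>n. s (v n - w) (v n - w) + 2 * s (v n) w - s w w) \<longlonglongrightarrow> 0 + 2 * s w w - s w w"
    by (intro tendsto_intros lim tendsto_inner v w)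
  ultimately show ?thesis by simp
qed

lemma restrict:
  assumes T: "T \<subseteq> S" "subspace T"
  shows "semi_inner T s"
proof (rule semi_inner.intro)
  note TS = subsetD[OF T(1)]
  show "subspace T" by fact
  show "s (x + y) z = s x z + s y z" if "x \<in> T" "y \<in> T" "z \<in> T" for x y z
    using that[THEN TS] by (rule add_left)
  show "s (c *\<^sub>R x) z = c * s x z" if "x \<in> T" "z \<in> T" for x z c
    using that[THEN TS] by (rule scale_left)
  show "s x y = s y x" if "x \<in> T" "y \<in> T" for x y
    using that[THEN TS] by (rule commute)
  show "0 \<le> s x x" if "x \<in> T" for x
    using that[THEN TS] by (rule nonneg)
qed

lemma orthonormal_coeff:
  assumes I: "finite I" and u: "\<And>i. i \<in> I \<Longrightarrow> u i \<in> S"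
    and orth: "\<And>i j. i \<in> I \<Longrightarrow> j \<in> I \<Longrightarrow> s (u i) (u j) = (if i = j then 1 else 0)"
    and j: "j \<in> I"
  shows "s (\<Sum>i\<in>I. c i *\<^sub>R u i) (u j) = c j"
proof -
  have "s (\<Sum>i\<in>I. c i *\<^sub>R u i) (u j) = (\<Sum>i\<in>I. c i * s (u i) (u j))"
    using u j by (subst sum_left) (auto intro!: sum.cong simp: scale_left)
  also have "\<dots> = (\<Sum>i\<in>I. if i = j then c i else 0)"
    using orth j by (intro sum.cong) auto
  finally show ?thesis using I j by simp
qed

end

section \<open>Minimizers of the Rayleigh quotient\<close>

lemma convergent_subsequence_finite_family:
  fixes f :: "nat \<Rightarrow> nat \<Rightarrow> real"
  assumes "\<And>i. i < N \<Longrightarrow> bounded (range (f i))"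
  shows "\<exists>r. strict_mono (r :: nat \<Rightarrow> nat) \<and> (\<forall>i<N. convergent (\<lambda>n. f i (r n)))"
  using assms
proof (induction N)
  case 0
  show ?case by (intro exI[of _ id]) (auto simp: strict_mono_def)
next
  case (Suc N)
  then obtain r where r: "strict_mono r" "\<forall>i<N. convergent (\<lambda>n. f i (r n))" by auto
  \<comment> \<open>One refinement per index is enough, since passing to a further subsequence
    preserves the limits already obtained.\<close>
  have "bounded (range (f N \<circ> r))"
    using Suc.prems[of N] by (rule bounded_subset) auto
  then obtain l r' where r': "strict_mono r'" "((f N \<circ> r) \<circ> r') \<longlonglongrightarrow> l"
    using bounded_imp_convergent_subsequence by blast
  have "convergent (\<lambda>n. f i (r (r' n)))" if "i < Suc N" for i
  proof (cases "i = N")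
    case True
    then show ?thesis using r'(2) by (auto simp: convergent_def o_def)
  next
    case False
    then have "convergent (\<lambda>n. f i (r n))" using r that by auto
    from convergent_subseq_convergent[OF this r'(1)] show ?thesis by (simp add: o_def)
  qed
  moreover have "strict_mono (\<lambda>n. r (r' n))" using r(1) r'(1) by (simp add: strict_mono_def)
  ultimately show ?case by blast
qed

text \<open>For a lower bound \<open>\<mu>\<close> of the Rayleigh quotient the shifted form is
  again a semi-inner product, so the Cauchy-Schwarz inequality and the parallelogram identity apply
  to it.\<close>

lemma semi_inner_shift:
  assumes "semi_inner T s" "semi_inner T a"
    and low: "\<And>w. w \<in> T \<Longrightarrow> \<mu> * s w w \<le> a w w"
  shows "semi_inner T (\<lambda>x y. a x y - \<mu> * s x y)"
proof -
  interpret s: semi_inner T s by fact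
  interpret a: semi_inner T a by fact
  show ?thesis
  proof (rule semi_inner.intro)
    show "subspace T" by (rule s.subspace)
    show "a (x + y) z - \<mu> * s (x + y) z = a x z - \<mu> * s x z + (a y z - \<mu> * s y z)"
      if "x \<in> T" "y \<in> T" "z \<in> T" for x y z
      using that by (simp add: s.add_left a.add_left algebra_simps)
    show "a (c *\<^sub>R x) z - \<mu> * s (c *\<^sub>R x) z = c * (a x z - \<mu> * s x z)"
      if "x \<in> T" "z \<in> T" for x z c
      using that by (simp add: s.scale_left a.scale_left algebra_simps)
    show "a x y - \<mu> * s x y = a y x - \<mu> * s y x" if "x \<in> T" "y \<in> T" for x y
      using that by (simp add: s.commute[of x y] a.commute[of x y])
    show "0 \<le> a x x - \<mu> * s x x" if "x \<in> T" for x
      using low[OF that] by simp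
  qed
qed

text \<open>\<open>complete\<close> says that the energy form is closed. \<open>compact\<close> is a
  quantitative version of the compact embedding: up to a small multiple of the energy, the norm is
  controlled by finitely many bounded functionals.\<close>

locale form_pair = s: semi_inner X s + a: semi_inner X a
  for X :: "'h::real_vector set" and s a :: "'h \<Rightarrow> 'h \<Rightarrow> real" +
  assumes complete: "\<And>v. \<lbrakk>\<And>n::nat. v n \<in> X;
      \<And>e. e > 0 \<Longrightarrow> \<exists>N. \<forall>m\<ge>N. \<forall>n\<ge>N. s (v m - v n) (v m - v n) + a (v m - v n) (v m - v n) < e\<rbrakk>
      \<Longrightarrow> \<exists>w\<in>X. (\<lambda>n. s (v n - w) (v n - w) + a (v n - w) (v n - w)) \<longlonglongrightarrow> 0"
    and compact: "\<And>e. e > 0 \<Longrightarrow> \<exists>(N::nat) L C.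
      (\<forall>i<N. \<forall>x\<in>X. \<forall>y\<in>X. L i (x - y) = L i x - L i y) \<and>
      (\<forall>i<N. \<forall>x\<in>X. \<bar>L i x\<bar> \<le> C * sqrt (s x x)) \<and>
      (\<forall>x\<in>X. s x x \<le> (\<Sum>i<N. (L i x)\<^sup>2) + e * a x x)"
begin

text \<open>For a minimizing sequence, the parallelogram identity for the form \<open>a - \<mu> s\<close> makes the shifted
  energy of the differences small; once the finitely many functionals of the axiom \<open>compact\<close> converge
  along a subsequence, that axiom makes the differences small in \<open>s\<close> as well.\<close>

lemma rayleigh_minimizer:
  assumes W: "W \<subseteq> X" "subspace W"
    and closed: "\<And>w x. \<lbrakk>\<And>n::nat. w n \<in> W; x \<in> X; (\<lambda>n. s (w n - x) (w n - x)) \<longlonglongrightarrow> 0\<rbrakk> \<Longrightarrow> x \<in> W"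
    and w0: "w0 \<in> W" "s w0 w0 > 0"
  shows "\<exists>v\<in>W. s v v = 1 \<and> (\<forall>w\<in>W. a v v * s w w \<le> a w w)"
proof -
  note WX = subsetD[OF W(1)]
  define R where "R = {a w w |w. w \<in> W \<and> s w w = 1}"
  define \<mu> where "\<mu> = Inf R"
  have scaleW: "c *\<^sub>R w \<in> W" if "w \<in> W" for c w
    using W(2) that by (rule subspace_scale)
  have normalize: "s ((1 / sqrt (s w w)) *\<^sub>R w) ((1 / sqrt (s w w)) *\<^sub>R w) = 1"
    "a ((1 / sqrt (s w w)) *\<^sub>R w) ((1 / sqrt (s w w)) *\<^sub>R w) = a w w / s w w"
    if "w \<in> W" "s w w > 0" for w
    using that WX[OF that(1)] by (simp_all add: s.square_scale a.square_scale power_divide)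
  have ne: "R \<noteq> {}" using normalize[OF w0] scaleW[OF w0(1)] unfolding R_def by blast
  have bdd: "bdd_below R" unfolding R_def by (rule bdd_belowI[of _ 0]) (auto simp: a.nonneg WX)
  have mu0: "0 \<le> \<mu>" unfolding \<mu>_def using ne by (rule cInf_greatest) (auto simp: R_def a.nonneg WX)
  have low: "\<mu> * s w w \<le> a w w" if w: "w \<in> W" for w
  proof (cases "s w w = 0")
    case True
    then show ?thesis using a.nonneg[OF WX[OF w]] by simp
  next
    case False
    then have pos: "s w w > 0" using s.nonneg[OF WX[OF w]] by simp
    have "a w w / s w w \<in> R"
      unfolding R_def using normalize[OF w pos] scaleW[OF w, of "1 / sqrt (s w w)"] by force
    then have "\<mu> \<le> a w w / s w w" unfolding \<mu>_def using bdd by (rule cInf_lower)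
    then show ?thesis using pos by (simp add: field_simps)
  qed
  interpret sW: semi_inner W s by (rule s.restrict[OF W])
  interpret aW: semi_inner W a by (rule a.restrict[OF W])
  interpret q: semi_inner W "\<lambda>x y. a x y - \<mu> * s x y"
    by (rule semi_inner_shift[OF sW.semi_inner_axioms aW.semi_inner_axioms low])
  have "\<exists>w\<in>W. s w w = 1 \<and> a w w < \<mu> + 1 / Suc n" for n
    using cInf_lessD[OF ne, of "\<mu> + 1 / Suc n"] unfolding \<mu>_def R_def by auto
  then obtain v where v: "\<And>n. v n \<in> W" "\<And>n. s (v n) (v n) = 1" "\<And>n. a (v n) (v n) < \<mu> + 1 / Suc n"
    by metis
  \<comment> \<open>Small enough that, after splitting \<open>e * a d d\<close> into
    \<open>e * (a d d - \<mu> * s d d)\<close> and \<open>e * \<mu> * s d d\<close>, the second part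
    is at most half of \<open>s d d\<close> and can be absorbed.\<close>
  define e where "e = 1 / (2 * (\<mu> + 1))"
  have e: "e > 0" "e * \<mu> \<le> 1/2" "e \<le> 1/2" using mu0 by (auto simp: e_def field_simps)
  obtain N L C where L: "\<And>i x y. i < N \<Longrightarrow> x \<in> X \<Longrightarrow> y \<in> X \<Longrightarrow> L i (x - y) = L i x - L i y"
    "\<And>i x. i < (N::nat) \<Longrightarrow> x \<in> X \<Longrightarrow> \<bar>L i x\<bar> \<le> C * sqrt (s x x)"
    "\<And>x. x \<in> X \<Longrightarrow> s x x \<le> (\<Sum>i<N. (L i x)\<^sup>2) + e * a x x"
    using compact[OF e(1)] by blast
  have "bounded (range (\<lambda>n. L i (v n)))" if "i < N" for i
    unfolding bounded_iff using L(2)[OF that WX[OF v(1)]] v(2) by (intro exI[of _ C]) auto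
  then obtain r where r: "strict_mono r" "\<And>i. i < N \<Longrightarrow> convergent (\<lambda>n. L i (v (r n)))"
    using convergent_subsequence_finite_family[of N "\<lambda>i n. L i (v n)"] by blast
  define l where "l i = lim (\<lambda>n. L i (v (r n)))" for i
  have l: "(\<lambda>n. L i (v (r n))) \<longlonglongrightarrow> l i" if "i < N" for i
    using r(2)[OF that] by (simp add: l_def convergent_LIMSEQ_iff)
  \<comment> \<open>Collects both errors of the n-th term: the distance of the functionals from
    their limits, and the bound \<open>1 / Suc n\<close> for its energy excess over
    \<open>\<mu>\<close>.\<close>
  define g where "g n = (\<Sum>i<N. (L i (v (r n)) - l i)\<^sup>2) + 1 / Suc n" for n
  have "g \<longlonglongrightarrow> (\<Sum>i<N. (l i - l i)\<^sup>2) + 0"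
    unfolding g_def using l
    by (intro tendsto_intros LIMSEQ_Suc[OF lim_1_over_n]) auto
  then have g0: "g \<longlonglongrightarrow> 0" by simp
  define u where "u n = v (r n)" for n
  have u: "u n \<in> W" "u n \<in> X" "s (u n) (u n) = 1" for n using v WX by (auto simp: u_def)
  have qu: "a (u n) (u n) - \<mu> * s (u n) (u n) \<le> 1 / Suc n" for n
  proof -
    have "a (u n) (u n) - \<mu> * s (u n) (u n) \<le> 1 / Suc (r n)"
      using v(3)[of "r n"] by (simp add: u_def v(2))
    also have "\<dots> \<le> 1 / Suc n"
      using seq_suble[OF r(1), of n] by (simp add: frac_le)
    finally show ?thesis .
  qed
  \<comment> \<open>The constant comes from \<open>s d d + a d d = (1 + \<mu>) * s d d + (a d d -
    \<mu> * s d d)\<close>, where \<open>s d d\<close> is at most 4 times and the shifted energy at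
    most 2 times \<open>g m + g n\<close>.\<close>
  have key: "s (u m - u n) (u m - u n) + a (u m - u n) (u m - u n) \<le> (6 + 4 * \<mu>) * (g m + g n)" for m n
  proof -
    define d where "d = u m - u n"
    have d: "d \<in> W" "d \<in> X" using u by (auto simp: d_def)
    have "a d d - \<mu> * s d d \<le> 2 * (a (u m) (u m) - \<mu> * s (u m) (u m)) + 2 * (a (u n) (u n) - \<mu> * s (u n) (u n))"
      using q.square_diff_le[of "u m" "u n" 0] u by (simp add: d_def)
    then have qd: "a d d - \<mu> * s d d \<le> 2 * (1 / Suc m + 1 / Suc n)"
      using qu[of m] qu[of n] by argo
    have "(\<Sum>i<N. (L i d)\<^sup>2) \<le> (\<Sum>i<N. 2 * (L i (u m) - l i)\<^sup>2 + 2 * (L i (u n) - l i)\<^sup>2)"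
    proof (rule sum_mono)
      fix i assume "i \<in> {..<N}"
      then have "L i d = (L i (u m) - l i) - (L i (u n) - l i)" using L(1) u by (simp add: d_def)
      also have "\<dots>\<^sup>2 \<le> 2 * (L i (u m) - l i)\<^sup>2 + 2 * (L i (u n) - l i)\<^sup>2"
        using zero_le_power2[of "(L i (u m) - l i) + (L i (u n) - l i)"]
        by (simp add: power2_eq_square algebra_simps)
      finally show "(L i d)\<^sup>2 \<le> 2 * (L i (u m) - l i)\<^sup>2 + 2 * (L i (u n) - l i)\<^sup>2" .
    qed
    also have "\<dots> = 2 * (g m + g n) - 2 * (1 / Suc m + 1 / Suc n)"
      by (simp add: g_def u_def sum.distrib sum_distrib_left[symmetric])
    finally have Ld: "(\<Sum>i<N. (L i d)\<^sup>2) \<le> 2 * (g m + g n) - 2 * (1 / Suc m + 1 / Suc n)" .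
    have h0: "0 \<le> 1 / real (Suc m) + 1 / real (Suc n)" by simp
    have qdg: "a d d - \<mu> * s d d \<le> 2 * (g m + g n)"
    proof -
      have "1 / real (Suc k) \<le> g k" for k unfolding g_def by (simp add: sum_nonneg)
      from this[of m] this[of n] qd show ?thesis by argo
    qed
    have s0: "0 \<le> s d d" and q0: "0 \<le> a d d - \<mu> * s d d" using d low s.nonneg by auto
    have "s d d \<le> (\<Sum>i<N. (L i d)\<^sup>2) + e * (a d d - \<mu> * s d d) + (e * \<mu>) * s d d"
      using L(3)[OF d(2)] by (simp add: algebra_simps)
    also have "\<dots> \<le> (\<Sum>i<N. (L i d)\<^sup>2) + (1/2) * (a d d - \<mu> * s d d) + (1/2) * s d d"
      using e s0 q0 by (intro add_mono mult_right_mono) auto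
    finally have "s d d \<le> 2 * (\<Sum>i<N. (L i d)\<^sup>2) + (a d d - \<mu> * s d d)" by argo
    with Ld qd h0 have sd: "s d d \<le> 4 * (g m + g n)" by argo
    have "(1 + \<mu>) * s d d \<le> (1 + \<mu>) * (4 * (g m + g n))" using mu0 sd by (intro mult_left_mono) auto
    moreover have "s d d + a d d = (1 + \<mu>) * s d d + (a d d - \<mu> * s d d)" by (simp add: algebra_simps)
    ultimately show ?thesis using qdg unfolding d_def[symmetric] by (simp add: algebra_simps)
  qed
  have "\<exists>M. \<forall>m\<ge>M. \<forall>n\<ge>M. s (u m - u n) (u m - u n) + a (u m - u n) (u m - u n) < \<epsilon>" if "\<epsilon> > 0" for \<epsilon>
  proof -
    have "\<epsilon> / (2 * (6 + 4 * \<mu>)) > 0" using that mu0 by simp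
    from LIMSEQ_D[OF g0 this] obtain M where M: "\<And>n. n \<ge> M \<Longrightarrow> g n < \<epsilon> / (2 * (6 + 4 * \<mu>))"
      by (auto simp: abs_less_iff)
    show ?thesis
    proof (intro exI[of _ M] allI impI)
      fix m n assume "M \<le> m" "M \<le> n"
      then have "g m + g n < \<epsilon> / (2 * (6 + 4 * \<mu>)) + \<epsilon> / (2 * (6 + 4 * \<mu>))"
        using M[of m] M[of n] by (intro add_strict_mono) auto
      also have "\<dots> = \<epsilon> / (6 + 4 * \<mu>)" using mu0 by (simp add: divide_simps)
      finally have "(6 + 4 * \<mu>) * (g m + g n) < \<epsilon>" using mu0 by (simp add: field_simps)
      with key[of m n] show "s (u m - u n) (u m - u n) + a (u m - u n) (u m - u n) < \<epsilon>" by simp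
    qed
  qed
  then have "\<exists>w\<in>X. (\<lambda>n. s (u n - w) (u n - w) + a (u n - w) (u n - w)) \<longlonglongrightarrow> 0"
    by (intro complete u(2)) auto
  then obtain w where w: "w \<in> X" "(\<lambda>n. s (u n - w) (u n - w) + a (u n - w) (u n - w)) \<longlonglongrightarrow> 0" by blast
  have sw: "(\<lambda>n. s (u n - w) (u n - w)) \<longlonglongrightarrow> 0"
    by (rule tendsto_sandwich[OF always_eventually always_eventually tendsto_const w(2)])
      (simp_all add: s.nonneg a.nonneg u w(1))
  have aw: "(\<lambda>n. a (u n - w) (u n - w)) \<longlonglongrightarrow> 0"
    by (rule tendsto_sandwich[OF always_eventually always_eventually tendsto_const w(2)])
      (simp_all add: s.nonneg a.nonneg u w(1))
  have wW: "w \<in> W" by (rule closed[OF u(1) w(1) sw])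
  have s1: "s w w = 1"
    using s.tendsto_square[OF u(2) w(1) sw] by (simp add: u(3) LIMSEQ_const_iff)
  have "a w w \<le> \<mu>"
  proof (rule LIMSEQ_le[OF a.tendsto_square[OF u(2) w(1) aw]])
    have "(\<lambda>n. \<mu> + 1 / real (Suc n)) \<longlonglongrightarrow> \<mu> + 0"
      by (intro tendsto_intros LIMSEQ_Suc[OF lim_1_over_n])
    then show "(\<lambda>n. \<mu> + 1 / real (Suc n)) \<longlonglongrightarrow> \<mu>" by simp
    show "\<exists>N. \<forall>n\<ge>N. a (u n) (u n) \<le> \<mu> + 1 / real (Suc n)"
    proof (intro exI[of _ 0] allI impI)
      show "a (u n) (u n) \<le> \<mu> + 1 / real (Suc n)" for n using qu[of n] u(3) by simp
    qed
  qed
  then have "\<forall>x\<in>W. a w w * s x x \<le> a x x"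
    using low mult_right_mono[OF _ sW.nonneg] order_trans by blast
  then show ?thesis using wW s1 by blast
qed

text \<open>Weak formulation: eigenvectors are defined through the forms alone, tested against the
  whole form domain, so that no operator is involved.\<close>

definition eigenspace :: "real \<Rightarrow> 'h set" where
  "eigenspace \<mu> = {v \<in> X. \<forall>w\<in>X. a v w = \<mu> * s v w}"

lemma eigenspace_mem: "v \<in> eigenspace \<mu> \<Longrightarrow> v \<in> X"
  by (simp add: eigenspace_def)

lemma eigenspaceD: "v \<in> eigenspace \<mu> \<Longrightarrow> w \<in> X \<Longrightarrow> a v w = \<mu> * s v w"
  by (simp add: eigenspace_def)

lemma eigenspace_orthogonal:
  assumes "v \<in> eigenspace \<mu>" "w \<in> eigenspace \<nu>" "\<mu> \<noteq> \<nu>"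
  shows "s v w = 0"
proof -
  note [simp] = eigenspace_mem[OF assms(1)] eigenspace_mem[OF assms(2)]
  have "\<mu> * s v w = a v w" using eigenspaceD[OF assms(1)] by simp
  also have "\<dots> = a w v" by (simp add: a.commute)
  also have "\<dots> = \<nu> * s v w" using eigenspaceD[OF assms(2)] by (simp add: s.commute)
  finally show ?thesis using assms(3) by simp
qed

lemma subspace_eigenspace: "subspace (eigenspace \<mu>)"
  unfolding eigenspace_def
  by (rule subspaceI) (auto simp: s.add_left a.add_left s.scale_left a.scale_left algebra_simps)

text \<open>A minimizer on the complement of the \<open>u i\<close> solves the eigenvalue equation
  there, and hence on all of \<open>X\<close>, because the \<open>u i\<close> are eigenvectors
  orthogonal to it. Its Rayleigh quotient is then an eigenvalue, which \<open>none\<close> prevents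
  from lying below \<open>z\<close>.\<close>

theorem rayleigh_bound:
  assumes I: "finite I" and u: "\<And>i. i \<in> I \<Longrightarrow> u i \<in> eigenspace (l i)"
    and orth: "\<And>i j. i \<in> I \<Longrightarrow> j \<in> I \<Longrightarrow> s (u i) (u j) = (if i = j then 1 else 0)"
    and none: "\<And>\<mu> v. \<lbrakk>\<mu> < z; v \<in> eigenspace \<mu>; \<And>i. i \<in> I \<Longrightarrow> s v (u i) = 0\<rbrakk> \<Longrightarrow> s v v = 0"
    and w: "w \<in> X" "\<And>i. i \<in> I \<Longrightarrow> s w (u i) = 0"
  shows "z * s w w \<le> a w w"
proof -
  note uX = eigenspace_mem[OF u]
  define W where "W = {w \<in> X. \<forall>i\<in>I. s w (u i) = 0}"
  have WX: "W \<subseteq> X" by (auto simp: W_def)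
  have subW: "subspace W"
    unfolding W_def by (rule subspaceI) (auto simp: uX s.add_left s.scale_left)
  have wW: "w \<in> W" using w by (auto simp: W_def)
  interpret sW: semi_inner W s by (rule s.restrict[OF WX subW])
  interpret aW: semi_inner W a by (rule a.restrict[OF WX subW])
  show ?thesis
  proof (cases "s w w = 0")
    case True
    then show ?thesis using a.nonneg w by simp
  next
    case False
    then have pos: "s w w > 0" using s.nonneg[OF w(1)] by simp
    have closed: "x \<in> W" if seq: "\<And>n::nat. y n \<in> W" "x \<in> X" "(\<lambda>n. s (y n - x) (y n - x)) \<longlonglongrightarrow> 0" for y x
    proof -
      have "s x (u i) = 0" if i: "i \<in> I" for i
      proof -
        have y: "y n \<in> X" "s (y n) (u i) = 0" for n using seq(1)[of n] i by (auto simp: W_def)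
        from s.tendsto_inner[OF y(1) seq(2) uX[OF i] seq(3)]
        show ?thesis by (simp add: y(2) LIMSEQ_const_iff)
      qed
      then show ?thesis using seq(2) by (auto simp: W_def)
    qed
    have "\<exists>v\<in>W. s v v = 1 \<and> (\<forall>w\<in>W. a v v * s w w \<le> a w w)"
      by (rule rayleigh_minimizer[OF WX subW _ wW pos]) (rule closed)
    then obtain v where v: "v \<in> W" "s v v = 1" "\<And>w. w \<in> W \<Longrightarrow> a v v * s w w \<le> a w w"
      by blast
    define \<mu> where "\<mu> = a v v"
    have vX: "v \<in> X" and vu: "\<And>i. i \<in> I \<Longrightarrow> s v (u i) = 0" using v(1) by (auto simp: W_def)
    interpret q: semi_inner W "\<lambda>x y. a x y - \<mu> * s x y"
      by (rule semi_inner_shift[OF sW.semi_inner_axioms aW.semi_inner_axioms]) (simp add: v(3) \<mu>_def)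
    \<comment> \<open>The shifted form vanishes at \<open>v\<close>, so \<open>v\<close> is
      orthogonal to all of \<open>W\<close> with respect to it.\<close>
    have EW: "a v x = \<mu> * s v x" if "x \<in> W" for x
      using q.null_orthogonal[OF v(1) _ that] by (simp add: v(2) \<mu>_def)
    have "a v x = \<mu> * s v x" if x: "x \<in> X" for x
    proof -
      \<comment> \<open>Projection onto the span of the \<open>u i\<close>: the rest lies in
        \<open>W\<close>, and both forms vanish on \<open>v\<close> and \<open>p\<close>.\<close>
      define p where "p = (\<Sum>i\<in>I. s x (u i) *\<^sub>R u i)"
      have p: "p \<in> X" unfolding p_def by (intro s.mem_sum s.mem uX)
      have "s p (u j) = s x (u j)" if "j \<in> I" for j
        unfolding p_def by (rule s.orthonormal_coeff[OF I uX orth that])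
      then have W': "x - p \<in> W" using x p uX by (auto simp: W_def s.diff_left)
      have "a v (u i) = 0" if "i \<in> I" for i
        using eigenspaceD[OF u[OF that] vX] vu[OF that] vX uX[OF that]
        by (simp add: a.commute[of v] s.commute[of v])
      then have "a v p = 0" "s v p = 0"
        unfolding p_def using vX uX vu by (simp_all add: a.sum_right s.sum_right a.scale_right s.scale_right)
      then show ?thesis using EW[OF W'] x p vX by (simp add: a.diff_right s.diff_right)
    qed
    then have ev: "v \<in> eigenspace \<mu>" using vX by (simp add: eigenspace_def)
    have "z \<le> \<mu>"
    proof (rule ccontr)
      assume "\<not> z \<le> \<mu>"
      then have "s v v = 0" using none[OF _ ev vu] by simp
      then show False using v(2) by simp
    qed
    then have "z * s w w \<le> \<mu> * s w w" using pos by simp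
    also have "\<dots> \<le> a w w" using v(3)[OF wW] by (simp add: \<mu>_def)
    finally show ?thesis .
  qed
qed

end

section \<open>Orthonormal families and dimension up to null vectors\<close>

context semi_inner
begin

text \<open>Extension by counting: as long as fewer than \<open>m\<close> vectors are chosen,
  orthogonality to them is a homogeneous system with fewer equations than unknowns. Independence
  keeps a nontrivial solution from being a null vector, so it can be normalized.\<close>

lemma orthonormal_family_exists:
  assumes E: "E \<subseteq> S" "subspace E"
    and e: "\<And>i. i < m \<Longrightarrow> e i \<in> E"
    and indep: "\<And>c j. \<lbrakk>s (\<Sum>i<m. c i *\<^sub>R e i) (\<Sum>i<m. c i *\<^sub>R e i) = 0; j < m\<rbrakk> \<Longrightarrow> c j = 0"
    and B: "finite B" "card B \<le> m"
  shows "\<exists>u. (\<forall>i\<in>B. u i \<in> E) \<and> (\<forall>i\<in>B. \<forall>j\<in>B. s (u i) (u j) = (if i = j then 1 else 0))"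
  using B
proof (induction B rule: finite_induct)
  case (insert b B)
  then have "card B < m" by simp
  with insert obtain u where u: "\<And>i. i \<in> B \<Longrightarrow> u i \<in> E"
    "\<And>i j. \<lbrakk>i \<in> B; j \<in> B\<rbrakk> \<Longrightarrow> s (u i) (u j) = (if i = j then 1 else 0)" by auto
  note ES = subsetD[OF E(1)]
  obtain c j where c: "j < m" "c j \<noteq> 0" "\<And>i. i \<in> B \<Longrightarrow> (\<Sum>l<m. c l * s (e l) (u i)) = 0"
    using homogeneous_system_nontrivial[OF insert.hyps(1), of "{..<m}" "\<lambda>i l. s (e l) (u i)"]
      \<open>card B < m\<close> by auto
  define x where "x = (\<Sum>l<m. c l *\<^sub>R e l)"
  have xE: "x \<in> E" unfolding x_def using E(2) e by (intro subspace_sum subspace_scale) auto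
  have xu: "s x (u i) = 0" if "i \<in> B" for i
    unfolding x_def using c(3)[OF that] e u(1)[OF that] ES
    by (subst sum_left) (auto simp: scale_left)
  have "s x x \<noteq> 0" using indep[of c j] c unfolding x_def by blast
  then have pos: "s x x > 0" using nonneg[OF ES[OF xE]] by simp
  define y where "y = (1 / sqrt (s x x)) *\<^sub>R x"
  have y: "y \<in> E" unfolding y_def by (rule subspace_scale[OF E(2) xE])
  have y1: "s y y = 1" unfolding y_def square_scale[OF ES[OF xE]] using pos by (simp add: power_divide)
  have yu: "s y (u i) = 0" "s (u i) y = 0" if "i \<in> B" for i
    using xu[OF that] ES[OF xE] ES[OF u(1)[OF that]] ES[OF y] commute[of "u i" y]
    by (auto simp: y_def scale_left)
  then show ?case
    using insert.hyps y y1 yu u by (intro exI[of _ "u(b := y)"]) auto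
qed auto

text \<open>With more than \<open>m\<close> vectors, their coordinates with respect to the
  \<open>e i\<close> satisfy a nontrivial linear relation. Up to null vectors this is a relation
  between the \<open>u i\<close>, and testing it against \<open>u j\<close> annihilates its
  coefficient \<open>c j\<close>.\<close>

lemma orthonormal_card_le:
  assumes E: "E \<subseteq> S"
    and e: "\<And>i. i < m \<Longrightarrow> e i \<in> E"
    and span: "\<And>v. v \<in> E \<Longrightarrow> \<exists>c. s (v - (\<Sum>i<m. c i *\<^sub>R e i)) (v - (\<Sum>i<m. c i *\<^sub>R e i)) = 0"
    and B: "finite B" and u: "\<And>i. i \<in> B \<Longrightarrow> u i \<in> E"
    and orth: "\<And>i j. \<lbrakk>i \<in> B; j \<in> B\<rbrakk> \<Longrightarrow> s (u i) (u j) = (if i = j then 1 else 0)"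
  shows "card B \<le> m"
proof (rule ccontr)
  assume "\<not> card B \<le> m"
  note ES = subsetD[OF E]
  from span[OF u] obtain C where C: "\<And>i. i \<in> B \<Longrightarrow>
    s (u i - (\<Sum>l<m. C i l *\<^sub>R e l)) (u i - (\<Sum>l<m. C i l *\<^sub>R e l)) = 0"
    by metis
  obtain c j where c: "j \<in> B" "c j \<noteq> 0" "\<And>l. l < m \<Longrightarrow> (\<Sum>i\<in>B. c i * C i l) = 0"
    using homogeneous_system_nontrivial[of "{..<m}" B "\<lambda>l i. C i l"] B \<open>\<not> card B \<le> m\<close> by auto
  have eS: "(\<Sum>l<m. C i l *\<^sub>R e l) \<in> S" for i using e ES by (intro mem_sum) auto
  have uu: "s (u i) (u j) = (\<Sum>l<m. C i l * s (e l) (u j))" if "i \<in> B" for i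
  proof -
    have "s (u i - (\<Sum>l<m. C i l *\<^sub>R e l)) (u j) = 0"
      using C[OF that] eS u[OF that] u[OF c(1)] ES by (simp add: null_orthogonal)
    then have "s (u i) (u j) = s (\<Sum>l<m. C i l *\<^sub>R e l) (u j)"
      using eS u[OF that] u[OF c(1)] ES by (simp add: diff_left)
    also have "\<dots> = (\<Sum>l<m. C i l * s (e l) (u j))"
      using e u[OF c(1)] ES by (subst sum_left) (auto simp: scale_left)
    finally show ?thesis .
  qed
  have "c j = (\<Sum>i\<in>B. c i * s (u i) (u j))"
    using orthonormal_coeff[OF B ES[OF u] orth c(1), of c] u c(1) ES
    by (simp add: sum_left scale_left)
  also have "\<dots> = (\<Sum>i\<in>B. \<Sum>l<m. c i * (C i l * s (e l) (u j)))"
    by (simp add: uu sum_distrib_left)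
  also have "\<dots> = (\<Sum>l<m. \<Sum>i\<in>B. c i * (C i l * s (e l) (u j)))"
    by (rule sum.swap)
  also have "\<dots> = (\<Sum>l<m. (\<Sum>i\<in>B. c i * C i l) * s (e l) (u j))"
    by (simp add: sum_distrib_right mult.assoc)
  also have "\<dots> = 0" using c(3) by simp
  finally show False using c(2) by simp
qed

end

section \<open>The orthonormal sequence of eigenvectors\<close>

context form_pair
begin

text \<open>The abstract counterpart of \<open>has_ae_dim\<close>, with null vectors of
  \<open>s\<close> in place of functions that vanish almost everywhere.\<close>

definition eigen_dim :: "real \<Rightarrow> nat \<Rightarrow> bool" where
  "eigen_dim \<mu> m \<longleftrightarrow> (\<exists>e. (\<forall>i<m. e i \<in> eigenspace \<mu>) \<and>
     (\<forall>c. s (\<Sum>i<m. c i *\<^sub>R e i) (\<Sum>i<m. c i *\<^sub>R e i) = 0 \<longrightarrow> (\<forall>j<m. c j = 0)) \<and>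
     (\<forall>v\<in>eigenspace \<mu>. \<exists>c. s (v - (\<Sum>i<m. c i *\<^sub>R e i)) (v - (\<Sum>i<m. c i *\<^sub>R e i)) = 0))"

lemma eigenspace_subset: "eigenspace \<mu> \<subseteq> X"
  using eigenspace_mem by blast

text \<open>The indices at which \<open>lam\<close> takes the value \<open>\<mu>\<close> serve
  directly as index set of an orthonormal basis of that eigenspace, so the bases fit together into
  one sequence. The last claim is \<open>rayleigh_bound\<close>; its hypothesis \<open>none\<close>
  follows from the dimension count.\<close>

theorem orthonormal_eigenfamily:
  fixes lam :: "nat \<Rightarrow> real"
  assumes mono: "mono_on {1..} lam"
    and fin: "\<And>\<mu>. finite {k. 1 \<le> k \<and> lam k = \<mu>}"
    and dim: "\<And>\<mu>. eigen_dim \<mu> (card {k. 1 \<le> k \<and> lam k = \<mu>})"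
  obtains u where "\<And>k. 1 \<le> k \<Longrightarrow> u k \<in> eigenspace (lam k)"
    and "\<And>i j. \<lbrakk>1 \<le> i; 1 \<le> j\<rbrakk> \<Longrightarrow> s (u i) (u j) = (if i = j then 1 else 0)"
    and "\<And>k w. \<lbrakk>w \<in> X; \<And>i. i \<in> {1..k} \<Longrightarrow> s w (u i) = 0\<rbrakk> \<Longrightarrow> lam (Suc k) * s w w \<le> a w w"
proof -
  define A where "A \<mu> = {k. 1 \<le> k \<and> lam k = \<mu>}" for \<mu>
  have finA: "finite (A \<mu>)" for \<mu> using fin by (simp add: A_def)
  have "\<exists>u. (\<forall>i\<in>A \<mu>. u i \<in> eigenspace \<mu>) \<and>
    (\<forall>i\<in>A \<mu>. \<forall>j\<in>A \<mu>. s (u i) (u j) = (if i = j then 1 else 0))" for \<mu>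
  proof -
    obtain e where e: "\<And>i. i < card (A \<mu>) \<Longrightarrow> e i \<in> eigenspace \<mu>"
      "\<And>c j. \<lbrakk>s (\<Sum>i<card (A \<mu>). c i *\<^sub>R e i) (\<Sum>i<card (A \<mu>). c i *\<^sub>R e i) = 0; j < card (A \<mu>)\<rbrakk>
        \<Longrightarrow> c j = 0"
      using dim[of \<mu>] unfolding eigen_dim_def A_def by blast
    show ?thesis
      by (rule s.orthonormal_family_exists[of "eigenspace \<mu>" "card (A \<mu>)" e])
        (use eigenspace_subset subspace_eigenspace e finA in auto)
  qed
  then obtain U where U: "\<And>\<mu> i. i \<in> A \<mu> \<Longrightarrow> U \<mu> i \<in> eigenspace \<mu>"
    "\<And>\<mu> i j. \<lbrakk>i \<in> A \<mu>; j \<in> A \<mu>\<rbrakk> \<Longrightarrow> s (U \<mu> i) (U \<mu> j) = (if i = j then 1 else 0)"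
    by metis
  define u where "u k = U (lam k) k" for k
  have u1: "u k \<in> eigenspace (lam k)" if "1 \<le> k" for k
    unfolding u_def using that by (intro U(1)) (simp add: A_def)
  have u2: "s (u i) (u j) = (if i = j then 1 else 0)" if "1 \<le> i" "1 \<le> j" for i j
  proof (cases "lam i = lam j")
    case True
    with U(2)[of i "lam i" j] that show ?thesis by (simp add: u_def A_def)
  next
    case False
    then have "i \<noteq> j" by auto
    then show ?thesis using eigenspace_orthogonal[OF u1[OF that(1)] u1[OF that(2)] False] by simp
  qed
  have "lam (Suc k) * s w w \<le> a w w"
    if w: "w \<in> X" "\<And>i. i \<in> {1..k} \<Longrightarrow> s w (u i) = 0" for k w
  proof (rule rayleigh_bound[where I = "{1..k}" and u = u and l = lam])
    fix \<mu> v assume lt: "\<mu> < lam (Suc k)" and v: "v \<in> eigenspace \<mu>"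
      and vu: "\<And>i. i \<in> {1..k} \<Longrightarrow> s v (u i) = 0"
    have vX: "v \<in> X" using v by (rule eigenspace_mem)
    show "s v v = 0"
    proof (rule ccontr)
      assume "s v v \<noteq> 0"
      then have pos: "s v v > 0" using s.nonneg[OF vX] by simp
      \<comment> \<open>By monotonicity every index of an eigenvalue below
        \<open>lam (Suc k)\<close> is at most \<open>k\<close>, so \<open>v\<close> is orthogonal to
        the complete basis of its eigenspace.\<close>
      have Ak: "A \<mu> \<subseteq> {1..k}"
      proof
        fix i assume i: "i \<in> A \<mu>"
        have "\<not> Suc k \<le> i"
        proof
          assume "Suc k \<le> i"
          then have "lam (Suc k) \<le> lam i" using mono by (intro mono_onD[OF mono]) auto
          then show False using lt i by (simp add: A_def)
        qed
        then show "i \<in> {1..k}" using i by (simp add: A_def)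
      qed
      define y where "y = (1 / sqrt (s v v)) *\<^sub>R v"
      have yE: "y \<in> eigenspace \<mu>" unfolding y_def by (rule subspace_scale[OF subspace_eigenspace v])
      have yX: "y \<in> X" using yE by (rule eigenspace_mem)
      have yy: "s y y = 1" using pos vX by (simp add: y_def s.square_scale power_divide)
      have yu: "s y (u i) = 0" if "i \<in> A \<mu>" for i
      proof -
        have "i \<in> {1..k}" using that Ak by blast
        then show ?thesis using vu[of i] vX eigenspace_mem[OF u1[of i]] by (simp add: y_def s.scale_left)
      qed
      have uE: "u i \<in> eigenspace \<mu>" if "i \<in> A \<mu>" for i using u1[of i] that by (simp add: A_def)
      have uy: "s (u i) y = 0" if "i \<in> A \<mu>" for i
        using yu[OF that] s.commute[OF eigenspace_mem[OF uE[OF that]] yX] by simp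
      \<comment> \<open>Eigenvalue indices start at 1, so index 0 is free to hold the additional
        vector \<open>y\<close>; the enlarged orthonormal family exceeds the dimension.\<close>
      have 0: "0 \<notin> A \<mu>" by (simp add: A_def)
      obtain e where e: "\<And>i. i < card (A \<mu>) \<Longrightarrow> e i \<in> eigenspace \<mu>"
        "\<And>v. v \<in> eigenspace \<mu> \<Longrightarrow>
          \<exists>c. s (v - (\<Sum>i<card (A \<mu>). c i *\<^sub>R e i)) (v - (\<Sum>i<card (A \<mu>). c i *\<^sub>R e i)) = 0"
        using dim[of \<mu>] unfolding eigen_dim_def A_def by blast
      have "card (insert 0 (A \<mu>)) \<le> card (A \<mu>)"
      proof (rule s.orthonormal_card_le[OF eigenspace_subset, where e = e and u = "u(0 := y)"])
        show "(u(0 := y)) i \<in> eigenspace \<mu>" if "i \<in> insert 0 (A \<mu>)" for i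
          using that yE uE by auto
        show "s ((u(0 := y)) i) ((u(0 := y)) j) = (if i = j then 1 else 0)"
          if "i \<in> insert 0 (A \<mu>)" "j \<in> insert 0 (A \<mu>)" for i j
          using that yy yu uy u2[of i j] 0 by (auto simp: A_def)
      qed (use e finA in auto)
      then show False using finA 0 by simp
    qed
  qed (use w u1 u2 in auto)
  with u1 u2 show ?thesis by (rule that)
qed

end

section \<open>Yang's inequality\<close>

text \<open>Here \<open>u i\<close> is an eigenfunction, \<open>x i\<close> its product with a fixed coordinate and \<open>d i\<close> its partial
  derivative in the direction of that coordinate.\<close>

lemma (in semi_inner) yang_inequality:
  assumes I: "finite I"
    and mem: "\<And>i. i \<in> I \<Longrightarrow> u i \<in> S" "\<And>i. i \<in> I \<Longrightarrow> x i \<in> S" "\<And>i. i \<in> I \<Longrightarrow> d i \<in> S"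
    and orth: "\<And>i j. \<lbrakk>i \<in> I; j \<in> I\<rbrakk> \<Longrightarrow> s (u i) (u j) = (if i = j then 1 else 0)"
    and symm: "\<And>i j. \<lbrakk>i \<in> I; j \<in> I\<rbrakk> \<Longrightarrow> s (x i) (u j) = s (x j) (u i)"
    and comm: "\<And>i j. \<lbrakk>i \<in> I; j \<in> I\<rbrakk> \<Longrightarrow> 2 * s (d i) (u j) = (l i - l j) * s (x i) (u j)"
    and xd: "\<And>i. i \<in> I \<Longrightarrow> s (x i) (d i) = - 1 / 2"
    and rayleigh: "\<And>i p. \<lbrakk>i \<in> I; p = x i - (\<Sum>j\<in>I. s (x i) (u j) *\<^sub>R u j)\<rbrakk>
      \<Longrightarrow> z * s p p \<le> l i * s p p - 2 * s (d i) p"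
    and lz: "\<And>i. i \<in> I \<Longrightarrow> l i \<le> z"
  shows "(\<Sum>i\<in>I. (z - l i)\<^sup>2) \<le> 4 * (\<Sum>i\<in>I. (z - l i) * s (d i) (d i))"
proof -
  define A where "A i j = s (x i) (u j)" for i j
  \<comment> \<open>The subtracted sum has terms antisymmetric in \<open>i\<close> and
    \<open>j\<close>, since \<open>A\<close> is symmetric. The factor \<open>z - l i\<close> in the
    estimate is what produces this antisymmetry.\<close>
  have bound: "(z - l i)\<^sup>2 \<le> 4 * ((z - l i) * s (d i) (d i))
      - (\<Sum>j\<in>I. (z - l i) * (z - l j) * ((z - l j) - (z - l i)) * (A i j)\<^sup>2)" if i: "i \<in> I" for i
  proof -
    define B where "B j = s (d i) (u j)" for j
    define p where "p = x i - (\<Sum>j\<in>I. A i j *\<^sub>R u j)"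
    define v where "v = d i - (\<Sum>j\<in>I. B j *\<^sub>R u j)"
    define \<delta> where "\<delta> = z - l i"
    \<comment> \<open>In the application this is the energy of \<open>p\<close> minus
      \<open>l i\<close> times its square, so the Rayleigh bound reads
      \<open>\<delta> * s p p \<le> P\<close>.\<close>
    define P where "P = - 2 * s (d i) p"
    have sums: "(\<Sum>j\<in>I. A i j *\<^sub>R u j) \<in> S" "(\<Sum>j\<in>I. B j *\<^sub>R u j) \<in> S"
      using mem by (auto intro!: mem_sum)
    have pS: "p \<in> S" and vS: "v \<in> S" using sums mem i by (auto simp: p_def v_def)
    have up: "s (u j) p = 0" if "j \<in> I" for j
    proof -
      have "s p (u j) = 0"
        unfolding p_def using i that sums mem orthonormal_coeff[OF I mem(1) orth that]
        by (simp add: diff_left A_def)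
      then show ?thesis using commute pS mem(1)[OF that] by simp
    qed
    have uv: "s v (u j) = 0" if "j \<in> I" for j
      unfolding v_def using i that sums mem orthonormal_coeff[OF I mem(1) orth that]
      by (simp add: diff_left B_def)
    have "s (\<Sum>j\<in>I. B j *\<^sub>R u j) p = 0"
      using pS mem up by (subst sum_left) (auto simp: scale_left)
    then have vp: "s v p = s (d i) p" using mem i sums pS by (simp add: v_def diff_left)
    have "s v (\<Sum>j\<in>I. B j *\<^sub>R u j) = 0"
      using vS mem uv by (subst sum_right) (auto simp: scale_right)
    then have "s v v = s v (d i)" using vS mem i sums by (subst (2) v_def) (simp add: diff_right)
    also have "\<dots> = s (d i) v" using commute vS mem i by blast
    also have "\<dots> = s (d i) (d i) - (\<Sum>j\<in>I. (B j)\<^sup>2)"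
      unfolding v_def using mem i sums
      by (simp add: diff_right sum_right scale_right B_def power2_eq_square)
    finally have vv: "s v v = s (d i) (d i) - (\<Sum>j\<in>I. (B j)\<^sup>2)" .
    have "s (d i) p = s (x i) (d i) - (\<Sum>j\<in>I. A i j * B j)"
      unfolding p_def using mem i sums
      by (simp add: diff_right sum_right scale_right B_def commute[of "d i" "x i"])
    then have P: "P = 1 + (\<Sum>j\<in>I. 2 * (A i j * B j))"
      using xd[OF i] by (simp add: P_def sum_distrib_left[symmetric])
    have d0: "\<delta> \<ge> 0" using lz[OF i] by (simp add: \<delta>_def)
    have "\<delta> * s p p \<le> P"
      using rayleigh[OF i p_def[unfolded A_def]] by (simp add: \<delta>_def P_def algebra_simps)
    then have *: "\<delta> * (\<delta> * s p p) \<le> \<delta> * P" using d0 by (rule mult_left_mono)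
    \<comment> \<open>Cauchy-Schwarz for \<open>p\<close> and \<open>v\<close> in a form that
      requires no division by \<open>\<delta>\<close>. Replacing \<open>d i\<close> by its
      projection \<open>v\<close> is free, because \<open>p\<close> is orthogonal to the
      \<open>u j\<close>, and it gains the sum of the squares of \<open>B\<close>.\<close>
    have "0 \<le> s (\<delta> *\<^sub>R p + 2 *\<^sub>R v) (\<delta> *\<^sub>R p + 2 *\<^sub>R v)"
      using pS vS by (intro nonneg) auto
    also have "\<dots> = \<delta> * (\<delta> * s p p) - 2 * (\<delta> * P) + 4 * s v v"
      using pS vS vp commute[OF pS vS]
      by (simp add: square_add square_scale scale_left scale_right P_def power2_eq_square)
    finally have "\<delta> * P \<le> 4 * s v v" using * by simp
    then have "\<delta> * (\<delta> * P) \<le> \<delta> * (4 * s v v)" using d0 by (rule mult_left_mono)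
    then have main: "\<delta>\<^sup>2 \<le> 4 * (\<delta> * s (d i) (d i)) - (\<Sum>j\<in>I. \<delta> * \<delta> * (2 * (A i j * B j)) + 4 * \<delta> * (B j)\<^sup>2)"
      unfolding P vv by (simp add: algebra_simps sum.distrib sum_distrib_left power2_eq_square)
    have "\<delta> * \<delta> * (2 * (A i j * B j)) + 4 * \<delta> * (B j)\<^sup>2
        = (z - l i) * (z - l j) * ((z - l j) - (z - l i)) * (A i j)\<^sup>2" if "j \<in> I" for j
    proof -
      have "2 * B j = (l i - l j) * A i j" using comm[OF i that] by (simp add: B_def A_def)
      then show ?thesis unfolding \<delta>_def by algebra
    qed
    then show ?thesis using main by (simp add: \<delta>_def)
  qed
  \<comment> \<open>Exchanging the names of the two indices changes the sign, so the total of the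
    correction terms is 0.\<close>
  define T where "T = (\<Sum>i\<in>I. \<Sum>j\<in>I. (z - l i) * (z - l j) * ((z - l j) - (z - l i)) * (A i j)\<^sup>2)"
  have "T = (\<Sum>i\<in>I. \<Sum>j\<in>I. (z - l j) * (z - l i) * ((z - l i) - (z - l j)) * (A j i)\<^sup>2)"
    unfolding T_def by (rule sum.swap)
  also have "\<dots> = (\<Sum>i\<in>I. \<Sum>j\<in>I. - ((z - l i) * (z - l j) * ((z - l j) - (z - l i)) * (A i j)\<^sup>2))"
  proof (intro sum.cong refl)
    fix i j assume ij: "i \<in> I" "j \<in> I"
    have "A j i = A i j" using symm[OF ij] by (simp add: A_def)
    then show "(z - l j) * (z - l i) * ((z - l i) - (z - l j)) * (A j i)\<^sup>2
        = - ((z - l i) * (z - l j) * ((z - l j) - (z - l i)) * (A i j)\<^sup>2)"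
      by (simp add: algebra_simps)
  qed
  also have "\<dots> = - T" by (simp add: T_def sum_negf)
  finally have "T = 0" by simp
  have "(\<Sum>i\<in>I. (z - l i)\<^sup>2) \<le> (\<Sum>i\<in>I. 4 * ((z - l i) * s (d i) (d i))
      - (\<Sum>j\<in>I. (z - l i) * (z - l j) * ((z - l j) - (z - l i)) * (A i j)\<^sup>2))"
    by (rule sum_mono) (rule bound)
  also have "\<dots> = 4 * (\<Sum>i\<in>I. (z - l i) * s (d i) (d i)) - T"
    by (simp add: sum_subtractf sum_distrib_left T_def)
  finally show ?thesis using \<open>T = 0\<close> by simp
qed

section \<open>Riesz means and Weyl-type bounds\<close>

text \<open>Squaring smooths the kink of the positive part: this is why the second Riesz mean is
  differentiable, with derivative twice the first.\<close>

lemma DERIV_max_0_square: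
  fixes t :: real
  shows "((\<lambda>t. (max 0 t)\<^sup>2) has_real_derivative 2 * max 0 t) (at t)"
proof -
  consider "t < 0" | "t = 0" | "t > 0" by linarith
  then show ?thesis
  proof cases
    case 1
    have "((\<lambda>t. 0) has_real_derivative 0) (at t)" by simp
    then have "((\<lambda>t. (max 0 t)\<^sup>2) has_real_derivative 0) (at t)"
      by (rule has_field_derivative_transform_within_open[where S = "{..<0}"]) (use 1 in auto)
    then show ?thesis using 1 by simp
  next
    case 2
    have "((\<lambda>h::real. (max 0 h)\<^sup>2 / h) \<longlongrightarrow> 0) (at 0)"
    proof (rule Lim_null_comparison)
      show "\<forall>\<^sub>F h in at 0. norm ((max 0 h)\<^sup>2 / h) \<le> \<bar>h\<bar>"
        by (rule always_eventually) (auto simp: max_def power2_eq_square)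
      show "((\<lambda>h. \<bar>h\<bar>) \<longlongrightarrow> 0) (at (0::real))" by (rule tendsto_rabs_zero) (rule tendsto_ident_at)
    qed
    then show ?thesis by (simp add: 2 DERIV_def)
  next
    case 3
    have "((\<lambda>t. t\<^sup>2) has_real_derivative 2 * t) (at t)" by (auto intro!: derivative_eq_intros)
    then have "((\<lambda>t. (max 0 t)\<^sup>2) has_real_derivative 2 * t) (at t)"
      by (rule has_field_derivative_transform_within_open[where S = "{0<..}"]) (use 3 in auto)
    then show ?thesis using 3 by simp
  qed
qed

text \<open>Bernoulli's inequality at \<open>t = y / w\<close>, scaled by \<open>w powr q\<close>;
  it is the weighted arithmetic-geometric mean inequality for \<open>t powr q\<close> and 1.\<close>

lemma powr_tangent_le:
  fixes y w q :: real
  assumes "y > 0" "w > 0" "q \<ge> 1"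
  shows "w powr q + q * w powr (q - 1) * (y - w) \<le> y powr q"
proof -
  define t where "t = y / w"
  have t: "t > 0" "y = t * w" using assms by (auto simp: t_def)
  have "(t powr q) powr (1 / q) * 1 powr (1 - 1 / q) \<le> 1 / q * t powr q + (1 - 1 / q) * 1"
    using assms t by (intro Youngs_inequality_0) (auto simp: divide_simps)
  then have "t \<le> 1 / q * t powr q + (1 - 1 / q)" using assms t by (simp add: powr_powr)
  then have "q * t \<le> q * (1 / q * t powr q + (1 - 1 / q))" using assms by (intro mult_left_mono) auto
  also have "\<dots> = t powr q + q - 1" using assms by (simp add: distrib_left right_diff_distrib)
  finally have "1 + q * (t - 1) \<le> t powr q" by (simp add: algebra_simps)
  then have "w powr q * (1 + q * (t - 1)) \<le> w powr q * t powr q" by (intro mult_left_mono) auto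
  also have "\<dots> = y powr q" using t assms by (simp add: powr_mult mult.commute)
  finally have "w powr q + q * (w powr q * (t - 1)) \<le> y powr q" by (simp add: algebra_simps)
  moreover have "w powr q * (t - 1) = w powr (q - 1) * (y - w)"
    using t assms by (simp add: powr_diff field_simps)
  ultimately show ?thesis by (simp add: mult.assoc)
qed

text \<open>Monotonicity of the second Riesz mean divided by \<open>z powr (2 + d / 2)\<close>,
  compared between \<open>z0\<close> and \<open>lam k\<close> and followed by Yang's inequality at
  \<open>lam k\<close>. Sums up to \<open>k\<close> are the full Riesz means in this range, as later
  eigenvalues do not lie below \<open>z\<close>.\<close>

lemma riesz_mean_growth:
  fixes lam :: "nat \<Rightarrow> real" and d :: real
  assumes d: "d > 0"
    and mono: "mono_on {1..} lam"
    and yang: "\<And>n z. \<lbrakk>z \<le> lam (Suc n); \<And>i. i \<in> {1..n} \<Longrightarrow> lam i \<le> z\<rbrakk>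
      \<Longrightarrow> d * (\<Sum>i=1..n. (z - lam i)\<^sup>2) \<le> 4 * (\<Sum>i=1..n. (z - lam i) * lam i)"
    and k: "1 \<le> k" and z0: "0 < z0" "z0 \<le> lam k"
  shows "(1 + d / 4) * (\<Sum>i=1..k. (max 0 (z0 - lam i))\<^sup>2) * (lam k / z0) powr (2 + d / 2)
    \<le> lam k * (\<Sum>i=1..k. max 0 (lam k - lam i))"
proof -
  define F where "F z = (\<Sum>i=1..k. (max 0 (z - lam i))\<^sup>2)" for z
  define R where "R z = (\<Sum>i=1..k. max 0 (z - lam i))" for z
  have FR: "(1 + d / 4) * F z \<le> z * R z" if z: "z \<le> lam k" for z
  proof -
    \<comment> \<open>The number of eigenvalues strictly below \<open>z\<close>: for this
      \<open>n\<close> Yang's inequality applies, and its sums equal those of the positive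
      parts.\<close>
    define n where "n = (LEAST n. z \<le> lam (Suc n))"
    have ex: "z \<le> lam (Suc (k - 1))" using z k by simp
    have n1: "z \<le> lam (Suc n)" unfolding n_def using ex by (rule LeastI)
    have nk: "n < k" using Least_le[of "\<lambda>n. z \<le> lam (Suc n)", OF ex] k by (simp add: n_def)
    have small: "lam i \<le> z" if "i \<in> {1..n}" for i
    proof -
      have "i - 1 < n" "Suc (i - 1) = i" using that by auto
      then show ?thesis using not_less_Least[of "i - 1" "\<lambda>n. z \<le> lam (Suc n)"] by (simp add: n_def)
    qed
    have large: "z \<le> lam i" if "i \<in> {n+1..k}" for i
      using n1 mono_onD[OF mono, of "Suc n" i] that by auto
    have split: "(\<Sum>i=1..k. f i) = (\<Sum>i=1..n. f i)" if "\<And>i. i \<in> {n+1..k} \<Longrightarrow> f i = 0" for f :: "nat \<Rightarrow> real"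
      using nk that by (intro sum.mono_neutral_right) auto
    have zero: "max 0 (z - lam i) = 0" if "i \<in> {n+1..k}" for i using large[OF that] by simp
    have F: "F z = (\<Sum>i=1..n. (z - lam i)\<^sup>2)"
      unfolding F_def using small by (subst split) (simp add: zero, auto intro!: sum.cong simp: max_def)
    have R: "R z = (\<Sum>i=1..n. (z - lam i))"
      unfolding R_def using small by (subst split) (simp add: zero, auto intro!: sum.cong simp: max_def)
    have "(\<Sum>i=1..n. (z - lam i) * lam i) = z * R z - F z"
      unfolding F R by (simp add: sum_distrib_left sum_subtractf[symmetric] power2_eq_square algebra_simps)
    then show ?thesis using yang[OF n1 small] by (simp add: F field_simps)
  qed
  \<comment> \<open>The exponent is \<open>2 * (1 + d / 4)\<close>, which makes the derivative below
    a positive multiple of \<open>z * R z - (1 + d / 4) * F z\<close>.\<close>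
  define p where "p = 2 + d / 2"
  have "F z0 * z0 powr (- p) \<le> F (lam k) * lam k powr (- p)"
  proof (rule DERIV_nonneg_imp_nondecreasing[OF z0(2)])
    fix z assume z: "z0 \<le> z" "z \<le> lam k"
    then have zp: "z > 0" using z0 by simp
    have "(F has_real_derivative (\<Sum>i=1..k. 2 * max 0 (z - lam i))) (at z)"
      unfolding F_def
      by (intro DERIV_sum DERIV_chain2[OF DERIV_max_0_square, where Db = 1, simplified])
        (auto intro!: derivative_eq_intros)
    then have F': "(F has_real_derivative 2 * R z) (at z)" by (simp add: R_def sum_distrib_left)
    have "((\<lambda>z. F z * z powr (- p)) has_real_derivative
        2 * R z * z powr (- p) + F z * (- p * z powr (- p - 1))) (at z)"
      using zp by (auto intro!: derivative_eq_intros F' simp: powr_diff)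
    moreover have "2 * R z * z powr (- p) + F z * (- p * z powr (- p - 1))
        = z powr (- p - 1) * (2 * (z * R z - (1 + d / 4) * F z))"
    proof -
      have "z powr (- p) = z * z powr (- p - 1)" using powr_add[of z 1 "- p - 1"] zp by simp
      then show ?thesis by (simp only:) (simp add: p_def algebra_simps)
    qed
    moreover have "\<dots> \<ge> 0" using FR[OF z(2)] by (intro mult_nonneg_nonneg) auto
    ultimately show "\<exists>y. ((\<lambda>z. F z * z powr - p) has_real_derivative y) (at z) \<and> y \<ge> 0" by metis
  qed
  then have "F z0 * (lam k / z0) powr p \<le> F (lam k)"
    using z0 by (simp add: powr_minus powr_divide field_simps)
  then have "(1 + d / 4) * (F z0 * (lam k / z0) powr p) \<le> (1 + d / 4) * F (lam k)"
    using d by (intro mult_left_mono) auto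
  also have "\<dots> \<le> lam k * R (lam k)" by (rule FR) simp
  finally show ?thesis by (simp add: F_def R_def p_def mult.assoc)
qed

text \<open>Both cases below lead to the same bound, in terms of \<open>y = max 1 (Z / z0)\<close>: the lower bound for
  the Riesz mean that holds beyond \<open>z0\<close> touches the linear bound \<open>j (z - m)\<close> at \<open>z0\<close>. Replacing
  the power of \<open>y\<close> by its tangent at \<open>w\<close> makes the bound independent of \<open>y\<close>.\<close>

lemma eigenvalue_mean_ratio_bound:
  fixes lam :: "nat \<Rightarrow> real" and d :: real
  assumes d: "d > 0"
    and mono: "mono_on {1..} lam"
    and nonneg: "\<And>i. 1 \<le> i \<Longrightarrow> 0 \<le> lam i"
    and yang: "\<And>n z. \<lbrakk>z \<le> lam (Suc n); \<And>i. i \<in> {1..n} \<Longrightarrow> lam i \<le> z\<rbrakk>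
      \<Longrightarrow> d * (\<Sum>i=1..n. (z - lam i)\<^sup>2) \<le> 4 * (\<Sum>i=1..n. (z - lam i) * lam i)"
    and j: "1 \<le> j" and jk: "j \<le> k"
  shows "eigenvalue_mean lam k / eigenvalue_mean lam j
    \<le> 2 * ((1 + d / 4) / (1 + d / 2)) powr (1 + 2 / d) * (real k / real j) powr (2 / d)"
proof (cases "eigenvalue_mean lam j = 0")
  case True
  \<comment> \<open>Division by 0 gives 0, and the right-hand side is nonnegative.\<close>
  then show ?thesis by simp
next
  case False
  define m where "m = eigenvalue_mean lam j"
  have "0 \<le> m" unfolding m_def eigenvalue_mean_def using nonneg by (intro mult_nonneg_nonneg sum_nonneg) auto
  then have m: "m > 0" using False by (simp add: m_def)
  have summ: "(\<Sum>i=1..j. lam i) = j * m" using j by (simp add: m_def eigenvalue_mean_def)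
  have k: "1 \<le> k" using j jk by simp
  define M where "M = eigenvalue_mean lam k"
  have sumM: "(\<Sum>i=1..k. lam i) = k * M" using k by (simp add: M_def eigenvalue_mean_def)
  define Z where "Z = lam k"
  \<comment> \<open>The maximizer of \<open>(z - m)\<^sup>2 / z powr (2 + d / 2)\<close>, which
    gives the best lower bound for the Riesz mean beyond it.\<close>
  define z0 where "z0 = (1 + 4 / d) * m"
  have z0: "z0 > 0" using m d by (simp add: z0_def add_pos_pos)
  define R where "R = (\<Sum>i=1..k. max 0 (Z - lam i))"
  have "R = (\<Sum>i=1..k. Z - lam i)"
    unfolding R_def Z_def using mono_onD[OF mono, of _ k] by (intro sum.cong refl max_absorb2) auto
  then have kM: "k * M = k * Z - R" by (simp add: sum_subtractf sumM del: One_nat_def)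
  have sumj: "(\<Sum>i=1..j. z - lam i) = j * (z - m)" for z
    by (simp add: sum_subtractf summ right_diff_distrib del: One_nat_def)
  have jR: "j * (z - m) \<le> (\<Sum>i=1..j. max 0 (z - lam i))" for z
    unfolding sumj[symmetric] by (rule sum_mono) simp
  define h where "h = d / 2"
  have h: "h > 0" using d by (simp add: h_def)
  \<comment> \<open>This is \<open>k * M = k * Z - R\<close> with \<open>Z = z0 * y\<close> and
    \<open>R\<close> replaced by its lower bound
    \<open>(4 / d) * j * m * y powr (1 + h)\<close>.\<close>
  have "\<exists>y\<ge>1. k * M \<le> m * (k * (1 + 4 / d) * y - (4 / d) * j * y powr (1 + h))"
  proof (cases "z0 \<le> Z")
    case True
    define y where "y = Z / z0"
    have y: "y \<ge> 1" and Zy: "Z = z0 * y" using True z0 by (auto simp: y_def)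
    \<comment> \<open>Convexity of the square, in the form of the Cauchy-Schwarz inequality for
      sums: the second Riesz mean at \<open>z0\<close> is at least
      \<open>j * (z0 - m)\<^sup>2\<close>.\<close>
    have "(j * (z0 - m))\<^sup>2 \<le> (\<Sum>i=1..j. max 0 (z0 - lam i))\<^sup>2"
      using d m by (intro power_mono[OF jR]) (auto simp: z0_def field_simps)
    also have "\<dots> \<le> (\<Sum>i=1..j. (max 0 (z0 - lam i))\<^sup>2) * j"
      using sum_squared_le_sum_of_squares[of "\<lambda>i. max 0 (z0 - lam i)" "{1..j}"] by simp
    also have "\<dots> \<le> (\<Sum>i=1..k. (max 0 (z0 - lam i))\<^sup>2) * j"
      using jk by (intro mult_right_mono sum_mono2) auto
    finally have "j * (j * (z0 - m)\<^sup>2) \<le> j * (\<Sum>i=1..k. (max 0 (z0 - lam i))\<^sup>2)"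
      by (simp add: power2_eq_square algebra_simps)
    then have F: "j * (z0 - m)\<^sup>2 \<le> (\<Sum>i=1..k. (max 0 (z0 - lam i))\<^sup>2)" using j by simp
    have "(1 + d / 4) * (j * (z0 - m)\<^sup>2) * y powr (2 + d / 2)
        \<le> (1 + d / 4) * (\<Sum>i=1..k. (max 0 (z0 - lam i))\<^sup>2) * y powr (2 + d / 2)"
      using d F by (intro mult_right_mono mult_left_mono) auto
    also have "\<dots> \<le> Z * R"
      using riesz_mean_growth[OF d mono yang k z0] True by (simp add: Z_def R_def y_def)
    finally have ZR: "(1 + d / 4) * (j * (z0 - m)\<^sup>2) * y powr (2 + d / 2) \<le> Z * R" .
    have yp: "y powr (2 + d / 2) = y * y powr (1 + h)"
      using y powr_add[of y 1 "1 + h"] by (simp add: h_def)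
    have eq: "(1 + d / 4) * (j * (z0 - m)\<^sup>2) = z0 * ((4 / d) * j * m)"
      using d by (simp add: z0_def power2_eq_square field_simps)
    from ZR have "(z0 * y) * ((4 / d) * j * m * y powr (1 + h)) \<le> (z0 * y) * R"
      unfolding eq yp Zy by (simp only: mult_ac)
    then have "(4 / d) * j * m * y powr (1 + h) \<le> R" using z0 y by (subst (asm) mult_le_cancel_left_pos) auto
    then have "k * M \<le> m * (k * (1 + 4 / d) * y - (4 / d) * j * y powr (1 + h))"
      unfolding kM Zy z0_def by (simp add: algebra_simps)
    then show ?thesis using y by blast
  next
    case False
    \<comment> \<open>Below \<open>z0\<close> the linear bound for \<open>R\<close> is used. What
      results is nondecreasing in \<open>Z\<close> because \<open>j \<le> k\<close>, so
      \<open>Z\<close> may be raised to \<open>z0\<close>, which is the case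
      \<open>y = 1\<close>.\<close>
    have "(\<Sum>i=1..j. max 0 (Z - lam i)) \<le> R"
      unfolding R_def using jk by (intro sum_mono2) auto
    then have "k * M \<le> k * Z - j * (Z - m)" using jR[of Z] kM by simp
    also have "\<dots> = (real k - j) * Z + j * m" by (simp add: algebra_simps)
    also have "\<dots> \<le> (real k - j) * z0 + j * m"
      using False jk by (intro add_right_mono mult_left_mono) auto
    also have "\<dots> = m * (k * (1 + 4 / d) * 1 - (4 / d) * j * 1 powr (1 + h))"
      by (simp add: z0_def algebra_simps add_divide_distrib diff_divide_distrib)
    finally show ?thesis by blast
  qed
  then obtain y where y: "y \<ge> 1" "k * M \<le> m * (k * (1 + 4 / d) * y - (4 / d) * j * y powr (1 + h))"
    by blast
  define \<rho> where "\<rho> = (1 + d / 4) / (1 + d / 2)"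
  \<comment> \<open>The stationary point of the bound as a function of \<open>y\<close>, from
    \<open>(1 + 4 / d) * k = (4 / d) * j * (1 + h) * w powr h\<close>. The ratio condition of the
    final theorem says that \<open>w\<close> is at least 1.\<close>
  define w where "w = (\<rho> * (k / j)) powr (1 / h)"
  have rho: "\<rho> > 0" using d by (simp add: \<rho>_def add_pos_pos)
  have w: "w > 0" using rho j k by (simp add: w_def)
  have wh: "w powr h = \<rho> * (k / j)" using h rho j k by (simp add: w_def powr_powr)
  have w1h: "w powr (1 + h) = w * (\<rho> * (k / j))" using w by (simp add: powr_add wh)
  have "w powr (1 + h) + (1 + h) * w powr h * (y - w) \<le> y powr (1 + h)"
    using powr_tangent_le[of y w "1 + h"] y w h by simp
  then have "k * (1 + 4 / d) * y - (4 / d) * j * y powr (1 + h)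
      \<le> k * (1 + 4 / d) * y - (4 / d) * j * (w powr (1 + h) + (1 + h) * w powr h * (y - w))"
    using d by (intro diff_left_mono mult_left_mono) auto
  \<comment> \<open>By the choice of \<open>w\<close> the two terms linear in \<open>y\<close>
    cancel.\<close>
  also have "\<dots> = 2 * \<rho> * w * k"
  proof -
    have "(1 + h) * \<rho> = 1 + d / 4" using d by (simp add: \<rho>_def h_def field_simps)
    then have "(1 + h) * w powr h = (1 + d / 4) * (k / j)" unfolding wh by (simp add: mult.assoc[symmetric])
    then have "(4 / d) * j * (w powr (1 + h) + (1 + h) * w powr h * (y - w))
      = (4 / d) * (j * (w * (\<rho> * (k / j)) + (1 + d / 4) * (k / j) * (y - w)))"
      by (simp only: w1h mult.assoc)
    also have "\<dots> = (4 / d) * (w * \<rho> * k + (1 + d / 4) * k * (y - w))"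
      using j by (simp add: distrib_left)
    finally have eq: "(4 / d) * j * (w powr (1 + h) + (1 + h) * w powr h * (y - w))
      = (4 / d) * (w * \<rho> * k + (1 + d / 4) * k * (y - w))" .
    have "k * (1 + 4 / d) * y - (4 / d) * j * (w powr (1 + h) + (1 + h) * w powr h * (y - w))
      = (4 / d) * w * k * ((1 + d / 4) - \<rho>)"
      unfolding eq using d by (simp add: field_simps)
    also have "(1 + d / 4) - \<rho> = h * \<rho>" using \<open>(1 + h) * \<rho> = 1 + d / 4\<close> by (simp add: algebra_simps)
    finally show ?thesis using d by (simp add: h_def)
  qed
  finally have "k * M \<le> m * (2 * \<rho> * w * k)" using y(2) m
    by (meson less_imp_le mult_left_mono order_trans)
  then have "M \<le> m * (2 * \<rho> * w)" using k by simp
  then have "M / m \<le> 2 * (\<rho> * w)" using m by (simp add: field_simps)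
  also have "\<rho> * w = \<rho> powr (1 + 2 / d) * (k / j) powr (2 / d)"
  proof -
    have "w = \<rho> powr (2 / d) * (k / j) powr (2 / d)"
      using powr_mult[of \<rho> "k / j" "2 / d"] rho by (simp add: w_def h_def)
    then show ?thesis using rho by (simp add: powr_add)
  qed
  finally show ?thesis by (simp add: M_def m_def \<rho>_def mult.assoc)
qed

section \<open>Square integrable functions\<close>

text \<open>Values in a Euclidean space, so that functions, gradients and pairs of both are covered
  at once.\<close>

definition L2_inner :: "'a::euclidean_space set \<Rightarrow> ('a \<Rightarrow> 'b::euclidean_space) \<Rightarrow> ('a \<Rightarrow> 'b) \<Rightarrow> real" where
  "L2_inner \<Omega> u v = (LINT x|lebesgue_on \<Omega>. u x \<bullet> v x)"

abbreviation L2 :: "'a::euclidean_space set \<Rightarrow> ('a \<Rightarrow> 'b::euclidean_space) set" where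
  "L2 \<Omega> \<equiv> {u. square_integrable \<Omega> u}"

lemma square_integrableD:
  assumes "square_integrable \<Omega> u"
  shows "u \<in> borel_measurable (lebesgue_on \<Omega>)" "integrable (lebesgue_on \<Omega>) (\<lambda>x. (norm (u x))\<^sup>2)"
  using assms by (auto simp: square_integrable_def)

lemma integrable_L2_inner:
  assumes u: "square_integrable \<Omega> u" and v: "square_integrable \<Omega> v"
  shows "integrable (lebesgue_on \<Omega>) (\<lambda>x. u x \<bullet> v x)"
proof (rule Bochner_Integration.integrable_bound)
  show "integrable (lebesgue_on \<Omega>) (\<lambda>x. (norm (u x))\<^sup>2 + (norm (v x))\<^sup>2)"
    using u v by (intro Bochner_Integration.integrable_add square_integrableD)
  show "(\<lambda>x. u x \<bullet> v x) \<in> borel_measurable (lebesgue_on \<Omega>)"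
    using u v by (intro borel_measurable_inner square_integrableD)
  have "norm (u x \<bullet> v x) \<le> norm ((norm (u x))\<^sup>2 + (norm (v x))\<^sup>2)" for x
  proof -
    have "\<bar>u x \<bullet> v x\<bar> \<le> norm (u x) * norm (v x)" by (rule Cauchy_Schwarz_ineq2)
    also have "\<dots> \<le> (norm (u x))\<^sup>2 + (norm (v x))\<^sup>2"
      using sum_squares_bound[of "norm (u x)" "norm (v x)"] zero_le_power2[of "norm (u x)"]
        zero_le_power2[of "norm (v x)"] mult_nonneg_nonneg[of "norm (u x)" "norm (v x)"]
      by (simp only: norm_ge_zero mult.assoc simp_thms)
    finally show ?thesis by simp
  qed
  then show "AE x in lebesgue_on \<Omega>. norm (u x \<bullet> v x) \<le> norm ((norm (u x))\<^sup>2 + (norm (v x))\<^sup>2)"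
    by (rule always_eventually[OF allI])
qed

lemma square_integrable_add:
  assumes u: "square_integrable \<Omega> u" and v: "square_integrable \<Omega> v"
  shows "square_integrable \<Omega> (\<lambda>x. u x + v x)"
proof -
  have "integrable (lebesgue_on \<Omega>) (\<lambda>x. (norm (u x))\<^sup>2 + (2 * (u x \<bullet> v x) + (norm (v x))\<^sup>2))"
    using u v by (intro Bochner_Integration.integrable_add integrable_mult_right
        integrable_L2_inner square_integrableD)
  then show ?thesis
    using u v borel_measurable_add[of u "lebesgue_on \<Omega>" v]
    by (simp add: square_integrable_def power2_norm_eq_inner inner_add_left inner_add_right
      inner_commute[of "v _" "u _"] algebra_simps)
qed

lemma square_integrable_scale:
  "square_integrable \<Omega> u \<Longrightarrow> square_integrable \<Omega> (\<lambda>x. c *\<^sub>R u x)"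
  unfolding square_integrable_def by (auto simp: power_mult_distrib intro: borel_measurable_scaleR)

lemma L2_semi_inner: "semi_inner (L2 \<Omega>) (L2_inner \<Omega>)"
proof (rule semi_inner.intro)
  show "subspace (L2 \<Omega>)"
    by (rule subspaceI)
      (auto simp: square_integrable_add square_integrable_scale scaleR_fun_def plus_fun_def zero_fun_def
        square_integrable_def[of _ "\<lambda>x. 0"])
  show "L2_inner \<Omega> (x + y) z = L2_inner \<Omega> x z + L2_inner \<Omega> y z"
    if "x \<in> L2 \<Omega>" "y \<in> L2 \<Omega>" "z \<in> L2 \<Omega>" for x y z
    using that by (simp add: L2_inner_def inner_add_left integrable_L2_inner)
  show "L2_inner \<Omega> (c *\<^sub>R x) z = c * L2_inner \<Omega> x z" for c x z
    by (simp add: L2_inner_def)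
  show "L2_inner \<Omega> x y = L2_inner \<Omega> y x" for x y
    by (simp add: L2_inner_def inner_commute)
  show "0 \<le> L2_inner \<Omega> x x" for x
    by (simp add: L2_inner_def)
qed

interpretation L2: semi_inner "L2 \<Omega>" "L2_inner \<Omega>" for \<Omega>
  by (rule L2_semi_inner)

lemma L2_inner_eq_norm: "L2_inner \<Omega> u u = (LINT x|lebesgue_on \<Omega>. (norm (u x))\<^sup>2)"
  by (simp add: L2_inner_def power2_norm_eq_inner)

lemma nn_integral_L2_norm:
  assumes "square_integrable \<Omega> u"
  shows "(\<integral>\<^sup>+x. ennreal ((norm (u x))\<^sup>2) \<partial>lebesgue_on \<Omega>) = ennreal (L2_inner \<Omega> u u)"
  unfolding L2_inner_eq_norm using square_integrableD(2)[OF assms] by (intro nn_integral_eq_integral) auto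

lemma L2_inner_eq_0_AE:
  assumes "square_integrable \<Omega> u"
  shows "L2_inner \<Omega> u u = 0 \<longleftrightarrow> (AE x in lebesgue_on \<Omega>. u x = 0)"
  unfolding L2_inner_eq_norm
  by (subst integral_nonneg_eq_0_iff_AE[OF square_integrableD(2)[OF assms]]) auto

lemma square_integrableI_nn_integral:
  assumes "u \<in> borel_measurable (lebesgue_on \<Omega>)"
    and "(\<integral>\<^sup>+x. ennreal ((norm (u x))\<^sup>2) \<partial>lebesgue_on \<Omega>) < \<infinity>"
  shows "square_integrable \<Omega> u"
  unfolding square_integrable_def
  using assms by (auto intro!: integrableI_bounded)

text \<open>Riesz-Fischer: a rapidly convergent subsequence converges almost everywhere, and Fatou's
  lemma turns the pointwise limit into a limit in the mean square.\<close>

lemma L2_complete: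
  fixes v :: "nat \<Rightarrow> 'a::euclidean_space \<Rightarrow> 'b::euclidean_space"
  assumes v: "\<And>n. square_integrable \<Omega> (v n)"
    and Cauchy: "\<And>e. e > 0 \<Longrightarrow> \<exists>N. \<forall>m\<ge>N. \<forall>n\<ge>N. L2_inner \<Omega> (v m - v n) (v m - v n) < e"
  obtains w where "square_integrable \<Omega> w" "(\<lambda>n. L2_inner \<Omega> (v n - w) (v n - w)) \<longlonglongrightarrow> 0"
proof -
  let ?M = "lebesgue_on \<Omega>"
  have [measurable]: "v n \<in> borel_measurable ?M" for n using v by (rule square_integrableD)
  have vd: "square_integrable \<Omega> (v m - v n)" for m n using L2.mem(3)[of "v m" \<Omega> "v n"] v by simp
  have "\<exists>N. \<forall>m\<ge>N. \<forall>n\<ge>N. L2_inner \<Omega> (v m - v n) (v m - v n) < (1/4)^i" for i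
    by (rule Cauchy) simp
  then obtain N where N: "\<And>i m n. \<lbrakk>N i \<le> m; N i \<le> n\<rbrakk> \<Longrightarrow> L2_inner \<Omega> (v m - v n) (v m - v n) < (1/4)^i"
    by metis
  \<comment> \<open>Partial sums make \<open>r\<close> monotone while keeping it above both
    \<open>N i\<close> and \<open>i\<close>.\<close>
  define r where "r i = (\<Sum>l\<le>i. N l) + i" for i
  have rN: "N i \<le> r i" for i
    unfolding r_def using member_le_sum[of i "{..i}" N] by simp
  have rge: "i \<le> r i" for i by (simp add: r_def)
  have rmono: "r i \<le> r (Suc i)" for i by (simp add: r_def)
  define D where "D i x = v (r (Suc i)) x - v (r i) x" for i x
  have [measurable]: "D i \<in> borel_measurable ?M" for i unfolding D_def by measurable
  \<comment> \<open>The squared increments are below \<open>(1/4)^i\<close>, which leaves room for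
    the weight \<open>2^i\<close>; the weight is spent on pointwise summability of the
    norms.\<close>
  have D_int: "(\<integral>\<^sup>+x. ennreal (2^i * (norm (D i x))\<^sup>2) \<partial>?M) \<le> ennreal ((1/2)^i)" for i
  proof -
    have "(\<integral>\<^sup>+x. ennreal (2^i * (norm (D i x))\<^sup>2) \<partial>?M) = ennreal (2^i) * (\<integral>\<^sup>+x. ennreal ((norm (D i x))\<^sup>2) \<partial>?M)"
      by (simp add: ennreal_mult nn_integral_cmult)
    also have "(\<integral>\<^sup>+x. ennreal ((norm (D i x))\<^sup>2) \<partial>?M)
        = ennreal (L2_inner \<Omega> (v (r (Suc i)) - v (r i)) (v (r (Suc i)) - v (r i)))"
      using nn_integral_L2_norm[OF vd, of "r (Suc i)" "r i"] by (simp add: D_def)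
    also have "\<dots> \<le> ennreal ((1/4)^i)"
      using N[of i "r (Suc i)" "r i"] rN[of i] rmono[of i] by (intro ennreal_leI) simp
    also have "ennreal (2^i) * ennreal ((1/4)^i) = ennreal ((1/2)^i)"
      by (simp add: ennreal_mult[symmetric] power_mult_distrib[symmetric])
    finally show ?thesis by (simp add: mult_left_mono)
  qed
  have "(\<integral>\<^sup>+x. (\<Sum>i. ennreal (2^i * (norm (D i x))\<^sup>2)) \<partial>?M) = (\<Sum>i. \<integral>\<^sup>+x. ennreal (2^i * (norm (D i x))\<^sup>2) \<partial>?M)"
    by (rule nn_integral_suminf) measurable
  also have "\<dots> \<le> (\<Sum>i. ennreal ((1/2)^i))" by (rule suminf_le[OF D_int]) auto
  also have "\<dots> = ennreal (\<Sum>i. (1/2)^i)" by (rule suminf_ennreal2) (auto intro: summable_geometric)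
  finally have "(\<integral>\<^sup>+x. (\<Sum>i. ennreal (2^i * (norm (D i x))\<^sup>2)) \<partial>?M) < \<infinity>"
    by (rule le_less_trans) simp
  then have "AE x in ?M. (\<Sum>i. ennreal (2^i * (norm (D i x))\<^sup>2)) \<noteq> \<infinity>"
    by (intro nn_integral_noteq_infinite) auto
  then have conv: "AE x in ?M. convergent (\<lambda>i. v (r i) x)"
  proof eventually_elim
    case (elim x)
    then have sm: "summable (\<lambda>i. 2^i * (norm (D i x))\<^sup>2)"
      by (intro summable_suminf_not_top) auto
    have "summable (\<lambda>i. norm (D i x))"
    proof (rule summable_comparison_test)
      show "summable (\<lambda>i. (1/2)^i + 2^i * (norm (D i x))\<^sup>2)"
        by (intro summable_add summable_geometric sm) simp
      \<comment> \<open>AM-GM; the weights trade square summability of the norms for summability\<close>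
      have "norm (D i x) \<le> (1/2)^i + 2^i * (norm (D i x))\<^sup>2" for i
      proof -
        define q where "q = norm (D i x)"
        have "0 \<le> (1/2)^i * ((1 - 2^i * q)\<^sup>2 + 2^i * q * 2)" by (simp add: q_def)
        also have "\<dots> = (1/2)^i + 2^i * q\<^sup>2 * (2^i * (1/2)^i)" by (simp add: power2_eq_square algebra_simps)
        finally have "0 \<le> (1/2)^i * (1 - 2^i * q)\<^sup>2" by simp
        also have "\<dots> = (1/2)^i - 2 * q * (2^i * (1/2)^i) + 2^i * q\<^sup>2 * (2^i * (1/2)^i)"
          by (simp add: power2_eq_square algebra_simps)
        also have "2^i * (1/2::real)^i = 1" by (simp add: power_mult_distrib[symmetric])
        finally show ?thesis using norm_ge_zero[of "D i x"] unfolding q_def by linarith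
      qed
      then show "\<exists>N. \<forall>n\<ge>N. norm (norm (D n x)) \<le> (1/2)^n + 2^n * (norm (D n x))\<^sup>2" by simp
    qed
    then have "summable (\<lambda>i. D i x)" by (rule summable_norm_cancel)
    then have "convergent (\<lambda>n. \<Sum>i<n. D i x)" by (simp add: summable_iff_convergent)
    moreover have "(\<Sum>i<n. D i x) = v (r n) x - v (r 0) x" for n
      unfolding D_def using sum_lessThan_telescope[of "\<lambda>i. v (r i) x" n] by simp
    ultimately have "convergent (\<lambda>n. v (r n) x - v (r 0) x)" by simp
    then show ?case by (simp add: convergent_diff_const_right_iff)
  qed
  define w where "w x = lim (\<lambda>i. v (r i) x)" for x
  have [measurable]: "w \<in> borel_measurable ?M"
    unfolding w_def by (rule borel_measurable_lim_metric) simp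
  have lim: "AE x in ?M. (\<lambda>i. v (r i) x) \<longlonglongrightarrow> w x"
    using conv by eventually_elim (simp add: w_def convergent_LIMSEQ_iff)
  \<comment> \<open>Fatou's lemma along the subsequence with \<open>n\<close> fixed. It is stated
    for nonnegative integrals, since square integrability of \<open>w\<close> is only deduced from
    it.\<close>
  have key: "(\<integral>\<^sup>+x. ennreal ((norm (v n x - w x))\<^sup>2) \<partial>?M) \<le> ennreal e"
    if K: "\<And>m. m \<ge> K \<Longrightarrow> L2_inner \<Omega> (v n - v m) (v n - v m) \<le> e" for n e and K :: nat
  proof -
    have "(\<integral>\<^sup>+x. ennreal ((norm (v n x - w x))\<^sup>2) \<partial>?M)
        = (\<integral>\<^sup>+x. liminf (\<lambda>i. ennreal ((norm (v n x - v (r i) x))\<^sup>2)) \<partial>?M)"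
    proof (rule nn_integral_cong_AE, use lim in eventually_elim)
      case (elim x)
      then have "(\<lambda>i. ennreal ((norm (v n x - v (r i) x))\<^sup>2)) \<longlonglongrightarrow> ennreal ((norm (v n x - w x))\<^sup>2)"
        by (intro tendsto_intros)
      then show ?case by (intro lim_imp_Liminf[symmetric] trivial_limit_sequentially)
    qed
    also have "\<dots> \<le> liminf (\<lambda>i. \<integral>\<^sup>+x. ennreal ((norm (v n x - v (r i) x))\<^sup>2) \<partial>?M)"
      by (rule nn_integral_liminf) measurable
    also have "\<dots> \<le> liminf (\<lambda>i. ennreal e)"
    proof (rule Liminf_mono, rule eventually_sequentiallyI[of K])
      fix i assume "K \<le> i"
      then have "L2_inner \<Omega> (v n - v (r i)) (v n - v (r i)) \<le> e" using K[of "r i"] rge[of i] by simp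
      then show "(\<integral>\<^sup>+x. ennreal ((norm (v n x - v (r i) x))\<^sup>2) \<partial>?M) \<le> ennreal e"
        using nn_integral_L2_norm[OF vd, of n "r i"] by (simp add: ennreal_leI)
    qed
    also have "\<dots> = ennreal e" by (simp add: Liminf_const)
    finally show ?thesis .
  qed
  have sub: "square_integrable \<Omega> (v n - w)" if "n \<ge> N 0" for n
  proof (rule square_integrableI_nn_integral)
    show "v n - w \<in> borel_measurable ?M" unfolding fun_diff_def by measurable
    have "(\<integral>\<^sup>+x. ennreal ((norm (v n x - w x))\<^sup>2) \<partial>?M) \<le> ennreal 1"
      using N[of 0 n] that by (intro key[of "N 0"]) (auto intro: less_imp_le)
    then show "(\<integral>\<^sup>+x. ennreal ((norm ((v n - w) x))\<^sup>2) \<partial>?M) < \<infinity>"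
      by (simp add: le_less_trans[of _ 1])
  qed
  have w: "square_integrable \<Omega> w"
    using L2.mem(3)[of "v (N 0)" \<Omega> "v (N 0) - w"] v sub[of "N 0"] by simp
  have "(\<lambda>n. L2_inner \<Omega> (v n - w) (v n - w)) \<longlonglongrightarrow> 0"
  proof (rule LIMSEQ_I)
    fix e :: real assume "e > 0"
    from Cauchy[of "e / 2"] this obtain K where
      K: "\<And>m n. \<lbrakk>m \<ge> K; n \<ge> K\<rbrakk> \<Longrightarrow> L2_inner \<Omega> (v m - v n) (v m - v n) < e / 2" by auto
    show "\<exists>K. \<forall>n\<ge>K. norm (L2_inner \<Omega> (v n - w) (v n - w) - 0) < e"
    proof (intro exI[of _ "K + N 0"] allI impI)
      fix n assume n: "K + N 0 \<le> n"
      have "ennreal (L2_inner \<Omega> (v n - w) (v n - w)) \<le> ennreal (e / 2)"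
        using nn_integral_L2_norm[OF sub, of n] key[of K n "e / 2"] K[of n] n
        by (auto intro: less_imp_le)
      then have "L2_inner \<Omega> (v n - w) (v n - w) \<le> e / 2" using \<open>e > 0\<close> by (simp add: ennreal_le_iff)
      then show "norm (L2_inner \<Omega> (v n - w) (v n - w) - 0) < e"
        using \<open>e > 0\<close> by (simp add: L2_inner_eq_norm)
    qed
  qed
  with w show ?thesis by (rule that)
qed

section \<open>Test functions\<close>

text \<open>The recursion in \<open>C_k\<close> does not make the classes nested by definition. The
  product rule needs nestedness, because it leaves one factor undifferentiated.\<close>

lemma C_k_SucD: "C_k (Suc n) f \<Longrightarrow> C_k n f"
proof (induction n arbitrary: f)
  case 0
  then show ?case
    by (auto intro!: continuous_at_imp_continuous_on differentiable_imp_continuous_within)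
qed auto

lemma C_k_const: "C_k n (\<lambda>x. c)"
  by (induction n arbitrary: c) auto

lemma frechet_derivative_inner_left: "frechet_derivative (\<lambda>x. x \<bullet> b) (at x) = (\<lambda>h. h \<bullet> b)"
  by (rule frechet_derivative_at[symmetric]) (auto intro!: derivative_eq_intros)

lemma C_k_inner: "C_k n (\<lambda>x. x \<bullet> b)"
  by (cases n) (auto intro!: continuous_intros simp: frechet_derivative_inner_left C_k_const)

lemma frechet_derivative_add:
  fixes f g :: "'a::real_normed_vector \<Rightarrow> real"
  assumes "f differentiable (at x)" "g differentiable (at x)"
  shows "frechet_derivative (\<lambda>x. f x + g x) (at x) h = frechet_derivative f (at x) h + frechet_derivative g (at x) h"
  by (rule fun_cong[OF frechet_derivative_at[OF
      has_derivative_add[OF assms[unfolded frechet_derivative_works]]], symmetric])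

lemma frechet_derivative_mult:
  fixes f g :: "'a::real_normed_vector \<Rightarrow> real"
  assumes "f differentiable (at x)" "g differentiable (at x)"
  shows "frechet_derivative (\<lambda>x. f x * g x) (at x) h
    = f x * frechet_derivative g (at x) h + frechet_derivative f (at x) h * g x"
  by (rule fun_cong[OF frechet_derivative_at[OF
      has_derivative_mult[OF assms[unfolded frechet_derivative_works]]], symmetric])

lemma C_k_add: "C_k n f \<Longrightarrow> C_k n g \<Longrightarrow> C_k n (\<lambda>x. f x + g x)"
proof (induction n arbitrary: f g)
  case (Suc n)
  then show ?case by (auto simp: frechet_derivative_add)
qed (auto intro: continuous_on_add)

lemma C_k_mult: "C_k n f \<Longrightarrow> C_k n g \<Longrightarrow> C_k n (\<lambda>x. f x * g x)"
proof (induction n arbitrary: f g)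
  case (Suc n)
  have "C_k n f" "C_k n g" using Suc.prems C_k_SucD by blast+
  then show ?case using Suc by (auto simp: frechet_derivative_mult intro!: C_k_add)
qed (auto intro: continuous_on_mult)

lemma test_functionsD:
  assumes "\<phi> \<in> test_functions \<Omega>"
  shows "C_k n \<phi>" "compact (closure {x. \<phi> x \<noteq> 0})" "closure {x. \<phi> x \<noteq> 0} \<subseteq> \<Omega>"
    "continuous_on UNIV \<phi>" "\<phi> differentiable (at x)"
    "b \<in> Basis \<Longrightarrow> continuous_on UNIV (\<lambda>x. frechet_derivative \<phi> (at x) b)"
proof -
  have C: "C_k n \<phi>" for n using assms by (auto simp: test_functions_def)
  then show "C_k n \<phi>" "continuous_on UNIV \<phi>" "\<phi> differentiable (at x)"
    "b \<in> Basis \<Longrightarrow> continuous_on UNIV (\<lambda>x. frechet_derivative \<phi> (at x) b)"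
    using C[of 0, unfolded C_k.simps] C[of "Suc 0", unfolded C_k.simps] by blast+
  show "compact (closure {x. \<phi> x \<noteq> 0})" "closure {x. \<phi> x \<noteq> 0} \<subseteq> \<Omega>"
    using assms by (auto simp: test_functions_def)
qed

lemma test_functionsI:
  assumes "\<And>n. C_k n \<phi>" "compact K" "K \<subseteq> \<Omega>" "\<And>x. x \<notin> K \<Longrightarrow> \<phi> x = 0"
  shows "\<phi> \<in> test_functions \<Omega>"
proof -
  have cl: "closure {x. \<phi> x \<noteq> 0} \<subseteq> K"
    using assms by (intro closure_minimal compact_imp_closed) auto
  then have "compact (closure {x. \<phi> x \<noteq> 0})"
    using compact_Int_closed[OF assms(2) closed_closure, of "{x. \<phi> x \<noteq> 0}"] by (simp add: Int_absorb1)
  then show ?thesis using assms cl by (auto simp: test_functions_def)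
qed

lemma test_functions_zero: "(\<lambda>x. 0) \<in> test_functions \<Omega>"
  by (rule test_functionsI[of _ "{}"]) (auto simp: C_k_const)

lemma not_in_support: "x \<notin> closure {x. \<phi> x \<noteq> 0} \<Longrightarrow> \<phi> x = 0"
  using closure_subset[of "{x. \<phi> x \<noteq> 0}"] by auto

lemma test_functions_add:
  assumes "\<phi> \<in> test_functions \<Omega>" "\<psi> \<in> test_functions \<Omega>"
  shows "(\<lambda>x. \<phi> x + \<psi> x) \<in> test_functions \<Omega>"
proof (rule test_functionsI)
  show "C_k n (\<lambda>x. \<phi> x + \<psi> x)" for n using assms by (intro C_k_add test_functionsD(1))
  show "compact (closure {x. \<phi> x \<noteq> 0} \<union> closure {x. \<psi> x \<noteq> 0})"
    using assms by (intro compact_Un test_functionsD(2))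
  show "closure {x. \<phi> x \<noteq> 0} \<union> closure {x. \<psi> x \<noteq> 0} \<subseteq> \<Omega>"
    using assms[THEN test_functionsD(3)] by simp
  show "\<phi> x + \<psi> x = 0" if "x \<notin> closure {x. \<phi> x \<noteq> 0} \<union> closure {x. \<psi> x \<noteq> 0}" for x
  proof -
    have "\<phi> x = 0" "\<psi> x = 0" using that by (blast intro: not_in_support)+
    then show ?thesis by simp
  qed
qed

lemma test_functions_smooth_mult:
  assumes "\<phi> \<in> test_functions \<Omega>" "\<And>n. C_k n f"
  shows "(\<lambda>x. f x * \<phi> x) \<in> test_functions \<Omega>"
proof (rule test_functionsI)
  show "C_k n (\<lambda>x. f x * \<phi> x)" for n by (intro C_k_mult assms(2) test_functionsD(1)[OF assms(1)])
  show "f x * \<phi> x = 0" if "x \<notin> closure {x. \<phi> x \<noteq> 0}" for x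
    using not_in_support[OF that] by simp
qed (use test_functionsD(2,3)[OF assms(1)] in simp_all)

lemma frechet_derivative_support:
  assumes "x \<notin> closure {x. \<phi> x \<noteq> 0}"
  shows "frechet_derivative \<phi> (at x) = (\<lambda>h. 0 :: real)"
proof (rule frechet_derivative_at[symmetric])
  have "((\<lambda>x. 0) has_derivative (\<lambda>h. 0)) (at x)" by simp
  then show "(\<phi> has_derivative (\<lambda>h. 0)) (at x)"
  proof (rule has_derivative_transform_within_open)
    show "open (- closure {x. \<phi> x \<noteq> 0})" "x \<in> - closure {x. \<phi> x \<noteq> 0}" using assms by auto
    show "0 = \<phi> y" if "y \<in> - closure {x. \<phi> x \<noteq> 0}" for y
      by (rule not_in_support[symmetric]) (use that in blast)
  qed
qed

lemma test_functions_partial: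
  assumes "\<phi> \<in> test_functions \<Omega>" "b \<in> Basis"
  shows "(\<lambda>x. frechet_derivative \<phi> (at x) b) \<in> test_functions \<Omega>"
proof (rule test_functionsI)
  show "C_k n (\<lambda>x. frechet_derivative \<phi> (at x) b)" for n
    using test_functionsD(1)[OF assms(1), of "Suc n"] assms(2) by simp
  show "frechet_derivative \<phi> (at x) b = 0" if "x \<notin> closure {x. \<phi> x \<noteq> 0}" for x
    by (simp only: frechet_derivative_support[OF that])
qed (use test_functionsD(2,3)[OF assms(1)] in \<open>simp_all only:\<close>)

lemma test_functions_bounded:
  assumes "\<phi> \<in> test_functions \<Omega>"
  obtains B where "\<And>x. \<bar>\<phi> x\<bar> \<le> B" "B > 0"
proof -
  have "compact (\<phi> ` closure {x. \<phi> x \<noteq> 0})"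
    using test_functionsD(2)[OF assms] continuous_on_subset[OF test_functionsD(4)[OF assms]]
    by (intro compact_continuous_image) auto
  then obtain B where B: "B > 0" "\<And>x. x \<in> closure {x. \<phi> x \<noteq> 0} \<Longrightarrow> \<bar>\<phi> x\<bar> \<le> B"
    using compact_imp_bounded[THEN bounded_pos[THEN iffD1]] by (metis image_eqI real_norm_def)
  have "\<bar>\<phi> x\<bar> \<le> B" for x
  proof (cases "x \<in> closure {x. \<phi> x \<noteq> 0}")
    case False
    then show ?thesis using not_in_support[OF False] B(1) by simp
  qed (rule B(2))
  with B(1) show ?thesis by (intro that)
qed

section \<open>Integrals of test functions\<close>

lemma integrable_continuous_compact_support:
  fixes f :: "'a::euclidean_space \<Rightarrow> 'b::euclidean_space"
  assumes "continuous_on UNIV f" "compact K" "\<And>x. x \<notin> K \<Longrightarrow> f x = 0"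
  shows "integrable lborel f"
proof -
  have "integrable lborel (\<lambda>x. indicator K x *\<^sub>R f x)"
    using assms by (intro borel_integrable_compact continuous_on_subset[OF assms(1)]) auto
  moreover have "(\<lambda>x. indicator K x *\<^sub>R f x) = f" using assms by (auto simp: indicator_def fun_eq_iff)
  ultimately show ?thesis by simp
qed

lemma square_integrable_continuous_compact_support:
  fixes f :: "'a::euclidean_space \<Rightarrow> 'b::euclidean_space"
  assumes "open \<Omega>" "continuous_on UNIV f" "compact K" "\<And>x. x \<notin> K \<Longrightarrow> f x = 0"
  shows "square_integrable \<Omega> f"
proof -
  have "integrable lborel (\<lambda>x. (norm (f x))\<^sup>2)"
    using assms by (intro integrable_continuous_compact_support[of _ K] continuous_intros) auto
  then have "integrable lebesgue (\<lambda>x. (norm (f x))\<^sup>2)"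
    using borel_measurable_integrable by (subst integrable_completion) blast+
  then have "integrable (lebesgue_on \<Omega>) (\<lambda>x. (norm (f x))\<^sup>2)"
    using assms(1) using integrable_mult_indicator[of \<Omega> lebesgue "\<lambda>x. (norm (f x))\<^sup>2"]
    by (simp add: integrable_restrict_space)
  moreover have "f \<in> borel_measurable (lebesgue_on \<Omega>)"
    using assms by (intro measurable_restrict_space1 measurable_completion) (simp add: borel_measurable_continuous_onI)
  ultimately show ?thesis by (simp add: square_integrable_def)
qed

text \<open>Passes to Borel measure on the whole space, where translation invariance and Fubini's
  theorem are applied.\<close>

lemma LINT_lebesgue_on_eq_lborel:
  fixes f :: "'a::euclidean_space \<Rightarrow> real"
  assumes "open \<Omega>" "f \<in> borel_measurable borel" "\<And>x. x \<notin> \<Omega> \<Longrightarrow> f x = 0"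
  shows "(LINT x|lebesgue_on \<Omega>. f x) = (LINT x|lborel. f x)"
proof -
  have "(LINT x|lebesgue_on \<Omega>. f x) = (LINT x|lebesgue. indicator \<Omega> x *\<^sub>R f x)"
    using assms by (intro integral_restrict_space) auto
  also have "(\<lambda>x. indicator \<Omega> x *\<^sub>R f x) = f" using assms by (auto simp: indicator_def fun_eq_iff)
  also have "(LINT x|lebesgue. f x) = (LINT x|lborel. f x)"
    using assms by (intro integral_completion) auto
  finally show ?thesis .
qed

lemma integral_translate:
  fixes f :: "'a::euclidean_space \<Rightarrow> real"
  assumes "f \<in> borel_measurable borel"
  shows "(LINT x|lborel. f (c + x)) = (LINT x|lborel. f x)"
proof -
  have "(LINT x|lborel. f x) = (LINT x|distr lborel borel ((+) c). f x)"
    by (simp add: lborel_distr_plus)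
  also have "\<dots> = (LINT x|lborel. f (c + x))" using assms by (intro integral_distr) auto
  finally show ?thesis by simp
qed

text \<open>Difference quotients have integral 0 by translation invariance, and dominated
  convergence transfers this to the derivative.\<close>

lemma integral_partial_test_function:
  assumes \<phi>: "\<phi> \<in> test_functions \<Omega>" and b: "b \<in> Basis"
  shows "(LINT x|lborel. frechet_derivative \<phi> (at x) b) = 0"
proof -
  let ?K = "closure {x. \<phi> x \<noteq> 0}"
  note D = test_functionsD[OF \<phi>]
  have [measurable]: "\<phi> \<in> borel_measurable borel" "(\<lambda>x. frechet_derivative \<phi> (at x) b) \<in> borel_measurable borel"
    using D(4) D(6)[OF b] by (auto intro: borel_measurable_continuous_onI)
  have int: "integrable lborel \<phi>"
    by (rule integrable_continuous_compact_support[OF D(4,2)]) (rule not_in_support)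
  obtain B where B: "\<And>x. \<bar>frechet_derivative \<phi> (at x) b\<bar> \<le> B" "B > 0"
    using test_functions_bounded[OF test_functions_partial[OF \<phi> b]] by blast
  obtain R where R: "R > 0" "\<And>x. x \<in> ?K \<Longrightarrow> norm x \<le> R"
    using compact_imp_bounded[OF D(2)] by (auto simp: bounded_pos)
  define t where "t n = 1 / real (Suc n)" for n
  have t: "0 < t n" "t n \<le> 1" for n by (auto simp: t_def)
  have t0: "t \<longlonglongrightarrow> 0" unfolding t_def by (rule LIMSEQ_Suc[OF lim_1_over_n])
  define q where "q n x = (\<phi> (t n *\<^sub>R b + x) - \<phi> x) / t n" for n x
  have der: "((\<lambda>s. \<phi> (s *\<^sub>R b + x)) has_real_derivative frechet_derivative \<phi> (at (s *\<^sub>R b + x)) b) (at s)" for s x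
  proof -
    have "(\<phi> has_derivative frechet_derivative \<phi> (at (s *\<^sub>R b + x))) (at (s *\<^sub>R b + x))"
      using D(5) by (simp add: frechet_derivative_works[symmetric])
    moreover have "((\<lambda>s. s *\<^sub>R b + x) has_derivative (\<lambda>h. h *\<^sub>R b)) (at s)"
      by (auto intro!: derivative_eq_intros)
    ultimately have "((\<lambda>s. \<phi> (s *\<^sub>R b + x)) has_derivative (\<lambda>h. frechet_derivative \<phi> (at (s *\<^sub>R b + x)) (h *\<^sub>R b))) (at s)"
      by (rule has_derivative_compose[rotated])
    moreover have "frechet_derivative \<phi> (at y) (h *\<^sub>R b) = h * frechet_derivative \<phi> (at y) b" for y h
      using linear_frechet_derivative[OF D(5)] by (simp add: linear_cmul)
    ultimately show ?thesis by (simp add: has_field_derivative_def mult_commute_abs)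
  qed
  have lim: "(\<lambda>n. q n x) \<longlonglongrightarrow> frechet_derivative \<phi> (at x) b" for x
  proof -
    have "((\<lambda>h. (\<phi> (h *\<^sub>R b + x) - \<phi> x) / h) \<longlongrightarrow> frechet_derivative \<phi> (at x) b) (at 0)"
      using der[of x 0] by (simp add: DERIV_def)
    moreover have "filterlim t (at 0) sequentially"
      using t0 t(1) by (auto simp: filterlim_at intro!: always_eventually less_imp_neq[symmetric])
    ultimately show ?thesis unfolding q_def by (rule filterlim_compose)
  qed
  \<comment> \<open>The mean value theorem inside the ball. Outside, both points miss the support,
    since the shift has length at most 1.\<close>
  have bound: "norm (q n x) \<le> indicator (cball 0 (R + 1)) x *\<^sub>R B" for n x
  proof (cases "x \<in> cball 0 (R + 1)")
    case True
    obtain \<xi> where "\<phi> (t n *\<^sub>R b + x) - \<phi> (0 *\<^sub>R b + x) = (t n - 0) * frechet_derivative \<phi> (at (\<xi> *\<^sub>R b + x)) b"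
      using MVT2[OF t(1) der] by blast
    then have "q n x = frechet_derivative \<phi> (at (\<xi> *\<^sub>R b + x)) b" using t(1)[of n] by (simp add: q_def)
    then show ?thesis using B(1) True by simp
  next
    case False
    have "norm x \<le> norm (t n *\<^sub>R b + x) + norm (t n *\<^sub>R b)" by (metis add_diff_cancel_left' norm_triangle_ineq4)
    moreover have "norm (t n *\<^sub>R b) \<le> 1" using t[of n] b by simp
    ultimately have "\<not> norm x \<le> R" "\<not> norm (t n *\<^sub>R b + x) \<le> R" using False by auto
    then have "x \<notin> ?K" "t n *\<^sub>R b + x \<notin> ?K" using R(2) by blast+
    then have "\<phi> x = 0" "\<phi> (t n *\<^sub>R b + x) = 0" by (blast intro: not_in_support)+
    then have "q n x = 0" by (simp add: q_def)
    then show ?thesis using False by simp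
  qed
  have "(\<lambda>n. LINT x|lborel. q n x) \<longlonglongrightarrow> (LINT x|lborel. frechet_derivative \<phi> (at x) b)"
  proof (rule integral_dominated_convergence)
    show "integrable lborel (\<lambda>x. indicator (cball 0 (R + 1)) x *\<^sub>R B)"
      by (intro borel_integrable_compact continuous_intros compact_cball)
  qed (use lim bound in \<open>auto simp: q_def\<close>)
  moreover have "(LINT x|lborel. q n x) = 0" for n
  proof -
    have "integrable lborel (\<lambda>x. \<phi> (t n *\<^sub>R b + x))"
    proof -
      have "integrable (distr lborel borel ((+) (t n *\<^sub>R b))) \<phi>" using int by (simp add: lborel_distr_plus)
      then show ?thesis by (subst (asm) integrable_distr_eq) auto
    qed
    then show ?thesis
      unfolding q_def using int integral_translate[of \<phi> "t n *\<^sub>R b"] by simp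
  qed
  ultimately show ?thesis by (simp add: LIMSEQ_const_iff)
qed

lemma grad_inner: "b \<in> Basis \<Longrightarrow> grad f x \<bullet> b = frechet_derivative f (at x) b"
  by (simp add: grad_def inner_sum_left inner_Basis if_distrib cong: if_cong)

lemma continuous_on_grad:
  "\<phi> \<in> test_functions \<Omega> \<Longrightarrow> continuous_on UNIV (grad \<phi>)"
  unfolding grad_def[abs_def] by (intro continuous_intros test_functionsD(6))

text \<open>A function and its weak gradient are combined into one function with values in
  \<open>real \<times> 'a\<close>, so that convergence in \<open>H\<^sup>1\<close> is convergence in \<open>L\<^sup>2\<close>.\<close>

definition test_pair :: "('a::euclidean_space \<Rightarrow> real) \<Rightarrow> 'a \<Rightarrow> real \<times> 'a" where
  "test_pair \<phi> x = (\<phi> x, grad \<phi> x)"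

lemma square_integrable_test_function:
  assumes "open \<Omega>" "\<phi> \<in> test_functions \<Omega>"
  shows "square_integrable \<Omega> \<phi>"
  by (rule square_integrable_continuous_compact_support[OF assms(1) test_functionsD(4,2)[OF assms(2)]])
    (rule not_in_support)

lemma square_integrable_test_pair:
  assumes "open \<Omega>" "\<phi> \<in> test_functions \<Omega>"
  shows "square_integrable \<Omega> (test_pair \<phi>)"
proof (rule square_integrable_continuous_compact_support[OF assms(1) _ test_functionsD(2)[OF assms(2)]])
  show "continuous_on UNIV (test_pair \<phi>)"
    unfolding test_pair_def[abs_def]
    by (intro continuous_intros continuous_on_grad[OF assms(2)] test_functionsD(4)[OF assms(2)])
  show "test_pair \<phi> x = 0" if "x \<notin> closure {x. \<phi> x \<noteq> 0}" for x
    using not_in_support[OF that] frechet_derivative_support[OF that]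
    by (simp add: test_pair_def grad_def zero_prod_def)
qed

text \<open>The vanishing integral of a partial derivative, applied to the product of the two
  functions.\<close>

lemma test_function_integration_by_parts:
  assumes \<Omega>: "open \<Omega>" and \<phi>: "\<phi> \<in> test_functions \<Omega>" and \<psi>: "\<psi> \<in> test_functions \<Omega>" and b: "b \<in> Basis"
  shows "(LINT x|lebesgue_on \<Omega>. \<phi> x * frechet_derivative \<psi> (at x) b)
    = - (LINT x|lebesgue_on \<Omega>. frechet_derivative \<phi> (at x) b * \<psi> x)"
proof -
  have prod: "(\<lambda>x. \<phi> x * \<psi> x) \<in> test_functions \<Omega>"
    using test_functions_smooth_mult[OF \<psi> test_functionsD(1)[OF \<phi>]] .
  note pd = test_functions_partial[OF _ b]
  have "(LINT x|lebesgue_on \<Omega>. frechet_derivative (\<lambda>x. \<phi> x * \<psi> x) (at x) b)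
      = (LINT x|lborel. frechet_derivative (\<lambda>x. \<phi> x * \<psi> x) (at x) b)"
  proof (rule LINT_lebesgue_on_eq_lborel[OF \<Omega>])
    show "(\<lambda>x. frechet_derivative (\<lambda>x. \<phi> x * \<psi> x) (at x) b) \<in> borel_measurable borel"
      by (rule borel_measurable_continuous_onI[OF test_functionsD(6)[OF prod b]])
    show "frechet_derivative (\<lambda>x. \<phi> x * \<psi> x) (at x) b = 0" if "x \<notin> \<Omega>" for x
      using that test_functionsD(3)[OF prod] by (subst frechet_derivative_support) auto
  qed
  also have "\<dots> = 0" by (rule integral_partial_test_function[OF prod b])
  finally have "(LINT x|lebesgue_on \<Omega>. frechet_derivative (\<lambda>x. \<phi> x * \<psi> x) (at x) b) = 0" .
  moreover have "frechet_derivative (\<lambda>x. \<phi> x * \<psi> x) (at x) b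
      = \<phi> x * frechet_derivative \<psi> (at x) b + frechet_derivative \<phi> (at x) b * \<psi> x" for x
    using test_functionsD(5) \<phi> \<psi> by (intro frechet_derivative_mult) auto
  moreover have "integrable (lebesgue_on \<Omega>) (\<lambda>x. \<phi> x * frechet_derivative \<psi> (at x) b)"
    "integrable (lebesgue_on \<Omega>) (\<lambda>x. frechet_derivative \<phi> (at x) b * \<psi> x)"
    using integrable_L2_inner[OF square_integrable_test_function[OF \<Omega> \<phi>] square_integrable_test_function[OF \<Omega> pd[OF \<psi>]]]
      integrable_L2_inner[OF square_integrable_test_function[OF \<Omega> pd[OF \<phi>]] square_integrable_test_function[OF \<Omega> \<psi>]]
    by simp_all
  ultimately show ?thesis by simp
qed

section \<open>The Poincare inequality on convex sets\<close>

text \<open>The fundamental theorem of calculus along the segment, followed by Cauchy-Schwarz in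
  \<open>t\<close> and in the inner product.\<close>

lemma segment_difference_square_le:
  fixes \<phi> :: "'a::euclidean_space \<Rightarrow> real"
  assumes \<phi>: "\<phi> \<in> test_functions \<Omega>" and \<delta>: "dist x y \<le> \<delta>"
  shows "ennreal ((\<phi> x - \<phi> y)\<^sup>2)
    \<le> ennreal (\<delta>\<^sup>2) * (\<integral>\<^sup>+t. ennreal ((norm (grad \<phi> (y + t *\<^sub>R (x - y))))\<^sup>2) * indicator {0..1} t \<partial>lborel)"
proof -
  define h where "h t = \<phi> (y + t *\<^sub>R (x - y))" for t
  define h' where "h' t = grad \<phi> (y + t *\<^sub>R (x - y)) \<bullet> (x - y)" for t
  define g where "g t = (norm (grad \<phi> (y + t *\<^sub>R (x - y))))\<^sup>2" for t
  define L where "L = \<phi> x - \<phi> y"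
  have grad_cont: "continuous_on UNIV (\<lambda>t. grad \<phi> (y + t *\<^sub>R (x - y)))"
    by (rule continuous_on_compose2[OF continuous_on_grad[OF \<phi>]]) (auto intro!: continuous_intros)
  have cont: "continuous_on UNIV h'" "continuous_on UNIV g"
    unfolding h'_def g_def by (intro continuous_intros grad_cont)+
  have der: "(h has_real_derivative h' t) (at t)" for t
  proof -
    let ?z = "y + t *\<^sub>R (x - y)"
    have "(\<phi> has_derivative frechet_derivative \<phi> (at ?z)) (at ?z)"
      using test_functionsD(5)[OF \<phi>] by (simp add: frechet_derivative_works[symmetric])
    moreover have "((\<lambda>t. y + t *\<^sub>R (x - y)) has_derivative (\<lambda>h. h *\<^sub>R (x - y))) (at t)"
      by (auto intro!: derivative_eq_intros)
    ultimately have "(h has_derivative (\<lambda>c. frechet_derivative \<phi> (at ?z) (c *\<^sub>R (x - y)))) (at t)"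
      unfolding h_def by (rule has_derivative_compose[rotated])
    moreover have "frechet_derivative \<phi> (at ?z) (c *\<^sub>R (x - y)) = c * h' t" for c
    proof -
      have lin: "linear (frechet_derivative \<phi> (at ?z))"
        using linear_frechet_derivative[OF test_functionsD(5)[OF \<phi>]] .
      have "frechet_derivative \<phi> (at ?z) v = grad \<phi> ?z \<bullet> v" for v
      proof -
        have "frechet_derivative \<phi> (at ?z) v = frechet_derivative \<phi> (at ?z) (\<Sum>b\<in>Basis. (v \<bullet> b) *\<^sub>R b)"
          by (simp add: euclidean_representation)
        also have "\<dots> = (\<Sum>b\<in>Basis. (v \<bullet> b) * frechet_derivative \<phi> (at ?z) b)"
          by (simp add: linear_sum[OF lin] linear_cmul[OF lin])
        also have "\<dots> = grad \<phi> ?z \<bullet> v"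
          by (simp add: grad_def inner_commute[of _ v] inner_sum_right mult.commute)
        finally show ?thesis .
      qed
      then show ?thesis by (simp add: h'_def)
    qed
    ultimately show ?thesis by (simp add: has_field_derivative_def mult_commute_abs)
  qed
  have int: "integrable lborel (\<lambda>t. f t * indicator {0..1} t)"
    if "continuous_on UNIV f" for f :: "real \<Rightarrow> real"
    using borel_integrable_compact[of "{0..1}" f] continuous_on_subset[OF that]
    by (simp add: mult.commute)
  \<comment> \<open>The integral of \<open>(h' - L)\<^sup>2\<close> is nonnegative, where \<open>L\<close> is the integral of \<open>h'\<close>.\<close>
  have "(LINT t|lborel. (2 * L * h' t - L\<^sup>2) * indicator {0..1} t)
      = (2 * L * h 1 - L\<^sup>2 * 1) - (2 * L * h 0 - L\<^sup>2 * 0)"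
    by (rule integral_FTC_Icc_real)
      (auto intro!: derivative_eq_intros der continuous_intros continuous_on_interior[OF cont(1)])
  also have "\<dots> = L\<^sup>2" by (simp add: h_def L_def power2_eq_square algebra_simps)
  finally have "L\<^sup>2 = (LINT t|lborel. (2 * L * h' t - L\<^sup>2) * indicator {0..1} t)" by simp
  also have "\<dots> \<le> (LINT t|lborel. (\<delta>\<^sup>2 * g t) * indicator {0..1} t)"
  proof (rule integral_mono)
    show "integrable lborel (\<lambda>t. (2 * L * h' t - L\<^sup>2) * indicator {0..1} t)"
      "integrable lborel (\<lambda>t. \<delta>\<^sup>2 * g t * indicator {0..1} t)"
      by (intro int continuous_intros cont)+
    fix t
    have "2 * L * h' t - L\<^sup>2 \<le> (h' t)\<^sup>2"
      using zero_le_power2[of "h' t - L"] by (simp add: power2_diff mult.commute mult.left_commute)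
    also have "(h' t)\<^sup>2 = \<bar>h' t\<bar>\<^sup>2" by simp
    also have "\<dots> \<le> (norm (grad \<phi> (y + t *\<^sub>R (x - y))) * \<delta>)\<^sup>2"
    proof (rule power_mono)
      have "\<bar>h' t\<bar> \<le> norm (grad \<phi> (y + t *\<^sub>R (x - y))) * norm (x - y)"
        unfolding h'_def by (rule Cauchy_Schwarz_ineq2)
      also have "\<dots> \<le> norm (grad \<phi> (y + t *\<^sub>R (x - y))) * \<delta>"
        using \<delta> by (intro mult_left_mono) (auto simp: dist_norm)
      finally show "\<bar>h' t\<bar> \<le> norm (grad \<phi> (y + t *\<^sub>R (x - y))) * \<delta>" .
    qed simp
    finally show "(2 * L * h' t - L\<^sup>2) * indicator {0..1} t \<le> (\<delta>\<^sup>2 * g t) * indicator {0..1} t"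
      by (simp add: g_def power_mult_distrib mult.commute indicator_def)
  qed
  finally have "ennreal (L\<^sup>2) \<le> ennreal (LINT t|lborel. (\<delta>\<^sup>2 * g t) * indicator {0..1} t)"
    by (rule ennreal_leI)
  also have "\<dots> = (\<integral>\<^sup>+t. ennreal ((\<delta>\<^sup>2 * g t) * indicator {0..1} t) \<partial>lborel)"
    by (intro nn_integral_eq_integral[symmetric] int continuous_intros cont) (simp add: g_def)
  also have "\<dots> = (\<integral>\<^sup>+t. ennreal (\<delta>\<^sup>2) * (ennreal (g t) * indicator {0..1} t) \<partial>lborel)"
    by (intro nn_integral_cong) (auto simp: ennreal_mult g_def indicator_def)
  also have "\<dots> = ennreal (\<delta>\<^sup>2) * (\<integral>\<^sup>+t. ennreal (g t) * indicator {0..1} t \<partial>lborel)"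
    using borel_measurable_continuous_onI[OF cont(2)] by (intro nn_integral_cmult) simp
  finally show ?thesis by (simp add: L_def g_def)
qed

lemma nn_integral_lborel_affine:
  fixes f :: "'a::euclidean_space \<Rightarrow> ennreal"
  assumes "f \<in> borel_measurable borel" "c \<noteq> 0"
  shows "(\<integral>\<^sup>+x. f x \<partial>lborel) = ennreal (\<bar>c\<bar> ^ DIM('a)) * (\<integral>\<^sup>+x. f (t + c *\<^sub>R x) \<partial>lborel)"
  using assms
  by (subst lborel_affine[OF assms(2), of t])
     (simp add: nn_integral_density nn_integral_distr nn_integral_cmult ennreal_power)

text \<open>Contraction towards \<open>y\<close> maps the convex set into itself, and for
  \<open>t \<ge> 1 / 2\<close> the change of variables costs at most the factor
  \<open>2 ^ DIM('a)\<close>.\<close>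

lemma nn_integral_contract_convex:
  fixes G :: "'a::euclidean_space \<Rightarrow> ennreal"
  assumes [measurable]: "G \<in> borel_measurable borel" "Q \<in> sets borel"
    and Q: "convex Q" and y: "y \<in> Q" and t: "1 / 2 \<le> t" "t \<le> 1"
  shows "(\<integral>\<^sup>+x. G (y + t *\<^sub>R (x - y)) * indicator Q x \<partial>lborel)
    \<le> 2 ^ DIM('a) * (\<integral>\<^sup>+x. G x * indicator Q x \<partial>lborel)"
proof -
  have eq: "y + t *\<^sub>R (x - y) = (1 - t) *\<^sub>R y + t *\<^sub>R x" for x by (simp add: algebra_simps)
  let ?I = "\<integral>\<^sup>+x. G ((1 - t) *\<^sub>R y + t *\<^sub>R x) * indicator Q ((1 - t) *\<^sub>R y + t *\<^sub>R x) \<partial>lborel"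
  have "(\<integral>\<^sup>+x. G (y + t *\<^sub>R (x - y)) * indicator Q x \<partial>lborel) \<le> ?I"
  proof (rule nn_integral_mono)
    fix x
    have "(1 - t) *\<^sub>R y + t *\<^sub>R x \<in> Q" if "x \<in> Q"
      using Q y that t by (intro convexD) auto
    then show "G (y + t *\<^sub>R (x - y)) * indicator Q x
        \<le> G ((1 - t) *\<^sub>R y + t *\<^sub>R x) * indicator Q ((1 - t) *\<^sub>R y + t *\<^sub>R x)"
      unfolding eq by (auto simp: indicator_def)
  qed
  also have "\<dots> = ennreal (2 ^ DIM('a) * (1 / 2) ^ DIM('a)) * ?I"
    by (simp add: power_mult_distrib[symmetric])
  also have "\<dots> \<le> ennreal (2 ^ DIM('a) * \<bar>t\<bar> ^ DIM('a)) * ?I"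
    using t by (intro mult_right_mono ennreal_leI mult_left_mono power_mono) auto
  also have "\<dots> = 2 ^ DIM('a) * (ennreal (\<bar>t\<bar> ^ DIM('a)) * ?I)"
    by (simp add: ennreal_mult mult.assoc ennreal_power[symmetric])
  also have "ennreal (\<bar>t\<bar> ^ DIM('a)) * ?I = (\<integral>\<^sup>+x. G x * indicator Q x \<partial>lborel)"
    using t by (intro nn_integral_lborel_affine[symmetric]) auto
  finally show ?thesis .
qed

text \<open>For small \<open>t\<close> the contraction towards \<open>y\<close> is too strong, but
  the same point arises from \<open>x\<close> with parameter \<open>1 - t\<close>, so the two
  variables exchange roles.\<close>

lemma nn_integral_segment_convex:
  fixes G :: "'a::euclidean_space \<Rightarrow> ennreal"
  assumes [measurable]: "G \<in> borel_measurable borel" "Q \<in> sets borel"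
    and Q: "convex Q" and t: "0 \<le> t" "t \<le> 1"
  shows "(\<integral>\<^sup>+y. (\<integral>\<^sup>+x. G (y + t *\<^sub>R (x - y)) * indicator Q x \<partial>lborel) * indicator Q y \<partial>lborel)
    \<le> 2 ^ DIM('a) * emeasure lborel Q * (\<integral>\<^sup>+x. G x * indicator Q x \<partial>lborel)"
proof -
  let ?I = "\<integral>\<^sup>+x. G x * indicator Q x \<partial>lborel"
  have half: "(\<integral>\<^sup>+y. (\<integral>\<^sup>+x. G (y + t *\<^sub>R (x - y)) * indicator Q x \<partial>lborel) * indicator Q y \<partial>lborel)
      \<le> 2 ^ DIM('a) * emeasure lborel Q * ?I" if "1 / 2 \<le> t" "t \<le> 1" for t
  proof -
    have "(\<integral>\<^sup>+y. (\<integral>\<^sup>+x. G (y + t *\<^sub>R (x - y)) * indicator Q x \<partial>lborel) * indicator Q y \<partial>lborel)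
        \<le> (\<integral>\<^sup>+y. (2 ^ DIM('a) * ?I) * indicator Q y \<partial>lborel)"
    proof (rule nn_integral_mono)
      show "(\<integral>\<^sup>+x. G (y + t *\<^sub>R (x - y)) * indicator Q x \<partial>lborel) * indicator Q y
          \<le> (2 ^ DIM('a) * ?I) * indicator Q y" for y
        using nn_integral_contract_convex[OF assms(1,2) Q _ that, of y] by (cases "y \<in> Q") auto
    qed
    also have "\<dots> = 2 ^ DIM('a) * ?I * emeasure lborel Q" by (rule nn_integral_cmult_indicator) simp
    finally show ?thesis by (simp add: mult_ac)
  qed
  show ?thesis
  proof (cases "1 / 2 \<le> t")
    case True
    then show ?thesis using half t by blast
  next
    case False
    have "(\<integral>\<^sup>+y. (\<integral>\<^sup>+x. G (y + t *\<^sub>R (x - y)) * indicator Q x \<partial>lborel) * indicator Q y \<partial>lborel)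
        = (\<integral>\<^sup>+y. (\<integral>\<^sup>+x. G (y + t *\<^sub>R (x - y)) * indicator Q x * indicator Q y \<partial>lborel) \<partial>lborel)"
      by (intro nn_integral_cong nn_integral_multc[symmetric]) measurable
    also have "\<dots> = (\<integral>\<^sup>+x. (\<integral>\<^sup>+y. G (y + t *\<^sub>R (x - y)) * indicator Q x * indicator Q y \<partial>lborel) \<partial>lborel)"
      by (rule lborel_pair.Fubini') measurable
    also have "\<dots> = (\<integral>\<^sup>+x. (\<integral>\<^sup>+y. G (x + (1 - t) *\<^sub>R (y - x)) * indicator Q y \<partial>lborel) * indicator Q x \<partial>lborel)"
    proof (intro nn_integral_cong)
      fix x
      have "(\<integral>\<^sup>+y. G (y + t *\<^sub>R (x - y)) * indicator Q x * indicator Q y \<partial>lborel)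
          = (\<integral>\<^sup>+y. G (x + (1 - t) *\<^sub>R (y - x)) * indicator Q y * indicator Q x \<partial>lborel)"
        by (intro nn_integral_cong) (simp add: algebra_simps)
      also have "\<dots> = (\<integral>\<^sup>+y. G (x + (1 - t) *\<^sub>R (y - x)) * indicator Q y \<partial>lborel) * indicator Q x"
        by (rule nn_integral_multc) measurable
      finally show "(\<integral>\<^sup>+y. G (y + t *\<^sub>R (x - y)) * indicator Q x * indicator Q y \<partial>lborel)
          = (\<integral>\<^sup>+y. G (x + (1 - t) *\<^sub>R (y - x)) * indicator Q y \<partial>lborel) * indicator Q x" .
    qed
    also have "\<dots> \<le> 2 ^ DIM('a) * emeasure lborel Q * ?I" using False t by (intro half) auto
    finally show ?thesis .
  qed
qed

text \<open>Fubini's theorem moves the segment parameter outermost, where the estimate for each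
  fixed \<open>t\<close> applies.\<close>

lemma nn_integral_double_difference_le:
  fixes \<phi> :: "'a::euclidean_space \<Rightarrow> real"
  assumes \<phi>: "\<phi> \<in> test_functions \<Omega>"
    and Q: "Q \<in> sets borel" "convex Q" and \<delta>: "\<And>x y. \<lbrakk>x \<in> Q; y \<in> Q\<rbrakk> \<Longrightarrow> dist x y \<le> \<delta>"
  shows "(\<integral>\<^sup>+y. (\<integral>\<^sup>+x. ennreal ((\<phi> x - \<phi> y)\<^sup>2) * indicator Q x \<partial>lborel) * indicator Q y \<partial>lborel)
    \<le> ennreal (\<delta>\<^sup>2) * (2 ^ DIM('a) * emeasure lborel Q *
        (\<integral>\<^sup>+x. ennreal ((norm (grad \<phi> x))\<^sup>2) * indicator Q x \<partial>lborel))"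
proof -
  note [measurable] = Q(1)
  define G where "G x = ennreal ((norm (grad \<phi> x))\<^sup>2)" for x
  have [measurable]: "G \<in> borel_measurable borel"
    unfolding G_def using borel_measurable_continuous_onI[OF continuous_on_grad[OF \<phi>]] by measurable
  let ?I = "\<integral>\<^sup>+x. G x * indicator Q x \<partial>lborel"
  let ?T = "\<lambda>t::real. indicator {0..1} t :: ennreal"
  let ?g = "\<lambda>x y t. G (y + t *\<^sub>R (x - y)) * ?T t * indicator Q x * indicator Q y"
  have "(\<integral>\<^sup>+y. (\<integral>\<^sup>+x. ennreal ((\<phi> x - \<phi> y)\<^sup>2) * indicator Q x \<partial>lborel) * indicator Q y \<partial>lborel)
      \<le> (\<integral>\<^sup>+y. (\<integral>\<^sup>+x. (ennreal (\<delta>\<^sup>2) * (\<integral>\<^sup>+t. G (y + t *\<^sub>R (x - y)) * ?T t \<partial>lborel)) * indicator Q x \<partial>lborel)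
          * indicator Q y \<partial>lborel)"
  proof (rule nn_integral_mono)
    fix y
    have "(\<integral>\<^sup>+x. ennreal ((\<phi> x - \<phi> y)\<^sup>2) * indicator Q x \<partial>lborel)
        \<le> (\<integral>\<^sup>+x. (ennreal (\<delta>\<^sup>2) * (\<integral>\<^sup>+t. G (y + t *\<^sub>R (x - y)) * ?T t \<partial>lborel)) * indicator Q x \<partial>lborel)"
      if "y \<in> Q"
    proof (rule nn_integral_mono)
      show "ennreal ((\<phi> x - \<phi> y)\<^sup>2) * indicator Q x
          \<le> (ennreal (\<delta>\<^sup>2) * (\<integral>\<^sup>+t. G (y + t *\<^sub>R (x - y)) * ?T t \<partial>lborel)) * indicator Q x" for x
        using segment_difference_square_le[OF \<phi> \<delta>, of x y] that by (cases "x \<in> Q") (auto simp: G_def)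
    qed
    then show "(\<integral>\<^sup>+x. ennreal ((\<phi> x - \<phi> y)\<^sup>2) * indicator Q x \<partial>lborel) * indicator Q y
        \<le> (\<integral>\<^sup>+x. (ennreal (\<delta>\<^sup>2) * (\<integral>\<^sup>+t. G (y + t *\<^sub>R (x - y)) * ?T t \<partial>lborel)) * indicator Q x \<partial>lborel)
          * indicator Q y"
      by (cases "y \<in> Q") auto
  qed
  also have "\<dots> = (\<integral>\<^sup>+y. (\<integral>\<^sup>+x. (\<integral>\<^sup>+t. ennreal (\<delta>\<^sup>2) * ?g x y t \<partial>lborel) \<partial>lborel) \<partial>lborel)"
    by (simp add: nn_integral_multc[symmetric] nn_integral_cmult[symmetric] mult.assoc)
  also have "\<dots> = ennreal (\<delta>\<^sup>2) * (\<integral>\<^sup>+y. (\<integral>\<^sup>+x. (\<integral>\<^sup>+t. ?g x y t \<partial>lborel) \<partial>lborel) \<partial>lborel)"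
    by (simp add: nn_integral_cmult)
  also have "(\<integral>\<^sup>+y. (\<integral>\<^sup>+x. (\<integral>\<^sup>+t. ?g x y t \<partial>lborel) \<partial>lborel) \<partial>lborel)
      = (\<integral>\<^sup>+y. (\<integral>\<^sup>+t. (\<integral>\<^sup>+x. ?g x y t \<partial>lborel) \<partial>lborel) \<partial>lborel)"
    by (intro nn_integral_cong lborel_pair.Fubini') measurable
  also have "\<dots> = (\<integral>\<^sup>+t. (\<integral>\<^sup>+y. (\<integral>\<^sup>+x. ?g x y t \<partial>lborel) \<partial>lborel) \<partial>lborel)"
    by (rule lborel_pair.Fubini') measurable
  also have "\<dots> \<le> (\<integral>\<^sup>+t. (2 ^ DIM('a) * emeasure lborel Q * ?I) * ?T t \<partial>lborel)"
  proof (rule nn_integral_mono)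
    fix t :: real
    show "(\<integral>\<^sup>+y. (\<integral>\<^sup>+x. ?g x y t \<partial>lborel) \<partial>lborel) \<le> (2 ^ DIM('a) * emeasure lborel Q * ?I) * ?T t"
    proof (cases "t \<in> {0..1}")
      case True
      then have "(\<integral>\<^sup>+y. (\<integral>\<^sup>+x. ?g x y t \<partial>lborel) \<partial>lborel)
          = (\<integral>\<^sup>+y. (\<integral>\<^sup>+x. G (y + t *\<^sub>R (x - y)) * indicator Q x \<partial>lborel) * indicator Q y \<partial>lborel)"
        by (simp add: nn_integral_multc)
      also have "\<dots> \<le> 2 ^ DIM('a) * emeasure lborel Q * ?I"
        using True Q by (intro nn_integral_segment_convex) auto
      finally show ?thesis using True by simp
    qed simp
  qed
  also have "\<dots> = (2 ^ DIM('a) * emeasure lborel Q * ?I) * emeasure lborel {0..1::real}"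
    by (rule nn_integral_cmult_indicator) simp
  finally show ?thesis by (simp add: G_def mult_left_mono)
qed

section \<open>The Poincare inequality on one convex set and on the cells of a division\<close>

lemma integrable_times_indicator:
  fixes f :: "'a::euclidean_space \<Rightarrow> real"
  assumes "integrable lborel f" "Q \<in> sets borel"
  shows "integrable lborel (\<lambda>x. f x * indicator Q x)"
  using integrable_mult_indicator[of Q lborel f] assms by (simp add: mult.commute)

lemma integrable_test_function_squares:
  assumes \<phi>: "\<phi> \<in> test_functions \<Omega>"
  shows "integrable lborel \<phi>" "integrable lborel (\<lambda>x. (\<phi> x)\<^sup>2)"
    "integrable lborel (\<lambda>x. (norm (grad \<phi> x))\<^sup>2)"
proof -
  note D = test_functionsD(4,2)[OF \<phi>]
  have 0: "\<phi> x = 0" "grad \<phi> x = 0" if "x \<notin> closure {x. \<phi> x \<noteq> 0}" for x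
    using not_in_support[OF that] frechet_derivative_support[OF that] by (simp_all add: grad_def)
  show "integrable lborel \<phi>"
    by (rule integrable_continuous_compact_support[OF D]) (rule 0)
  show "integrable lborel (\<lambda>x. (\<phi> x)\<^sup>2)"
  proof (rule integrable_continuous_compact_support[OF _ D(2)])
    show "continuous_on UNIV (\<lambda>x. (\<phi> x)\<^sup>2)" by (intro continuous_intros D)
    show "(\<phi> x)\<^sup>2 = 0" if "x \<notin> closure {x. \<phi> x \<noteq> 0}" for x using 0[OF that] by simp
  qed
  show "integrable lborel (\<lambda>x. (norm (grad \<phi> x))\<^sup>2)"
  proof (rule integrable_continuous_compact_support[OF _ D(2)])
    show "continuous_on UNIV (\<lambda>x. (norm (grad \<phi> x))\<^sup>2)" by (intro continuous_intros continuous_on_grad[OF \<phi>])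
    show "(norm (grad \<phi> x))\<^sup>2 = 0" if "x \<notin> closure {x. \<phi> x \<noteq> 0}" for x using 0[OF that] by simp
  qed
qed

text \<open>The double integral of \<open>(\<phi> x - \<phi> y)\<^sup>2\<close> over
  \<open>Q\<close> is twice the measure times the integral of the square, minus twice the square of
  the integral. Keeping the measure as a factor avoids division for null sets.\<close>

lemma poincare_convex:
  fixes \<phi> :: "'a::euclidean_space \<Rightarrow> real"
  assumes \<phi>: "\<phi> \<in> test_functions \<Omega>"
    and Q: "Q \<in> sets borel" "convex Q" "bounded Q" and \<delta>: "\<And>x y. \<lbrakk>x \<in> Q; y \<in> Q\<rbrakk> \<Longrightarrow> dist x y \<le> \<delta>"
  shows "measure lborel Q * (LINT x|lborel. (\<phi> x)\<^sup>2 * indicator Q x)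
    \<le> (LINT x|lborel. \<phi> x * indicator Q x)\<^sup>2
      + \<delta>\<^sup>2 * 2 ^ DIM('a) * measure lborel Q * (LINT x|lborel. (norm (grad \<phi> x))\<^sup>2 * indicator Q x)"
proof -
  define \<rho> where "\<rho> = measure lborel Q"
  define A where "A = (LINT x|lborel. \<phi> x * indicator Q x)"
  define B where "B = (LINT x|lborel. (\<phi> x)\<^sup>2 * indicator Q x)"
  define E where "E = (LINT x|lborel. (norm (grad \<phi> x))\<^sup>2 * indicator Q x)"
  note int = integrable_test_function_squares[OF \<phi>, THEN integrable_times_indicator, OF Q(1)]
  have fin: "emeasure lborel Q < \<infinity>" by (rule emeasure_bounded_finite[OF Q(3)])
  have eQ: "emeasure lborel Q = ennreal \<rho>" using fin by (simp add: \<rho>_def emeasure_eq_ennreal_measure)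
  have i1: "integrable lborel (indicator Q :: 'a \<Rightarrow> real)" using Q(1) fin by simp
  have I1: "(LINT x|lborel. indicator Q x) = \<rho>" by (simp add: \<rho>_def)
  have E0: "0 \<le> E" unfolding E_def by simp
  have inner: "integrable lborel (\<lambda>x. (\<phi> x - c)\<^sup>2 * indicator Q x)"
    "(LINT x|lborel. (\<phi> x - c)\<^sup>2 * indicator Q x) = B - 2 * c * A + c\<^sup>2 * \<rho>" for c
  proof -
    have eq: "(\<phi> x - c)\<^sup>2 * indicator Q x
        = (\<phi> x)\<^sup>2 * indicator Q x - (2 * c) * (\<phi> x * indicator Q x) + c\<^sup>2 * indicator Q x" for x
      by (simp add: power2_diff algebra_simps)
    show "integrable lborel (\<lambda>x. (\<phi> x - c)\<^sup>2 * indicator Q x)"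
      unfolding eq using int i1 by simp
    show "(LINT x|lborel. (\<phi> x - c)\<^sup>2 * indicator Q x) = B - 2 * c * A + c\<^sup>2 * \<rho>"
      unfolding eq using int i1 by (simp add: A_def B_def \<rho>_def)
  qed
  \<comment> \<open>The inner integral is a quadratic polynomial in \<open>c\<close>; afterwards
    \<open>c = \<phi> y\<close> is integrated over \<open>Q\<close> as well.\<close>
  have nn_inner: "(\<integral>\<^sup>+x. ennreal ((\<phi> x - c)\<^sup>2) * indicator Q x \<partial>lborel) = ennreal (B - 2 * c * A + c\<^sup>2 * \<rho>)" for c
  proof -
    have "(\<integral>\<^sup>+x. ennreal ((\<phi> x - c)\<^sup>2) * indicator Q x \<partial>lborel) = (\<integral>\<^sup>+x. ennreal ((\<phi> x - c)\<^sup>2 * indicator Q x) \<partial>lborel)"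
      by (intro nn_integral_cong) (auto simp: indicator_def)
    also have "\<dots> = ennreal (LINT x|lborel. (\<phi> x - c)\<^sup>2 * indicator Q x)"
      by (rule nn_integral_eq_integral[OF inner(1)]) simp
    finally show ?thesis by (simp only: inner(2))
  qed
  have inner_nonneg: "0 \<le> B - 2 * c * A + c\<^sup>2 * \<rho>" for c
    unfolding inner(2)[symmetric] by simp
  have outer: "(\<integral>\<^sup>+y. ennreal (B - 2 * \<phi> y * A + (\<phi> y)\<^sup>2 * \<rho>) * indicator Q y \<partial>lborel) = ennreal (2 * \<rho> * B - 2 * A\<^sup>2)"
  proof -
    have eq: "(B - 2 * \<phi> y * A + (\<phi> y)\<^sup>2 * \<rho>) * indicator Q y
        = B * indicator Q y - (2 * A) * (\<phi> y * indicator Q y) + \<rho> * ((\<phi> y)\<^sup>2 * indicator Q y)" for y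
      by (simp add: algebra_simps)
    have "(\<integral>\<^sup>+y. ennreal (B - 2 * \<phi> y * A + (\<phi> y)\<^sup>2 * \<rho>) * indicator Q y \<partial>lborel)
        = (\<integral>\<^sup>+y. ennreal ((B - 2 * \<phi> y * A + (\<phi> y)\<^sup>2 * \<rho>) * indicator Q y) \<partial>lborel)"
      by (intro nn_integral_cong) (auto simp: indicator_def)
    also have "\<dots> = ennreal (LINT y|lborel. (B - 2 * \<phi> y * A + (\<phi> y)\<^sup>2 * \<rho>) * indicator Q y)"
    proof (rule nn_integral_eq_integral)
      show "integrable lborel (\<lambda>y. (B - 2 * \<phi> y * A + (\<phi> y)\<^sup>2 * \<rho>) * indicator Q y)"
        unfolding eq using int i1 by simp
    qed (simp add: inner_nonneg)
    also have "(LINT y|lborel. (B - 2 * \<phi> y * A + (\<phi> y)\<^sup>2 * \<rho>) * indicator Q y) = 2 * \<rho> * B - 2 * A\<^sup>2"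
      unfolding eq using int i1 by (simp add: A_def[symmetric] B_def[symmetric] \<rho>_def[symmetric])
        (simp add: power2_eq_square)
    finally show ?thesis .
  qed
  have nnE: "(\<integral>\<^sup>+x. ennreal ((norm (grad \<phi> x))\<^sup>2) * indicator Q x \<partial>lborel) = ennreal E"
  proof -
    have "(\<integral>\<^sup>+x. ennreal ((norm (grad \<phi> x))\<^sup>2) * indicator Q x \<partial>lborel)
        = (\<integral>\<^sup>+x. ennreal ((norm (grad \<phi> x))\<^sup>2 * indicator Q x) \<partial>lborel)"
      by (intro nn_integral_cong) (auto simp: indicator_def)
    also have "\<dots> = ennreal E" unfolding E_def by (rule nn_integral_eq_integral[OF int(3)]) simp
    finally show ?thesis .
  qed
  have "ennreal (2 * \<rho> * B - 2 * A\<^sup>2) \<le> ennreal (\<delta>\<^sup>2) * (2 ^ DIM('a) * ennreal \<rho> * ennreal E)"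
    using nn_integral_double_difference_le[OF \<phi> Q(1,2) \<delta>] by (simp only: nn_inner outer nnE eQ)
  also have "\<dots> = ennreal (\<delta>\<^sup>2 * (2 ^ DIM('a) * \<rho> * E))"
    using E0 by (simp add: ennreal_mult \<rho>_def flip: ennreal_power)
  finally have "2 * \<rho> * B - 2 * A\<^sup>2 \<le> \<delta>\<^sup>2 * (2 ^ DIM('a) * \<rho> * E)"
    using E0 by (subst (asm) ennreal_le_iff) (auto simp: \<rho>_def)
  moreover have "0 \<le> \<delta>\<^sup>2 * (2 ^ DIM('a) * \<rho> * E)" using E0 by (simp add: \<rho>_def)
  \<comment> \<open>The factor 2 on the left is not passed on to the gradient term, which is
    nonnegative.\<close>
  ultimately have "\<rho> * B \<le> A\<^sup>2 + \<delta>\<^sup>2 * 2 ^ DIM('a) * \<rho> * E" by (simp add: mult.assoc)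
  then show ?thesis by (simp only: A_def B_def E_def \<rho>_def)
qed

text \<open>Cells may share boundary points, but frontiers of convex sets are null sets, so almost
  every point of the box lies in exactly one cell.\<close>

lemma integral_division_sum:
  fixes f :: "'a::euclidean_space \<Rightarrow> real"
  assumes D: "D division_of cbox a b" and f: "integrable lborel f" "\<And>x. x \<notin> cbox a b \<Longrightarrow> f x = 0"
  shows "(LINT x|lborel. f x) = (\<Sum>Q\<in>D. LINT x|lborel. f x * indicator Q x)"
proof -
  note div = division_ofD[OF D]
  have meas: "Q \<in> sets borel" if "Q \<in> D" for Q using div(4)[OF that] by auto
  have fr: "AE x in lborel. x \<notin> frontier Q" if Q: "Q \<in> D" for Q
  proof -
    have "convex Q" using div(4)[OF Q] by auto
    then have "frontier Q \<in> null_sets lebesgue"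
      using negligible_convex_frontier negligible_iff_null_sets by blast
    then have "frontier Q \<in> null_sets lborel"
      by (subst (asm) null_sets_completion_iff) auto
    then show ?thesis by (rule AE_not_in)
  qed
  have "AE x in lborel. \<forall>Q\<in>D. x \<notin> frontier Q"
    using div(1) fr by (intro AE_finite_allI) auto
  then have ae: "AE x in lborel. f x = (\<Sum>Q\<in>D. f x * indicator Q x)"
  proof eventually_elim
    case (elim x)
    show ?case
    proof (cases "x \<in> cbox a b")
      case False
      then show ?thesis using f(2) by simp
    next
      case True
      then obtain Q where Q: "Q \<in> D" "x \<in> Q" using div(6) by blast
      have "x \<notin> Q'" if "Q' \<in> D" "Q' \<noteq> Q" for Q'
      proof
        assume "x \<in> Q'"
        then have "x \<in> interior Q'" "x \<in> interior Q"
          using elim Q that closure_subset by (auto simp: frontier_def)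
        then show False using div(5)[OF that(1) Q(1) that(2)] by blast
      qed
      then have "(\<Sum>Q\<in>D. f x * indicator Q x) = (\<Sum>Q'\<in>D. if Q' = Q then f x else 0)"
        using Q by (intro sum.cong) (auto simp: indicator_def)
      then show ?thesis using Q div(1) by simp
    qed
  qed
  have "(LINT x|lborel. f x) = (LINT x|lborel. (\<Sum>Q\<in>D. f x * indicator Q x))"
    using ae f(1) meas by (intro integral_cong_AE) (auto intro!: borel_measurable_sum borel_measurable_times)
  also have "\<dots> = (\<Sum>Q\<in>D. LINT x|lborel. f x * indicator Q x)"
    using integrable_times_indicator[OF f(1) meas] by (intro Bochner_Integration.integral_sum) auto
  finally show ?thesis .
qed

text \<open>The Poincare constant of a cell is of the order of its squared diameter, so a fine
  enough division makes it as small as \<open>e\<close>. The means over the cells are the finitely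
  many functionals.\<close>

lemma poincare_finite_functionals:
  fixes \<Omega> :: "'a::euclidean_space set"
  assumes \<Omega>: "bounded \<Omega>" and e: "e > 0"
  obtains D where "finite D" "\<And>Q. Q \<in> D \<Longrightarrow> \<exists>a b. Q = cbox a b"
    "\<And>\<phi>. \<phi> \<in> test_functions \<Omega> \<Longrightarrow>
      (LINT x|lborel. (\<phi> x)\<^sup>2) \<le> (\<Sum>Q\<in>D. (LINT x|lborel. \<phi> x * indicator Q x)\<^sup>2 / measure lborel Q)
        + e * (LINT x|lborel. (norm (grad \<phi> x))\<^sup>2)"
proof -
  obtain a b where ab: "\<Omega> \<subseteq> cbox a b" using bounded_subset_cbox_symmetric[OF \<Omega>] by blast
  \<comment> \<open>Chosen so that the constant \<open>\<delta>\<^sup>2 * 2 ^ DIM('a)\<close> of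
    \<open>poincare_convex\<close> is \<open>e\<close>.\<close>
  define \<delta> where "\<delta> = sqrt (e / 2 ^ DIM('a))"
  have \<delta>: "\<delta> > 0" "\<delta>\<^sup>2 * 2 ^ DIM('a) = e" using e by (simp_all add: \<delta>_def)
  have "gauge (\<lambda>x::'a. ball x (\<delta> / 2))" using \<delta> by (intro gauge_ball) simp
  then obtain p where p: "p tagged_division_of cbox a b" "(\<lambda>x. ball x (\<delta> / 2)) fine p"
    by (rule fine_division_exists)
  define D where "D = snd ` p"
  have D: "D division_of cbox a b" unfolding D_def by (rule division_of_tagged_division[OF p(1)])
  note div = division_ofD[OF D]
  have diam: "dist x y \<le> \<delta>" if Q: "Q \<in> D" "x \<in> Q" "y \<in> Q" for Q x y
  proof -
    from Q obtain t where "(t, Q) \<in> p" by (auto simp: D_def)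
    then have "Q \<subseteq> ball t (\<delta> / 2)" using p(2) by (auto simp: fine_def)
    then have "dist t x < \<delta> / 2" "dist t y < \<delta> / 2" using Q by auto
    then show ?thesis by (smt (verit) dist_commute dist_triangle field_sum_of_halves)
  qed
  have "(LINT x|lborel. (\<phi> x)\<^sup>2) \<le> (\<Sum>Q\<in>D. (LINT x|lborel. \<phi> x * indicator Q x)\<^sup>2 / measure lborel Q)
      + e * (LINT x|lborel. (norm (grad \<phi> x))\<^sup>2)" if \<phi>: "\<phi> \<in> test_functions \<Omega>" for \<phi>
  proof -
    note int = integrable_test_function_squares[OF \<phi>]
    have out: "\<phi> x = 0" "grad \<phi> x = 0" if "x \<notin> cbox a b" for x
    proof -
      have x: "x \<notin> closure {x. \<phi> x \<noteq> 0}" using that ab test_functionsD(3)[OF \<phi>] by blast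
      show "\<phi> x = 0" "grad \<phi> x = 0"
        using not_in_support[OF x] frechet_derivative_support[OF x] by (simp_all add: grad_def)
    qed
    have "(LINT x|lborel. (\<phi> x)\<^sup>2) = (\<Sum>Q\<in>D. LINT x|lborel. (\<phi> x)\<^sup>2 * indicator Q x)"
      by (rule integral_division_sum[OF D int(2)]) (simp add: out)
    also have "\<dots> \<le> (\<Sum>Q\<in>D. (LINT x|lborel. \<phi> x * indicator Q x)\<^sup>2 / measure lborel Q
        + e * (LINT x|lborel. (norm (grad \<phi> x))\<^sup>2 * indicator Q x))"
    proof (rule sum_mono)
      fix Q assume Q: "Q \<in> D"
      obtain l u where lu: "Q = cbox l u" using div(4)[OF Q] by blast
      have Q': "Q \<in> sets borel" "convex Q" "bounded Q" by (auto simp: lu)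
      note P = poincare_convex[OF \<phi> Q' diam[OF Q]]
      show "(LINT x|lborel. (\<phi> x)\<^sup>2 * indicator Q x) \<le> (LINT x|lborel. \<phi> x * indicator Q x)\<^sup>2 / measure lborel Q
          + e * (LINT x|lborel. (norm (grad \<phi> x))\<^sup>2 * indicator Q x)"
      proof (cases "measure lborel Q = 0")
        \<comment> \<open>On a null cell the integral on the left is 0, and the quotient on the
          right is 0 as well by \<open>x / 0 = 0\<close>.\<close>
        case True
        then have "Q \<in> null_sets lborel"
          using emeasure_bounded_finite[OF Q'(3)] Q'(1)
          by (auto simp: null_sets_def emeasure_eq_ennreal_measure)
        then have "AE x in lborel. x \<notin> Q" by (rule AE_not_in)
        then have "AE x in lborel. (\<phi> x)\<^sup>2 * indicator Q x = 0"
          by eventually_elim simp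
        then have "(LINT x|lborel. (\<phi> x)\<^sup>2 * indicator Q x) = 0"
          by (rule integral_eq_zero_AE)
        moreover have "0 \<le> (LINT x|lborel. (norm (grad \<phi> x))\<^sup>2 * indicator Q x)" by simp
        ultimately show ?thesis using True e by simp
      next
        case False
        then have "measure lborel Q > 0" by (simp add: less_le)
        then show ?thesis using P by (simp add: \<delta>(2) field_simps)
      qed
    qed
    also have "\<dots> = (\<Sum>Q\<in>D. (LINT x|lborel. \<phi> x * indicator Q x)\<^sup>2 / measure lborel Q)
        + e * (LINT x|lborel. (norm (grad \<phi> x))\<^sup>2)"
    proof -
      have "(LINT x|lborel. (norm (grad \<phi> x))\<^sup>2) = (\<Sum>Q\<in>D. LINT x|lborel. (norm (grad \<phi> x))\<^sup>2 * indicator Q x)"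
        by (rule integral_division_sum[OF D int(3)]) (simp add: out)
      then show ?thesis by (simp add: sum.distrib sum_distrib_left)
    qed
    finally show ?thesis .
  qed
  moreover have "finite D" "\<And>Q. Q \<in> D \<Longrightarrow> \<exists>a b. Q = cbox a b" using div(1,4) by auto
  ultimately show ?thesis by (intro that)
qed

section \<open>The Sobolev space and its quadratic forms\<close>

text \<open>A pair holds a function and its gradient. Splitting the inner product of pairs into two
  forms on the same space provides the \<open>s\<close> and \<open>a\<close> of
  \<open>form_pair\<close>.\<close>

definition val_inner :: "'a::euclidean_space set \<Rightarrow> ('a \<Rightarrow> real \<times> 'a) \<Rightarrow> ('a \<Rightarrow> real \<times> 'a) \<Rightarrow> real" where
  "val_inner \<Omega> U V = L2_inner \<Omega> (\<lambda>x. fst (U x)) (\<lambda>x. fst (V x))"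

definition grad_inner :: "'a::euclidean_space set \<Rightarrow> ('a \<Rightarrow> real \<times> 'a) \<Rightarrow> ('a \<Rightarrow> real \<times> 'a) \<Rightarrow> real" where
  "grad_inner \<Omega> U V = L2_inner \<Omega> (\<lambda>x. snd (U x)) (\<lambda>x. snd (V x))"

lemma square_integrable_bounded_linear:
  assumes u: "square_integrable \<Omega> u" and f: "bounded_linear f"
  shows "square_integrable \<Omega> (\<lambda>x. f (u x))"
proof -
  obtain K where K: "\<And>x. norm (f x) \<le> norm x * K" using bounded_linear.bounded[OF f] by blast
  have m: "(\<lambda>x. f (u x)) \<in> borel_measurable (lebesgue_on \<Omega>)"
    using borel_measurable_continuous_onI[OF linear_continuous_on[OF f]] square_integrableD(1)[OF u]
    by (rule measurable_compose[rotated])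
  have "integrable (lebesgue_on \<Omega>) (\<lambda>x. (norm (f (u x)))\<^sup>2)"
  proof (rule Bochner_Integration.integrable_bound)
    show "integrable (lebesgue_on \<Omega>) (\<lambda>x. K\<^sup>2 * (norm (u x))\<^sup>2)"
      using square_integrableD(2)[OF u] by simp
    show "(\<lambda>x. (norm (f (u x)))\<^sup>2) \<in> borel_measurable (lebesgue_on \<Omega>)" using m by measurable
    have "(norm (f (u x)))\<^sup>2 \<le> K\<^sup>2 * (norm (u x))\<^sup>2" for x
      using power_mono[OF K norm_ge_zero, of "u x" 2] by (simp add: power_mult_distrib mult.commute)
    then show "AE x in lebesgue_on \<Omega>. norm ((norm (f (u x)))\<^sup>2) \<le> norm (K\<^sup>2 * (norm (u x))\<^sup>2)"
      by simp
  qed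
  with m show ?thesis by (simp add: square_integrable_def)
qed

lemma square_integrable_fst: "square_integrable \<Omega> U \<Longrightarrow> square_integrable \<Omega> (\<lambda>x. fst (U x))"
  and square_integrable_snd: "square_integrable \<Omega> U \<Longrightarrow> square_integrable \<Omega> (\<lambda>x. snd (U x))"
  by (rule square_integrable_bounded_linear, assumption, rule bounded_linear_fst bounded_linear_snd)+

lemma square_integrable_Pair:
  assumes "square_integrable \<Omega> u" "square_integrable \<Omega> g"
  shows "square_integrable \<Omega> (\<lambda>x. (u x, g x))"
  using square_integrable_add[OF square_integrable_bounded_linear[OF assms(1), of "\<lambda>x. (x, 0)"]
      square_integrable_bounded_linear[OF assms(2), of "\<lambda>x. (0, x)"]]
  by (simp add: bounded_linear_Pair bounded_linear_ident bounded_linear_zero)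

lemma L2_inner_pair:
  assumes "square_integrable \<Omega> U" "square_integrable \<Omega> V"
  shows "L2_inner \<Omega> U V = val_inner \<Omega> U V + grad_inner \<Omega> U V"
  using integrable_L2_inner[OF assms(1)[THEN square_integrable_fst] assms(2)[THEN square_integrable_fst]]
    integrable_L2_inner[OF assms(1)[THEN square_integrable_snd] assms(2)[THEN square_integrable_snd]]
  by (simp add: L2_inner_def val_inner_def grad_inner_def inner_prod_def)

lemma val_semi_inner: "semi_inner (L2 \<Omega>) (val_inner \<Omega>)"
proof (rule semi_inner.intro)
  show "subspace (L2 \<Omega>)" by (rule L2.subspace)
  show "val_inner \<Omega> (x + y) z = val_inner \<Omega> x z + val_inner \<Omega> y z"
    if "x \<in> L2 \<Omega>" "y \<in> L2 \<Omega>" "z \<in> L2 \<Omega>" for x y z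
    using that L2.add_left[of "\<lambda>t. fst (x t)" \<Omega> "\<lambda>t. fst (y t)" "\<lambda>t. fst (z t)"]
    by (simp add: val_inner_def square_integrable_fst plus_fun_def)
  show "val_inner \<Omega> (c *\<^sub>R x) z = c * val_inner \<Omega> x z" for c x z
    by (simp add: val_inner_def L2_inner_def mult.assoc)
  show "val_inner \<Omega> x y = val_inner \<Omega> y x" for x y
    by (simp add: val_inner_def L2_inner_def mult.commute)
  show "0 \<le> val_inner \<Omega> x x" for x
    by (simp add: val_inner_def L2_inner_def)
qed

lemma grad_semi_inner: "semi_inner (L2 \<Omega>) (grad_inner \<Omega>)"
proof (rule semi_inner.intro)
  show "subspace (L2 \<Omega>)" by (rule L2.subspace)
  show "grad_inner \<Omega> (x + y) z = grad_inner \<Omega> x z + grad_inner \<Omega> y z"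
    if "x \<in> L2 \<Omega>" "y \<in> L2 \<Omega>" "z \<in> L2 \<Omega>" for x y z
    using that L2.add_left[of "\<lambda>t. snd (x t)" \<Omega> "\<lambda>t. snd (y t)" "\<lambda>t. snd (z t)"]
    by (simp add: grad_inner_def square_integrable_snd plus_fun_def)
  show "grad_inner \<Omega> (c *\<^sub>R x) z = c * grad_inner \<Omega> x z" for c x z
    by (simp add: grad_inner_def L2_inner_def)
  show "grad_inner \<Omega> x y = grad_inner \<Omega> y x" for x y
    by (simp add: grad_inner_def L2_inner_def inner_commute)
  show "0 \<le> grad_inner \<Omega> x x" for x
    by (simp add: grad_inner_def L2_inner_def)
qed

interpretation val: semi_inner "L2 \<Omega>" "val_inner \<Omega>" for \<Omega>
  by (rule val_semi_inner)

interpretation grd: semi_inner "L2 \<Omega>" "grad_inner \<Omega>" for \<Omega>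
  by (rule grad_semi_inner)

lemma tendsto_L2_inner:
  assumes "\<And>n. square_integrable \<Omega> (V n)" "square_integrable \<Omega> U" "square_integrable \<Omega> F"
    "(\<lambda>n. L2_inner \<Omega> (V n - U) (V n - U)) \<longlonglongrightarrow> 0"
  shows "(\<lambda>n. L2_inner \<Omega> (V n) F) \<longlonglongrightarrow> L2_inner \<Omega> U F"
  using assms by (intro L2.tendsto_inner) auto

lemma square_integrable_diff:
  "square_integrable \<Omega> u \<Longrightarrow> square_integrable \<Omega> v \<Longrightarrow> square_integrable \<Omega> (u - v)"
  using L2.mem(3)[of u \<Omega> v] by simp

lemma tendsto_val_grad:
  assumes V: "\<And>n. square_integrable \<Omega> (V n)" and U: "square_integrable \<Omega> U"
    and lim: "(\<lambda>n. L2_inner \<Omega> (V n - U) (V n - U)) \<longlonglongrightarrow> 0"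
  shows "(\<lambda>n. val_inner \<Omega> (V n - U) (V n - U)) \<longlonglongrightarrow> 0" "(\<lambda>n. grad_inner \<Omega> (V n - U) (V n - U)) \<longlonglongrightarrow> 0"
proof -
  have d: "square_integrable \<Omega> (V n - U)" for n using V U by (rule square_integrable_diff)
  have eq: "L2_inner \<Omega> (V n - U) (V n - U) = val_inner \<Omega> (V n - U) (V n - U) + grad_inner \<Omega> (V n - U) (V n - U)" for n
    by (rule L2_inner_pair[OF d d])
  have nn: "0 \<le> val_inner \<Omega> (V n - U) (V n - U)" "0 \<le> grad_inner \<Omega> (V n - U) (V n - U)" for n
    using d by (simp_all add: val.nonneg grd.nonneg)
  show "(\<lambda>n. val_inner \<Omega> (V n - U) (V n - U)) \<longlonglongrightarrow> 0"
    by (rule tendsto_sandwich[OF always_eventually always_eventually tendsto_const lim]) (simp_all add: nn eq)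
  show "(\<lambda>n. grad_inner \<Omega> (V n - U) (V n - U)) \<longlonglongrightarrow> 0"
    by (rule tendsto_sandwich[OF always_eventually always_eventually tendsto_const lim]) (simp_all add: nn eq)
qed

text \<open>The graph of the weak gradient rather than the set of functions: gradients need not be
  chosen, and the space is a subspace of square integrable maps.\<close>

definition H10 :: "'a::euclidean_space set \<Rightarrow> ('a \<Rightarrow> real \<times> 'a) set" where
  "H10 \<Omega> = {U. H1_0 \<Omega> (\<lambda>x. fst (U x)) (\<lambda>x. snd (U x))}"

lemma H10_L2: "U \<in> H10 \<Omega> \<Longrightarrow> square_integrable \<Omega> U"
  using square_integrable_Pair[of \<Omega> "\<lambda>x. fst (U x)" "\<lambda>x. snd (U x)"] by (simp add: H10_def H1_0_def)

text \<open>Written as orthogonality to fixed square integrable maps, the condition visibly survives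
  limits in the mean square.\<close>

lemma weak_gradient_iff:
  assumes \<Omega>: "open \<Omega>" and U: "square_integrable \<Omega> U"
  shows "weak_gradient \<Omega> (\<lambda>x. fst (U x)) (\<lambda>x. snd (U x)) \<longleftrightarrow>
    (\<forall>\<psi>\<in>test_functions \<Omega>. \<forall>b\<in>Basis. L2_inner \<Omega> U (\<lambda>x. (frechet_derivative \<psi> (at x) b, \<psi> x *\<^sub>R b)) = 0)"
proof -
  have "(LINT x|lebesgue_on \<Omega>. fst (U x) * frechet_derivative \<psi> (at x) b) =
        - (LINT x|lebesgue_on \<Omega>. (snd (U x) \<bullet> b) * \<psi> x) \<longleftrightarrow>
        L2_inner \<Omega> U (\<lambda>x. (frechet_derivative \<psi> (at x) b, \<psi> x *\<^sub>R b)) = 0"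
    if \<psi>: "\<psi> \<in> test_functions \<Omega>" and b: "b \<in> Basis" for \<psi> b
  proof -
    have F: "square_integrable \<Omega> (\<lambda>x. frechet_derivative \<psi> (at x) b)"
      "square_integrable \<Omega> (\<lambda>x. \<psi> x *\<^sub>R b)"
      using square_integrable_test_function[OF \<Omega>] \<psi> test_functions_partial[OF \<psi> b]
        square_integrable_bounded_linear[OF _ bounded_linear_scaleR_left, of \<Omega> \<psi> b] by auto
    show ?thesis
      using L2_inner_pair[OF U square_integrable_Pair[OF F]]
      by (auto simp: val_inner_def grad_inner_def L2_inner_def mult.commute)
  qed
  then show ?thesis by (simp add: weak_gradient_def)
qed

text \<open>The closure of the test pairs: these satisfy the orthogonality relations of
  \<open>weak_gradient_iff\<close> by integration by parts, and the relations pass to the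
  limit.\<close>

lemma H10_iff:
  assumes \<Omega>: "open \<Omega>"
  shows "U \<in> H10 \<Omega> \<longleftrightarrow> square_integrable \<Omega> U \<and>
    (\<exists>\<phi>. (\<forall>n. \<phi> n \<in> test_functions \<Omega>) \<and>
      (\<lambda>n. L2_inner \<Omega> (test_pair (\<phi> n) - U) (test_pair (\<phi> n) - U)) \<longlonglongrightarrow> 0)"
proof -
  have dist: "L2_inner \<Omega> (test_pair \<phi> - U) (test_pair \<phi> - U)
      = (LINT x|lebesgue_on \<Omega>. (\<phi> x - fst (U x))\<^sup>2) + (LINT x|lebesgue_on \<Omega>. (norm (grad \<phi> x - snd (U x)))\<^sup>2)"
    if "\<phi> \<in> test_functions \<Omega>" "square_integrable \<Omega> U" for \<phi>
  proof -
    have d: "square_integrable \<Omega> (test_pair \<phi> - U)"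
      using square_integrable_test_pair[OF \<Omega> that(1)] that(2) by (rule square_integrable_diff)
    show ?thesis
      unfolding L2_inner_pair[OF d d] unfolding val_inner_def grad_inner_def L2_inner_eq_norm
      by (simp add: test_pair_def)
  qed
  show ?thesis
  proof
    assume U: "U \<in> H10 \<Omega>"
    then obtain \<phi> where \<phi>: "\<And>n. \<phi> n \<in> test_functions \<Omega>"
      "(\<lambda>n. (LINT x|lebesgue_on \<Omega>. (\<phi> n x - fst (U x))\<^sup>2)
        + (LINT x|lebesgue_on \<Omega>. (norm (grad (\<phi> n) x - snd (U x)))\<^sup>2)) \<longlonglongrightarrow> 0"
      by (auto simp: H10_def H1_0_def)
    then show "square_integrable \<Omega> U \<and> (\<exists>\<phi>. (\<forall>n. \<phi> n \<in> test_functions \<Omega>) \<and>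
      (\<lambda>n. L2_inner \<Omega> (test_pair (\<phi> n) - U) (test_pair (\<phi> n) - U)) \<longlonglongrightarrow> 0)"
      using H10_L2[OF U] by (intro conjI exI[of _ \<phi>]) (simp_all add: dist)
  next
    assume "square_integrable \<Omega> U \<and> (\<exists>\<phi>. (\<forall>n. \<phi> n \<in> test_functions \<Omega>) \<and>
      (\<lambda>n. L2_inner \<Omega> (test_pair (\<phi> n) - U) (test_pair (\<phi> n) - U)) \<longlonglongrightarrow> 0)"
    then obtain \<phi> where U: "square_integrable \<Omega> U" and \<phi>: "\<And>n. \<phi> n \<in> test_functions \<Omega>"
      and lim: "(\<lambda>n. L2_inner \<Omega> (test_pair (\<phi> n) - U) (test_pair (\<phi> n) - U)) \<longlonglongrightarrow> 0" by blast
    have "weak_gradient \<Omega> (\<lambda>x. fst (U x)) (\<lambda>x. snd (U x))"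
      unfolding weak_gradient_iff[OF \<Omega> U]
    proof (intro ballI)
      fix \<psi> and b :: 'a assume \<psi>: "\<psi> \<in> test_functions \<Omega>" and b: "b \<in> Basis"
      let ?F = "\<lambda>x. (frechet_derivative \<psi> (at x) b, \<psi> x *\<^sub>R b)"
      have F: "square_integrable \<Omega> (\<lambda>x. frechet_derivative \<psi> (at x) b)"
        "square_integrable \<Omega> (\<lambda>x. \<psi> x *\<^sub>R b)"
        using square_integrable_test_function[OF \<Omega>] \<psi> test_functions_partial[OF \<psi> b]
          square_integrable_bounded_linear[OF _ bounded_linear_scaleR_left, of \<Omega> \<psi> b] by auto
      have "L2_inner \<Omega> (test_pair (\<phi> n)) ?F = 0" for n
        using test_function_integration_by_parts[OF \<Omega> \<phi>[of n] \<psi> b] b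
          L2_inner_pair[OF square_integrable_test_pair[OF \<Omega> \<phi>[of n]] square_integrable_Pair[OF F]]
        by (simp add: val_inner_def grad_inner_def L2_inner_def test_pair_def grad_inner mult.commute)
      then show "L2_inner \<Omega> U ?F = 0"
        using tendsto_L2_inner[OF square_integrable_test_pair[OF \<Omega> \<phi>] U square_integrable_Pair[OF F] lim]
        by (simp add: LIMSEQ_const_iff)
    qed
    then show "U \<in> H10 \<Omega>"
      using U \<phi> lim unfolding H10_def H1_0_def
      by (intro CollectI conjI exI[of _ \<phi>]) (simp_all add: dist square_integrable_fst square_integrable_snd)
  qed
qed

lemma H10_test_pair:
  assumes "open \<Omega>" "\<phi> \<in> test_functions \<Omega>"
  shows "test_pair \<phi> \<in> H10 \<Omega>"
  unfolding H10_iff[OF assms(1)]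
  using assms square_integrable_test_pair[OF assms]
  by (intro conjI exI[of _ "\<lambda>n. \<phi>"]) (auto simp: L2_inner_def)

lemma H10_iff_dense:
  assumes \<Omega>: "open \<Omega>"
  shows "U \<in> H10 \<Omega> \<longleftrightarrow> square_integrable \<Omega> U \<and>
    (\<forall>e>0. \<exists>\<phi>\<in>test_functions \<Omega>. L2_inner \<Omega> (test_pair \<phi> - U) (test_pair \<phi> - U) < e)"
proof
  assume "U \<in> H10 \<Omega>"
  then obtain \<phi> where U: "square_integrable \<Omega> U" and \<phi>: "\<And>n. \<phi> n \<in> test_functions \<Omega>"
    "(\<lambda>n. L2_inner \<Omega> (test_pair (\<phi> n) - U) (test_pair (\<phi> n) - U)) \<longlonglongrightarrow> 0"
    unfolding H10_iff[OF \<Omega>] by blast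
  have "\<exists>\<phi>\<in>test_functions \<Omega>. L2_inner \<Omega> (test_pair \<phi> - U) (test_pair \<phi> - U) < e" if e: "e > 0" for e
    using order_tendstoD(2)[OF \<phi>(2) e] \<phi>(1) by (auto simp: eventually_sequentially)
  with U show "square_integrable \<Omega> U \<and>
    (\<forall>e>0. \<exists>\<phi>\<in>test_functions \<Omega>. L2_inner \<Omega> (test_pair \<phi> - U) (test_pair \<phi> - U) < e)" by blast
next
  assume U: "square_integrable \<Omega> U \<and>
    (\<forall>e>0. \<exists>\<phi>\<in>test_functions \<Omega>. L2_inner \<Omega> (test_pair \<phi> - U) (test_pair \<phi> - U) < e)"
  then have "\<exists>\<phi>\<in>test_functions \<Omega>. L2_inner \<Omega> (test_pair \<phi> - U) (test_pair \<phi> - U) < 1 / real (Suc n)" for n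
    by simp
  then obtain \<phi> where \<phi>: "\<And>n. \<phi> n \<in> test_functions \<Omega>"
    "\<And>n. L2_inner \<Omega> (test_pair (\<phi> n) - U) (test_pair (\<phi> n) - U) < 1 / real (Suc n)" by metis
  have "(\<lambda>n. L2_inner \<Omega> (test_pair (\<phi> n) - U) (test_pair (\<phi> n) - U)) \<longlonglongrightarrow> 0"
    by (rule tendsto_sandwich[OF always_eventually always_eventually tendsto_const LIMSEQ_Suc[OF lim_1_over_n]])
      (use \<phi>(2) in \<open>auto simp: L2_inner_eq_norm intro: less_imp_le\<close>)
  then show "U \<in> H10 \<Omega>" unfolding H10_iff[OF \<Omega>] using U \<phi>(1) by blast
qed

lemma H10_closed:
  assumes \<Omega>: "open \<Omega>" and U: "square_integrable \<Omega> U"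
    and V: "\<And>e. e > 0 \<Longrightarrow> \<exists>V\<in>H10 \<Omega>. L2_inner \<Omega> (V - U) (V - U) < e"
  shows "U \<in> H10 \<Omega>"
  unfolding H10_iff_dense[OF \<Omega>]
proof (intro conjI U allI impI)
  fix e :: real assume e: "e > 0"
  obtain V where V: "V \<in> H10 \<Omega>" "L2_inner \<Omega> (V - U) (V - U) < e / 4" using V[of "e / 4"] e by auto
  obtain \<phi> where \<phi>: "\<phi> \<in> test_functions \<Omega>" "L2_inner \<Omega> (test_pair \<phi> - V) (test_pair \<phi> - V) < e / 4"
    using V(1) e unfolding H10_iff_dense[OF \<Omega>] by (metis zero_less_divide_iff zero_less_numeral)
  have "L2_inner \<Omega> ((test_pair \<phi> - V) + (V - U)) ((test_pair \<phi> - V) + (V - U))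
      \<le> 2 * L2_inner \<Omega> (test_pair \<phi> - V) (test_pair \<phi> - V) + 2 * L2_inner \<Omega> (V - U) (V - U)"
    using square_integrable_test_pair[OF \<Omega> \<phi>(1)] H10_L2[OF V(1)] U
    by (intro L2.square_add_le) (auto intro: square_integrable_diff)
  then have "L2_inner \<Omega> (test_pair \<phi> - U) (test_pair \<phi> - U) < e" using V(2) \<phi>(2) by simp
  with \<phi>(1) show "\<exists>\<phi>\<in>test_functions \<Omega>. L2_inner \<Omega> (test_pair \<phi> - U) (test_pair \<phi> - U) < e" by blast
qed

lemma test_pair_add:
  assumes "\<phi> \<in> test_functions \<Omega>" "\<psi> \<in> test_functions \<Omega>"
  shows "test_pair (\<lambda>x. \<phi> x + \<psi> x) = test_pair \<phi> + test_pair \<psi>"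
  using assms[THEN test_functionsD(5)]
  by (auto simp: fun_eq_iff test_pair_def grad_def frechet_derivative_add scaleR_add_left sum.distrib)

lemma test_pair_mult:
  assumes "\<phi> \<in> test_functions \<Omega>" "f differentiable (at x)"
  shows "test_pair (\<lambda>x. f x * \<phi> x) x = f x *\<^sub>R test_pair \<phi> x + (0, \<phi> x *\<^sub>R grad f x)"
  using test_functionsD(5)[OF assms(1)] assms(2)
  by (auto simp: test_pair_def grad_def frechet_derivative_mult scaleR_add_left sum.distrib scaleR_sum_right
      algebra_simps)

lemma H10_subspace:
  assumes \<Omega>: "open \<Omega>"
  shows "subspace (H10 \<Omega>)"
proof (rule subspaceI)
  have "test_pair (\<lambda>x. 0) = (0 :: 'a \<Rightarrow> real \<times> 'a)"
    by (auto simp: fun_eq_iff test_pair_def grad_def zero_prod_def)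
  then show "0 \<in> H10 \<Omega>" using H10_test_pair[OF \<Omega> test_functions_zero] by simp
next
  fix U V assume UV: "U \<in> H10 \<Omega>" "V \<in> H10 \<Omega>"
  note [simp] = UV[THEN H10_L2]
  show "U + V \<in> H10 \<Omega>"
    unfolding H10_iff_dense[OF \<Omega>]
  proof (intro conjI allI impI)
    show "square_integrable \<Omega> (U + V)" using L2.mem(2)[of U \<Omega> V] by simp
    fix e :: real assume e: "e > 0"
    then have e4: "e / 4 > 0" by simp
    obtain \<phi> where \<phi>: "\<phi> \<in> test_functions \<Omega>" "L2_inner \<Omega> (test_pair \<phi> - U) (test_pair \<phi> - U) < e / 4"
      using UV(1) e4 unfolding H10_iff_dense[OF \<Omega>] by blast
    obtain \<psi> where \<psi>: "\<psi> \<in> test_functions \<Omega>" "L2_inner \<Omega> (test_pair \<psi> - V) (test_pair \<psi> - V) < e / 4"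
      using UV(2) e4 unfolding H10_iff_dense[OF \<Omega>] by blast
    have eq: "test_pair (\<lambda>x. \<phi> x + \<psi> x) - (U + V) = (test_pair \<phi> - U) + (test_pair \<psi> - V)"
      by (simp add: test_pair_add[OF \<phi>(1) \<psi>(1)])
    have "L2_inner \<Omega> ((test_pair \<phi> - U) + (test_pair \<psi> - V)) ((test_pair \<phi> - U) + (test_pair \<psi> - V))
        \<le> 2 * L2_inner \<Omega> (test_pair \<phi> - U) (test_pair \<phi> - U) + 2 * L2_inner \<Omega> (test_pair \<psi> - V) (test_pair \<psi> - V)"
      using square_integrable_test_pair[OF \<Omega>] \<phi>(1) \<psi>(1)
      by (intro L2.square_add_le) (auto intro: square_integrable_diff)
    then have "L2_inner \<Omega> (test_pair (\<lambda>x. \<phi> x + \<psi> x) - (U + V)) (test_pair (\<lambda>x. \<phi> x + \<psi> x) - (U + V)) < e"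
      unfolding eq using \<phi>(2) \<psi>(2) by simp
    with test_functions_add[OF \<phi>(1) \<psi>(1)]
    show "\<exists>\<phi>\<in>test_functions \<Omega>. L2_inner \<Omega> (test_pair \<phi> - (U + V)) (test_pair \<phi> - (U + V)) < e" by blast
  qed
next
  fix c :: real and U assume U: "U \<in> H10 \<Omega>"
  note [simp] = U[THEN H10_L2]
  show "c *\<^sub>R U \<in> H10 \<Omega>"
    unfolding H10_iff_dense[OF \<Omega>]
  proof (intro conjI allI impI)
    show "square_integrable \<Omega> (c *\<^sub>R U)" using L2.mem(4)[of U \<Omega> c] by simp
    fix e :: real assume e: "e > 0"
    \<comment> \<open>Adding 1 treats \<open>c = 0\<close> together with the other scalars.\<close>
    have c: "c\<^sup>2 + 1 > 0" by (simp add: add_nonneg_pos)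
    then have pos: "e / (c\<^sup>2 + 1) > 0" using e by simp
    then obtain \<phi> where \<phi>: "\<phi> \<in> test_functions \<Omega>"
      "L2_inner \<Omega> (test_pair \<phi> - U) (test_pair \<phi> - U) < e / (c\<^sup>2 + 1)"
      using U unfolding H10_iff_dense[OF \<Omega>] by blast
    have t: "test_pair (\<lambda>x. c * \<phi> x) = c *\<^sub>R test_pair \<phi>"
      using test_pair_mult[OF \<phi>(1), of "\<lambda>x. c"] by (auto simp: fun_eq_iff grad_def zero_prod_def[symmetric])
    have "L2_inner \<Omega> (c *\<^sub>R (test_pair \<phi> - U)) (c *\<^sub>R (test_pair \<phi> - U))
        = c\<^sup>2 * L2_inner \<Omega> (test_pair \<phi> - U) (test_pair \<phi> - U)"
      using square_integrable_test_pair[OF \<Omega> \<phi>(1)]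
      by (intro L2.square_scale) (auto intro: square_integrable_diff)
    also have "\<dots> \<le> c\<^sup>2 * (e / (c\<^sup>2 + 1))" using \<phi>(2) by (intro mult_left_mono) auto
    also have "\<dots> < (c\<^sup>2 + 1) * (e / (c\<^sup>2 + 1))" using pos by (intro mult_strict_right_mono) auto
    also have "\<dots> = e" using c by simp
    finally have "L2_inner \<Omega> (test_pair (\<lambda>x. c * \<phi> x) - c *\<^sub>R U) (test_pair (\<lambda>x. c * \<phi> x) - c *\<^sub>R U) < e"
      by (simp add: t scaleR_diff_right)
    with test_functions_smooth_mult[OF \<phi>(1) C_k_const]
    show "\<exists>\<phi>\<in>test_functions \<Omega>. L2_inner \<Omega> (test_pair \<phi> - c *\<^sub>R U) (test_pair \<phi> - c *\<^sub>R U) < e" by blast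
  qed
qed

text \<open>The density argument in reusable form: identities known for test functions extend to the
  whole space once they are written as one inner product with a fixed \<open>F\<close>.\<close>

lemma H10_orthogonal:
  assumes \<Omega>: "open \<Omega>" and F: "square_integrable \<Omega> F"
    and test: "\<And>\<phi>. \<phi> \<in> test_functions \<Omega> \<Longrightarrow> L2_inner \<Omega> (test_pair \<phi>) F = 0"
    and U: "U \<in> H10 \<Omega>"
  shows "L2_inner \<Omega> U F = 0"
proof -
  obtain \<phi> where \<phi>: "\<And>n. \<phi> n \<in> test_functions \<Omega>"
    "(\<lambda>n. L2_inner \<Omega> (test_pair (\<phi> n) - U) (test_pair (\<phi> n) - U)) \<longlonglongrightarrow> 0"
    using U unfolding H10_iff[OF \<Omega>] by blast
  show ?thesis
    using tendsto_L2_inner[OF square_integrable_test_pair[OF \<Omega> \<phi>(1)] H10_L2[OF U] F \<phi>(2)]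
    by (simp add: test[OF \<phi>(1)] LIMSEQ_const_iff)
qed

text \<open>The functional of \<open>poincare_finite_functionals\<close> for the cell \<open>Q\<close> is the inner product with this
  function, which vanishes if \<open>Q\<close> is a null set since \<open>x / 0 = 0\<close>.\<close>

definition cell_function :: "'a::euclidean_space set \<Rightarrow> 'a \<Rightarrow> real \<times> 'a" where
  "cell_function Q x = (indicator Q x / sqrt (measure lborel Q), 0)"

lemma square_integrable_cell_function:
  assumes "open \<Omega>" "bounded \<Omega>" "Q \<in> sets borel"
  shows "square_integrable \<Omega> (cell_function Q)"
proof -
  have fin: "finite_measure (lebesgue_on \<Omega>)"
    using assms(1,2) by (intro finite_measure_lebesgue_on lmeasurable_open)
  have m: "(\<lambda>x. indicator Q x / sqrt (measure lborel Q) :: real) \<in> borel_measurable (lebesgue_on \<Omega>)"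
    using assms(3) by (intro measurable_restrict_space1 measurable_completion) auto
  have "square_integrable \<Omega> (\<lambda>x. indicator Q x / sqrt (measure lborel Q) :: real)"
    unfolding square_integrable_def
  proof (intro conjI m finite_measure.integrable_const_bound[OF fin])
    show "AE x in lebesgue_on \<Omega>. norm ((norm (indicator Q x / sqrt (measure lborel Q) :: real))\<^sup>2)
        \<le> (1 / sqrt (measure lborel Q))\<^sup>2"
      by (rule always_eventually) (auto simp: indicator_def)
    show "(\<lambda>x. (norm (indicator Q x / sqrt (measure lborel Q) :: real))\<^sup>2) \<in> borel_measurable (lebesgue_on \<Omega>)"
      using m by measurable
  qed
  moreover have "square_integrable \<Omega> (\<lambda>x. 0 :: 'a)" by (simp add: square_integrable_def)
  ultimately show ?thesis unfolding cell_function_def[abs_def] by (rule square_integrable_Pair)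
qed

text \<open>Completeness is \<open>L2_complete\<close> together with closedness of
  \<open>H10\<close>. The compactness axiom is the Poincare inequality over a division, stated
  through inner products with the cell functions so that every term is continuous and the inequality
  passes from test pairs to limits.\<close>

theorem H10_form_pair:
  fixes \<Omega> :: "'a::euclidean_space set"
  assumes \<Omega>: "open \<Omega>" and bd: "bounded \<Omega>"
  shows "form_pair (H10 \<Omega>) (val_inner \<Omega>) (grad_inner \<Omega>)"
proof -
  have sub: "H10 \<Omega> \<subseteq> L2 \<Omega>" using H10_L2 by blast
  note X = H10_subspace[OF \<Omega>]
  interpret s: semi_inner "H10 \<Omega>" "val_inner \<Omega>" by (rule val.restrict[OF sub X])
  interpret a: semi_inner "H10 \<Omega>" "grad_inner \<Omega>" by (rule grd.restrict[OF sub X])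
  show ?thesis
  proof
    fix v assume v: "\<And>n::nat. v n \<in> H10 \<Omega>"
      and Cauchy: "\<And>e. e > 0 \<Longrightarrow> \<exists>N. \<forall>m\<ge>N. \<forall>n\<ge>N.
        val_inner \<Omega> (v m - v n) (v m - v n) + grad_inner \<Omega> (v m - v n) (v m - v n) < e"
    have eq: "val_inner \<Omega> (u - w) (u - w) + grad_inner \<Omega> (u - w) (u - w) = L2_inner \<Omega> (u - w) (u - w)"
      if "square_integrable \<Omega> u" "square_integrable \<Omega> w" for u w
      using L2_inner_pair[OF square_integrable_diff[OF that] square_integrable_diff[OF that]] by simp
    have vL: "\<And>n. square_integrable \<Omega> (v n)" using v by (rule H10_L2)
    have "\<exists>N. \<forall>m\<ge>N. \<forall>n\<ge>N. L2_inner \<Omega> (v m - v n) (v m - v n) < e" if "e > 0" for e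
      using Cauchy[OF that] by (simp add: eq[OF vL vL])
    then obtain w where w: "square_integrable \<Omega> w" "(\<lambda>n. L2_inner \<Omega> (v n - w) (v n - w)) \<longlonglongrightarrow> 0"
      using L2_complete[of \<Omega> v] vL by blast
    have "w \<in> H10 \<Omega>"
    proof (rule H10_closed[OF \<Omega> w(1)])
      fix e :: real assume "e > 0"
      from order_tendstoD(2)[OF w(2) this] obtain N where "L2_inner \<Omega> (v N - w) (v N - w) < e"
        by (auto simp: eventually_sequentially)
      then show "\<exists>V\<in>H10 \<Omega>. L2_inner \<Omega> (V - w) (V - w) < e" using v by blast
    qed
    then show "\<exists>w\<in>H10 \<Omega>. (\<lambda>n. val_inner \<Omega> (v n - w) (v n - w) + grad_inner \<Omega> (v n - w) (v n - w)) \<longlonglongrightarrow> 0"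
      using w(2) by (intro bexI[of _ w]) (simp_all add: eq[OF vL w(1)])
  next
    fix e :: real assume e: "e > 0"
    obtain D where D: "finite D" "\<And>Q. Q \<in> D \<Longrightarrow> \<exists>a b. Q = cbox a b"
      and P: "\<And>\<phi>. \<phi> \<in> test_functions \<Omega> \<Longrightarrow>
        (LINT x|lborel. (\<phi> x)\<^sup>2) \<le> (\<Sum>Q\<in>D. (LINT x|lborel. \<phi> x * indicator Q x)\<^sup>2 / measure lborel Q)
          + e * (LINT x|lborel. (norm (grad \<phi> x))\<^sup>2)"
      using poincare_finite_functionals[OF bd e] by blast
    have Qb: "Q \<in> sets borel" if "Q \<in> D" for Q using D(2)[OF that] by auto
    note k = square_integrable_cell_function[OF \<Omega> bd Qb]
    have test: "val_inner \<Omega> (test_pair \<phi>) (test_pair \<phi>)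
        \<le> (\<Sum>Q\<in>D. (val_inner \<Omega> (test_pair \<phi>) (cell_function Q))\<^sup>2)
          + e * grad_inner \<Omega> (test_pair \<phi>) (test_pair \<phi>)" if \<phi>: "\<phi> \<in> test_functions \<Omega>" for \<phi>
    proof -
      note int = integrable_test_function_squares[OF \<phi>]
      have out: "\<phi> x = 0" "grad \<phi> x = 0" if "x \<notin> \<Omega>" for x
      proof -
        have x: "x \<notin> closure {x. \<phi> x \<noteq> 0}" using that test_functionsD(3)[OF \<phi>] by blast
        show "\<phi> x = 0" "grad \<phi> x = 0"
          using not_in_support[OF x] frechet_derivative_support[OF x] by (simp_all add: grad_def)
      qed
      have m: "f \<in> borel_measurable borel" if "integrable lborel f" for f :: "'a \<Rightarrow> real"
        using borel_measurable_integrable[OF that] by simp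
      have v: "val_inner \<Omega> (test_pair \<phi>) (test_pair \<phi>) = (LINT x|lborel. (\<phi> x)\<^sup>2)"
        unfolding val_inner_def L2_inner_eq_norm
        using LINT_lebesgue_on_eq_lborel[OF \<Omega> m[OF int(2)]] out by (simp add: test_pair_def)
      have g: "grad_inner \<Omega> (test_pair \<phi>) (test_pair \<phi>) = (LINT x|lborel. (norm (grad \<phi> x))\<^sup>2)"
        unfolding grad_inner_def L2_inner_eq_norm
        using LINT_lebesgue_on_eq_lborel[OF \<Omega> m[OF int(3)]] out by (simp add: test_pair_def)
      have c: "(val_inner \<Omega> (test_pair \<phi>) (cell_function Q))\<^sup>2
          = (LINT x|lborel. \<phi> x * indicator Q x)\<^sup>2 / measure lborel Q" if "Q \<in> D" for Q
      proof -
        have "val_inner \<Omega> (test_pair \<phi>) (cell_function Q)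
            = (LINT x|lebesgue_on \<Omega>. \<phi> x * indicator Q x / sqrt (measure lborel Q))"
          by (simp add: val_inner_def L2_inner_def test_pair_def cell_function_def)
        also have "\<dots> = (LINT x|lebesgue_on \<Omega>. \<phi> x * indicator Q x) / sqrt (measure lborel Q)"
          by simp
        also have "(LINT x|lebesgue_on \<Omega>. \<phi> x * indicator Q x) = (LINT x|lborel. \<phi> x * indicator Q x)"
          by (rule LINT_lebesgue_on_eq_lborel[OF \<Omega> m[OF integrable_times_indicator[OF int(1) Qb[OF that]]]])
            (simp add: out)
        finally show ?thesis by (simp add: power_divide)
      qed
      show ?thesis using P[OF \<phi>] by (simp add: v g c)
    qed
    have ineq: "val_inner \<Omega> U U \<le> (\<Sum>Q\<in>D. (val_inner \<Omega> U (cell_function Q))\<^sup>2) + e * grad_inner \<Omega> U U"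
      if U: "U \<in> H10 \<Omega>" for U
    proof -
      obtain \<phi> where \<phi>: "\<And>n. \<phi> n \<in> test_functions \<Omega>"
        "(\<lambda>n. L2_inner \<Omega> (test_pair (\<phi> n) - U) (test_pair (\<phi> n) - U)) \<longlonglongrightarrow> 0"
        using U unfolding H10_iff[OF \<Omega>] by blast
      note t = square_integrable_test_pair[OF \<Omega> \<phi>(1)] and UL = H10_L2[OF U]
      note lims = tendsto_val_grad[OF t UL \<phi>(2)]
      have 1: "(\<lambda>n. val_inner \<Omega> (test_pair (\<phi> n)) (test_pair (\<phi> n))) \<longlonglongrightarrow> val_inner \<Omega> U U"
        using t UL lims by (intro val.tendsto_square) auto
      have 2: "(\<lambda>n. grad_inner \<Omega> (test_pair (\<phi> n)) (test_pair (\<phi> n))) \<longlonglongrightarrow> grad_inner \<Omega> U U"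
        using t UL lims by (intro grd.tendsto_square) auto
      have 3: "(\<lambda>n. val_inner \<Omega> (test_pair (\<phi> n)) (cell_function Q)) \<longlonglongrightarrow> val_inner \<Omega> U (cell_function Q)"
        if "Q \<in> D" for Q
        using t UL lims k[OF that] by (intro val.tendsto_inner) auto
      show ?thesis
        by (rule LIMSEQ_le[OF 1 tendsto_add[OF tendsto_sum[OF tendsto_power[OF 3]] tendsto_mult_left[OF 2]]])
          (use test[OF \<phi>(1)] in auto)
    qed
    obtain q where q: "bij_betw q {..<card D} D"
      using ex_bij_betw_nat_finite[OF D(1)] by (auto simp: atLeast0LessThan)
    define L where "L i U = val_inner \<Omega> U (cell_function (q i))" for i U
    have qD: "q i \<in> D" if "i < card D" for i using q that by (auto simp: bij_betw_def)
    \<comment> \<open>A common bound for all functionals: each norm is one nonnegative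
      summand.\<close>
    define C where "C = (\<Sum>Q\<in>D. sqrt (val_inner \<Omega> (cell_function Q) (cell_function Q)))"
    show "\<exists>(N::nat) L C.
      (\<forall>i<N. \<forall>x\<in>H10 \<Omega>. \<forall>y\<in>H10 \<Omega>. L i (x - y) = L i x - L i y) \<and>
      (\<forall>i<N. \<forall>x\<in>H10 \<Omega>. \<bar>L i x\<bar> \<le> C * sqrt (val_inner \<Omega> x x)) \<and>
      (\<forall>x\<in>H10 \<Omega>. val_inner \<Omega> x x \<le> (\<Sum>i<N. (L i x)\<^sup>2) + e * grad_inner \<Omega> x x)"
    proof (intro exI[of _ "card D"] exI[of _ L] exI[of _ C] conjI allI impI ballI)
      show "L i (x - y) = L i x - L i y" if "i < card D" "x \<in> H10 \<Omega>" "y \<in> H10 \<Omega>" for i x y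
        unfolding L_def using that k[OF qD[OF that(1)]] by (intro val.diff_left) (auto intro: H10_L2)
      show "\<bar>L i x\<bar> \<le> C * sqrt (val_inner \<Omega> x x)" if i: "i < card D" and x: "x \<in> H10 \<Omega>" for i x
      proof -
        let ?k = "cell_function (q i)"
        have "(L i x)\<^sup>2 \<le> val_inner \<Omega> x x * val_inner \<Omega> ?k ?k"
          unfolding L_def using x k[OF qD[OF i]] by (intro val.Cauchy_Schwarz) (auto intro: H10_L2)
        then have "\<bar>L i x\<bar> \<le> sqrt (val_inner \<Omega> ?k ?k) * sqrt (val_inner \<Omega> x x)"
          by (metis mult.commute real_sqrt_abs real_sqrt_le_iff real_sqrt_mult)
        also have "\<dots> \<le> C * sqrt (val_inner \<Omega> x x)"
          unfolding C_def using D(1) qD[OF i] k x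
          by (intro mult_right_mono member_le_sum[of "q i" D "\<lambda>Q. sqrt (val_inner \<Omega> (cell_function Q) (cell_function Q))"])
            (simp_all add: val.nonneg s.nonneg)
        finally show ?thesis .
      qed
      show "val_inner \<Omega> x x \<le> (\<Sum>i<card D. (L i x)\<^sup>2) + e * grad_inner \<Omega> x x" if "x \<in> H10 \<Omega>" for x
        using ineq[OF that] sum.reindex_bij_betw[OF q, of "\<lambda>Q. (val_inner \<Omega> x (cell_function Q))\<^sup>2"]
        by (simp add: L_def)
    qed
  qed
qed

text \<open>The definition of the weak gradient covers test functions in the second argument;
  density replaces them by arbitrary \<open>W\<close>, with \<open>V\<close> packed into the fixed
  map \<open>?F\<close>.\<close>

lemma H10_integration_by_parts:
  assumes \<Omega>: "open \<Omega>" and V: "V \<in> H10 \<Omega>" and W: "W \<in> H10 \<Omega>" and b: "b \<in> Basis"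
  shows "L2_inner \<Omega> (\<lambda>x. fst (V x)) (\<lambda>x. snd (W x) \<bullet> b) + L2_inner \<Omega> (\<lambda>x. snd (V x) \<bullet> b) (\<lambda>x. fst (W x)) = 0"
proof -
  let ?F = "\<lambda>x. (snd (V x) \<bullet> b, fst (V x) *\<^sub>R b)"
  note VL = H10_L2[OF V] and WL = H10_L2[OF W]
  have F: "square_integrable \<Omega> (\<lambda>x. snd (V x) \<bullet> b)" "square_integrable \<Omega> (\<lambda>x. fst (V x) *\<^sub>R b)"
    using square_integrable_bounded_linear[OF square_integrable_snd[OF VL] bounded_linear_inner_left]
      square_integrable_bounded_linear[OF square_integrable_fst[OF VL] bounded_linear_scaleR_left] by auto
  have Fp: "square_integrable \<Omega> ?F" using F by (rule square_integrable_Pair)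
  have eq: "L2_inner \<Omega> U ?F = L2_inner \<Omega> (\<lambda>x. fst (V x)) (\<lambda>x. snd (U x) \<bullet> b)
      + L2_inner \<Omega> (\<lambda>x. snd (V x) \<bullet> b) (\<lambda>x. fst (U x))" if "square_integrable \<Omega> U" for U
    using L2_inner_pair[OF that Fp]
    by (simp add: val_inner_def grad_inner_def L2_inner_def mult.commute)
  have "L2_inner \<Omega> (test_pair \<phi>) ?F = 0" if \<phi>: "\<phi> \<in> test_functions \<Omega>" for \<phi>
  proof -
    have "(LINT x|lebesgue_on \<Omega>. fst (V x) * frechet_derivative \<phi> (at x) b)
        = - (LINT x|lebesgue_on \<Omega>. (snd (V x) \<bullet> b) * \<phi> x)"
      using V \<phi> b by (auto simp: H10_def H1_0_def weak_gradient_def)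
    then show ?thesis
      unfolding eq[OF square_integrable_test_pair[OF \<Omega> \<phi>]] using b
      by (simp add: L2_inner_def test_pair_def grad_inner)
  qed
  from H10_orthogonal[OF \<Omega> Fp this W] show ?thesis by (simp add: eq[OF WL])
qed

text \<open>Multiplication of the function by the coordinate x_b; the gradient component follows the
  product rule.\<close>

definition coord_mult :: "'a::euclidean_space \<Rightarrow> ('a \<Rightarrow> real \<times> 'a) \<Rightarrow> 'a \<Rightarrow> real \<times> 'a" where
  "coord_mult b U x = (x \<bullet> b) *\<^sub>R U x + (0, fst (U x) *\<^sub>R b)"

text \<open>Since \<open>\<Omega>\<close> is bounded, the operation is bounded in the mean square.
  It maps test pairs to test pairs, hence preserves their closure.\<close>

lemma H10_coord_mult:
  assumes \<Omega>: "open \<Omega>" and bd: "bounded \<Omega>" and b: "b \<in> Basis" and U: "U \<in> H10 \<Omega>"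
  shows "coord_mult b U \<in> H10 \<Omega>"
proof -
  obtain R where R: "R > 0" "\<And>x. x \<in> \<Omega> \<Longrightarrow> norm x \<le> R" using bd by (auto simp: bounded_pos)
  have pt: "(norm (coord_mult b V x))\<^sup>2 \<le> (R + 1)\<^sup>2 * (norm (V x))\<^sup>2" if x: "x \<in> \<Omega>" for V x
  proof -
    have "norm (coord_mult b V x) \<le> \<bar>x \<bullet> b\<bar> * norm (V x) + \<bar>fst (V x)\<bar>"
      unfolding coord_mult_def using norm_triangle_ineq[of "(x \<bullet> b) *\<^sub>R V x" "(0, fst (V x) *\<^sub>R b)"] b
      by (simp add: norm_Pair)
    also have "\<dots> \<le> R * norm (V x) + norm (V x)"
    proof (intro add_mono mult_right_mono)
      show "\<bar>x \<bullet> b\<bar> \<le> R" using Basis_le_norm[OF b, of x] R(2)[OF x] by simp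
      show "\<bar>fst (V x)\<bar> \<le> norm (V x)" using norm_fst_le[of "fst (V x)" "snd (V x)"] by simp
    qed simp
    finally have "norm (coord_mult b V x) \<le> (R + 1) * norm (V x)" by (simp add: algebra_simps)
    from power_mono[OF this, of 2] show ?thesis by (simp add: power_mult_distrib)
  qed
  have id: "(\<lambda>x. x) \<in> borel_measurable (lebesgue_on \<Omega>)"
    by (intro measurable_restrict_space1 measurable_completion) simp
  have L: "square_integrable \<Omega> (coord_mult b V)"
    "L2_inner \<Omega> (coord_mult b V) (coord_mult b V) \<le> (R + 1)\<^sup>2 * L2_inner \<Omega> V V"
    if V: "square_integrable \<Omega> V" for V
  proof -
    note [measurable] = square_integrableD(1)[OF V] id
    have fV: "(\<lambda>x. fst (V x)) \<in> borel_measurable (lebesgue_on \<Omega>)"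
      by (rule square_integrableD(1)[OF square_integrable_fst[OF V]])
    have "(\<lambda>x. (0 :: real, fst (V x) *\<^sub>R b)) \<in> borel_measurable (lebesgue_on \<Omega>)"
      using fV by (intro borel_measurable_Pair borel_measurable_scaleR) auto
    then have m: "coord_mult b V \<in> borel_measurable (lebesgue_on \<Omega>)"
      unfolding coord_mult_def[abs_def] by (intro borel_measurable_add borel_measurable_scaleR) simp_all
    have int: "integrable (lebesgue_on \<Omega>) (\<lambda>x. (norm (coord_mult b V x))\<^sup>2)"
    proof (rule Bochner_Integration.integrable_bound)
      show "integrable (lebesgue_on \<Omega>) (\<lambda>x. (R + 1)\<^sup>2 * (norm (V x))\<^sup>2)"
        using square_integrableD(2)[OF V] by simp
      show "(\<lambda>x. (norm (coord_mult b V x))\<^sup>2) \<in> borel_measurable (lebesgue_on \<Omega>)" using m by measurable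
      show "AE x in lebesgue_on \<Omega>. norm ((norm (coord_mult b V x))\<^sup>2) \<le> norm ((R + 1)\<^sup>2 * (norm (V x))\<^sup>2)"
        by (rule AE_I2) (use pt in \<open>simp add: space_restrict_space\<close>)
    qed
    with m show "square_integrable \<Omega> (coord_mult b V)" by (simp add: square_integrable_def)
    have "(LINT x|lebesgue_on \<Omega>. (norm (coord_mult b V x))\<^sup>2)
        \<le> (LINT x|lebesgue_on \<Omega>. (R + 1)\<^sup>2 * (norm (V x))\<^sup>2)"
      using square_integrableD(2)[OF V]
      by (intro integral_mono int) (use pt in \<open>simp_all add: space_restrict_space\<close>)
    then show "L2_inner \<Omega> (coord_mult b V) (coord_mult b V) \<le> (R + 1)\<^sup>2 * L2_inner \<Omega> V V"
      by (simp add: L2_inner_eq_norm)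
  qed
  have lin: "coord_mult b V - coord_mult b V' = coord_mult b (V - V')" for V V'
    by (simp add: fun_eq_iff coord_mult_def algebra_simps)
  have grad_coord: "grad (\<lambda>x. x \<bullet> b) x = b" for x
    by (rule euclidean_eqI) (simp add: grad_inner frechet_derivative_inner_left inner_commute[of b])
  have tp: "coord_mult b (test_pair \<phi>) = test_pair (\<lambda>x. (x \<bullet> b) * \<phi> x)" if "\<phi> \<in> test_functions \<Omega>" for \<phi>
  proof
    fix x
    have "(\<lambda>x. x \<bullet> b) differentiable (at x)" by (intro differentiableI) (auto intro!: derivative_eq_intros)
    from test_pair_mult[OF that this] show "coord_mult b (test_pair \<phi>) x = test_pair (\<lambda>x. (x \<bullet> b) * \<phi> x) x"
      by (simp add: coord_mult_def grad_coord) (simp add: test_pair_def)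
  qed
  show ?thesis
  proof (rule H10_closed[OF \<Omega> L(1)[OF H10_L2[OF U]]])
    fix e :: real assume e: "e > 0"
    then have "e / (R + 1)\<^sup>2 > 0" using R by simp
    then obtain \<phi> where \<phi>: "\<phi> \<in> test_functions \<Omega>"
      "L2_inner \<Omega> (test_pair \<phi> - U) (test_pair \<phi> - U) < e / (R + 1)\<^sup>2"
      using U unfolding H10_iff_dense[OF \<Omega>] by blast
    have "L2_inner \<Omega> (coord_mult b (test_pair \<phi>) - coord_mult b U) (coord_mult b (test_pair \<phi>) - coord_mult b U)
        \<le> (R + 1)\<^sup>2 * L2_inner \<Omega> (test_pair \<phi> - U) (test_pair \<phi> - U)"
      unfolding lin using square_integrable_test_pair[OF \<Omega> \<phi>(1)] H10_L2[OF U]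
      by (intro L(2) square_integrable_diff)
    also have "\<dots> < e" using \<phi>(2) R by (simp add: field_simps)
    finally show "\<exists>V\<in>H10 \<Omega>. L2_inner \<Omega> (V - coord_mult b U) (V - coord_mult b U) < e"
      unfolding tp[OF \<phi>(1)]
      using H10_test_pair[OF \<Omega> test_functions_smooth_mult[OF \<phi>(1) C_k_inner]] by blast
  qed
qed

section \<open>The Dirichlet Laplacian\<close>

context
  fixes \<Omega> :: "'a::euclidean_space set"
  assumes \<Omega>: "open \<Omega>" and bd: "bounded \<Omega>"
begin

interpretation H: form_pair "H10 \<Omega>" "val_inner \<Omega>" "grad_inner \<Omega>"
  by (rule H10_form_pair[OF \<Omega> bd])

text \<open>Links the definition, tested against test functions, to the abstract eigenspace, tested
  against all of \<open>H10\<close>; density bridges the gap.\<close>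

lemma dirichlet_eigenspace_iff:
  "u \<in> dirichlet_eigenspace \<Omega> \<mu> \<longleftrightarrow> (\<exists>g. (\<lambda>x. (u x, g x)) \<in> H.eigenspace \<mu>)"
proof
  assume "u \<in> dirichlet_eigenspace \<Omega> \<mu>"
  then obtain g where g: "H1_0 \<Omega> u g" and sq: "square_integrable \<Omega> (\<lambda>x. \<mu> * u x)"
    and weak: "\<And>\<phi>. \<phi> \<in> test_functions \<Omega> \<Longrightarrow>
      (LINT x|lebesgue_on \<Omega>. g x \<bullet> grad \<phi> x) = (LINT x|lebesgue_on \<Omega>. (\<mu> * u x) * \<phi> x)"
    by (auto simp: dirichlet_eigenspace_def dirichlet_laplacian_def)
  define U where "U x = (u x, g x)" for x
  \<comment> \<open>The inner product with this map is energy minus \<open>\<mu>\<close> times value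
    form, so that \<open>H10_orthogonal\<close> applies.\<close>
  define F where "F x = (- (\<mu> * u x), g x)" for x
  have U: "U \<in> H10 \<Omega>" using g by (simp add: H10_def U_def)
  have F: "square_integrable \<Omega> F"
    unfolding F_def using square_integrable_scale[OF sq, of "-1"] g
    by (intro square_integrable_Pair) (auto simp: H1_0_def)
  have eq: "L2_inner \<Omega> W F = grad_inner \<Omega> U W - \<mu> * val_inner \<Omega> U W" if "square_integrable \<Omega> W" for W
    unfolding L2_inner_pair[OF that F]
    by (simp add: val_inner_def grad_inner_def L2_inner_def F_def U_def inner_commute mult_ac)
  have "L2_inner \<Omega> (test_pair \<phi>) F = 0" if \<phi>: "\<phi> \<in> test_functions \<Omega>" for \<phi>
    unfolding eq[OF square_integrable_test_pair[OF \<Omega> \<phi>]] using weak[OF \<phi>]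
    by (simp add: grad_inner_def val_inner_def L2_inner_def U_def test_pair_def mult.assoc)
  then have "L2_inner \<Omega> W F = 0" if "W \<in> H10 \<Omega>" for W
    using that by (rule H10_orthogonal[OF \<Omega> F])
  then have "grad_inner \<Omega> U W = \<mu> * val_inner \<Omega> U W" if "W \<in> H10 \<Omega>" for W
    using that eq[OF H10_L2[OF that]] by simp
  then have "U \<in> H.eigenspace \<mu>" using U by (simp add: H.eigenspace_def)
  then show "\<exists>g. (\<lambda>x. (u x, g x)) \<in> H.eigenspace \<mu>" unfolding U_def[abs_def] by blast
next
  assume "\<exists>g. (\<lambda>x. (u x, g x)) \<in> H.eigenspace \<mu>"
  then obtain g where U: "(\<lambda>x. (u x, g x)) \<in> H.eigenspace \<mu>" by blast
  then have H1: "H1_0 \<Omega> u g" using H.eigenspace_mem[OF U] by (simp add: H10_def)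
  have "square_integrable \<Omega> (\<lambda>x. \<mu> * u x)"
    using H1 square_integrable_scale[of \<Omega> u \<mu>] by (simp add: H1_0_def)
  moreover have "(LINT x|lebesgue_on \<Omega>. g x \<bullet> grad \<phi> x) = (LINT x|lebesgue_on \<Omega>. (\<mu> * u x) * \<phi> x)"
    if "\<phi> \<in> test_functions \<Omega>" for \<phi>
    using H.eigenspaceD[OF U H10_test_pair[OF \<Omega> that]]
    by (simp add: grad_inner_def val_inner_def L2_inner_def test_pair_def mult.assoc)
  ultimately show "u \<in> dirichlet_eigenspace \<Omega> \<mu>"
    using H1 by (auto simp: dirichlet_eigenspace_def dirichlet_laplacian_def)
qed

lemma val_inner_eq_0_AE:
  assumes "square_integrable \<Omega> U"
  shows "val_inner \<Omega> U U = 0 \<longleftrightarrow> (AE x in lebesgue_on \<Omega>. fst (U x) = 0)"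
  unfolding val_inner_def by (rule L2_inner_eq_0_AE[OF square_integrable_fst[OF assms]])

text \<open>Attaching gradients to a basis changes nothing, because \<open>val_inner\<close> sees
  only the values.\<close>

lemma eigen_dim_has_ae_dim:
  assumes "has_ae_dim \<Omega> (dirichlet_eigenspace \<Omega> \<mu>) m"
  shows "H.eigen_dim \<mu> m"
proof -
  obtain u where u: "\<And>i. i < m \<Longrightarrow> u i \<in> dirichlet_eigenspace \<Omega> \<mu>"
    and indep: "\<And>c j. \<lbrakk>AE x in lebesgue_on \<Omega>. (\<Sum>i<m. c i * u i x) = 0; j < m\<rbrakk> \<Longrightarrow> c j = 0"
    and span: "\<And>v. v \<in> dirichlet_eigenspace \<Omega> \<mu> \<Longrightarrow> \<exists>c. AE x in lebesgue_on \<Omega>. v x = (\<Sum>i<m. c i * u i x)"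
    using assms unfolding has_ae_dim_def by blast
  from u obtain g where g: "\<And>i. i < m \<Longrightarrow> (\<lambda>x. (u i x, g i x)) \<in> H.eigenspace \<mu>"
    unfolding dirichlet_eigenspace_iff by metis
  define e where "e i x = (u i x, g i x)" for i x
  have e: "e i \<in> H.eigenspace \<mu>" if "i < m" for i using g[OF that] by (simp add: e_def[abs_def])
  have fst_sum: "fst ((\<Sum>i<m. c i *\<^sub>R e i) x) = (\<Sum>i<m. c i * u i x)" for c x
    by (simp add: sum_fun_apply fst_sum e_def)
  have sumH: "(\<Sum>i<m. c i *\<^sub>R e i) \<in> H10 \<Omega>" for c
    using e by (intro H.s.mem_sum H.s.mem H.eigenspace_mem) auto
  show ?thesis
    unfolding H.eigen_dim_def
  proof (intro exI[of _ e] conjI allI impI ballI)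
    show "e i \<in> H.eigenspace \<mu>" if "i < m" for i using that by (rule e)
    show "c j = 0" if "val_inner \<Omega> (\<Sum>i<m. c i *\<^sub>R e i) (\<Sum>i<m. c i *\<^sub>R e i) = 0" "j < m" for c j
    proof (rule indep[OF _ that(2)])
      show "AE x in lebesgue_on \<Omega>. (\<Sum>i<m. c i * u i x) = 0"
        using that(1) unfolding val_inner_eq_0_AE[OF H10_L2[OF sumH]] fst_sum .
    qed
    show "\<exists>c. val_inner \<Omega> (v - (\<Sum>i<m. c i *\<^sub>R e i)) (v - (\<Sum>i<m. c i *\<^sub>R e i)) = 0"
      if v: "v \<in> H.eigenspace \<mu>" for v
    proof -
      have "(\<lambda>x. fst (v x)) \<in> dirichlet_eigenspace \<Omega> \<mu>"
        unfolding dirichlet_eigenspace_iff using v by (intro exI[of _ "\<lambda>x. snd (v x)"]) simp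
      from span[OF this] obtain c where c: "AE x in lebesgue_on \<Omega>. fst (v x) = (\<Sum>i<m. c i * u i x)" by blast
      have "square_integrable \<Omega> (v - (\<Sum>i<m. c i *\<^sub>R e i))"
        using H10_L2[OF H.eigenspace_mem[OF v]] H10_L2[OF sumH] by (rule square_integrable_diff)
      moreover have "AE x in lebesgue_on \<Omega>. fst ((v - (\<Sum>i<m. c i *\<^sub>R e i)) x) = 0"
        using c by eventually_elim (simp add: fst_sum)
      ultimately show ?thesis using val_inner_eq_0_AE by blast
    qed
  qed
qed

text \<open>Weak form of the commutator: the negative Laplacian maps x_b u to l x_b u minus twice
  the b-th partial derivative of u, for an eigenfunction u with eigenvalue l.\<close>

lemma grad_inner_coord_mult:
  assumes b: "b \<in> Basis" and U: "U \<in> H.eigenspace l" and W: "W \<in> H10 \<Omega>"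
  shows "grad_inner \<Omega> (coord_mult b U) W
    = l * val_inner \<Omega> (coord_mult b U) W - 2 * L2_inner \<Omega> (\<lambda>x. snd (U x) \<bullet> b) (\<lambda>x. fst (W x))"
proof -
  note UH = H.eigenspace_mem[OF U]
  note UL = H10_L2[OF UH] and WL = H10_L2[OF W]
  have PW: "coord_mult b W \<in> H10 \<Omega>" by (rule H10_coord_mult[OF \<Omega> bd b W])
  have sn: "square_integrable \<Omega> (\<lambda>x. snd (V x) \<bullet> b)" if "square_integrable \<Omega> V" for V
    by (rule square_integrable_bounded_linear[OF square_integrable_snd[OF that] bounded_linear_inner_left])
  have i1: "integrable (lebesgue_on \<Omega>) (\<lambda>x. snd (U x) \<bullet> snd (coord_mult b W x))"
    by (intro integrable_L2_inner square_integrable_snd UL H10_L2[OF PW])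
  have i2: "integrable (lebesgue_on \<Omega>) (\<lambda>x. fst (U x) * (snd (W x) \<bullet> b))"
    using integrable_L2_inner[OF square_integrable_fst[OF UL] sn[OF WL]] by simp
  have i3: "integrable (lebesgue_on \<Omega>) (\<lambda>x. (snd (U x) \<bullet> b) * fst (W x))"
    using integrable_L2_inner[OF sn[OF UL] square_integrable_fst[OF WL]] by simp
  \<comment> \<open>Moves the coordinate factor from \<open>U\<close> to \<open>W\<close>, where the
    eigenvalue equation of \<open>U\<close> can be tested with \<open>coord_mult b W\<close>.
    Integration by parts then merges the two first-order remainders into the factor 2.\<close>
  have "snd (coord_mult b U x) \<bullet> snd (W x) = snd (U x) \<bullet> snd (coord_mult b W x)
      + fst (U x) * (snd (W x) \<bullet> b) - (snd (U x) \<bullet> b) * fst (W x)" for x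
    by (simp add: coord_mult_def inner_add_left inner_add_right inner_commute[of b] mult.commute)
  then have "grad_inner \<Omega> (coord_mult b U) W = grad_inner \<Omega> U (coord_mult b W)
      + L2_inner \<Omega> (\<lambda>x. fst (U x)) (\<lambda>x. snd (W x) \<bullet> b) - L2_inner \<Omega> (\<lambda>x. snd (U x) \<bullet> b) (\<lambda>x. fst (W x))"
    using i1 i2 i3 by (simp add: grad_inner_def L2_inner_def)
  also have "L2_inner \<Omega> (\<lambda>x. fst (U x)) (\<lambda>x. snd (W x) \<bullet> b) = - L2_inner \<Omega> (\<lambda>x. snd (U x) \<bullet> b) (\<lambda>x. fst (W x))"
    using H10_integration_by_parts[OF \<Omega> UH W b] by simp
  also have "grad_inner \<Omega> U (coord_mult b W) = l * val_inner \<Omega> (coord_mult b U) W"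
    using H.eigenspaceD[OF U PW]
    by (simp add: val_inner_def L2_inner_def coord_mult_def mult_ac)
  finally show ?thesis by simp
qed

text \<open>The abstract inequality holds for each coordinate direction separately. Summation over
  the directions gives the dimension on the left and turns the squared partial derivatives into
  eigenvalues on the right.\<close>

theorem yang_inequality_dirichlet:
  fixes lam :: "nat \<Rightarrow> real"
  assumes lam: "dirichlet_eigenvalues \<Omega> lam"
  shows "\<And>k. 1 \<le> k \<Longrightarrow> 0 \<le> lam k"
    and "\<And>n z. \<lbrakk>z \<le> lam (Suc n); \<And>i. i \<in> {1..n} \<Longrightarrow> lam i \<le> z\<rbrakk> \<Longrightarrow>
      real DIM('a) * (\<Sum>i=1..n. (z - lam i)\<^sup>2) \<le> 4 * (\<Sum>i=1..n. (z - lam i) * lam i)"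
proof -
  have mono: "mono_on {1..} lam" and fin: "\<And>\<mu>. finite {k. 1 \<le> k \<and> lam k = \<mu>}"
    and dim: "\<And>\<mu>. H.eigen_dim \<mu> (card {k. 1 \<le> k \<and> lam k = \<mu>})"
    using lam eigen_dim_has_ae_dim by (auto simp: dirichlet_eigenvalues_def)
  obtain U where U: "\<And>k. 1 \<le> k \<Longrightarrow> U k \<in> H.eigenspace (lam k)"
    and orth: "\<And>i j. \<lbrakk>1 \<le> i; 1 \<le> j\<rbrakk> \<Longrightarrow> val_inner \<Omega> (U i) (U j) = (if i = j then 1 else 0)"
    and ray: "\<And>k w. \<lbrakk>w \<in> H10 \<Omega>; \<And>i. i \<in> {1..k} \<Longrightarrow> val_inner \<Omega> w (U i) = 0\<rbrakk>
      \<Longrightarrow> lam (Suc k) * val_inner \<Omega> w w \<le> grad_inner \<Omega> w w"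
    using H.orthonormal_eigenfamily[OF mono fin dim] by blast
  have UH: "U k \<in> H10 \<Omega>" if "1 \<le> k" for k using U[OF that] by (rule H.eigenspace_mem)
  note UL = UH[THEN H10_L2]
  have lam_eq: "grad_inner \<Omega> (U k) (U k) = lam k" if "1 \<le> k" for k
    using H.eigenspaceD[OF U[OF that] UH[OF that]] orth[OF that that] by simp
  show "0 \<le> lam k" if "1 \<le> k" for k
    using lam_eq[OF that] H.a.nonneg[OF UH[OF that]] by simp
  fix n z assume z: "z \<le> lam (Suc n)" and lz: "\<And>i. i \<in> {1..n} \<Longrightarrow> lam i \<le> z"
  have direction: "(\<Sum>i\<in>{1..n}. (z - lam i)\<^sup>2)
      \<le> 4 * (\<Sum>i\<in>{1..n}. (z - lam i) * L2_inner \<Omega> (\<lambda>x. snd (U i x) \<bullet> b) (\<lambda>x. snd (U i x) \<bullet> b))"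
    if b: "b \<in> Basis" for b
  proof (rule L2.yang_inequality[where u = "\<lambda>i x. fst (U i x)" and x = "\<lambda>i x. fst (coord_mult b (U i) x)"])
    have P: "coord_mult b (U i) \<in> H10 \<Omega>" if "1 \<le> i" for i by (rule H10_coord_mult[OF \<Omega> bd b UH[OF that]])
    fix i assume "i \<in> {1..n}"
    then have i: "1 \<le> i" by simp
    show "(\<lambda>x. fst (U i x)) \<in> L2 \<Omega>" using square_integrable_fst[OF UL[OF i]] by simp
    show "(\<lambda>x. fst (coord_mult b (U i) x)) \<in> L2 \<Omega>" using square_integrable_fst[OF H10_L2[OF P[OF i]]] by simp
    show "(\<lambda>x. snd (U i x) \<bullet> b) \<in> L2 \<Omega>"
      using square_integrable_bounded_linear[OF square_integrable_snd[OF UL[OF i]] bounded_linear_inner_left] by simp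
    show "lam i \<le> z" using \<open>i \<in> {1..n}\<close> by (rule lz)
    \<comment> \<open>The partial derivative of x_b u is x_b times that of u, plus u. Integration by
      parts therefore gives twice the wanted product plus the normalized square of u, with total
      0.\<close>
    have "L2_inner \<Omega> (\<lambda>x. fst (coord_mult b (U i) x)) (\<lambda>x. snd (U i x) \<bullet> b)
        + L2_inner \<Omega> (\<lambda>x. snd (coord_mult b (U i) x) \<bullet> b) (\<lambda>x. fst (U i x)) = 0"
      by (rule H10_integration_by_parts[OF \<Omega> P[OF i] UH[OF i] b])
    moreover have "L2_inner \<Omega> (\<lambda>x. snd (coord_mult b (U i) x) \<bullet> b) (\<lambda>x. fst (U i x))
        = L2_inner \<Omega> (\<lambda>x. fst (coord_mult b (U i) x)) (\<lambda>x. snd (U i x) \<bullet> b) + val_inner \<Omega> (U i) (U i)"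
    proof -
      have "integrable (lebesgue_on \<Omega>) (\<lambda>x. fst (coord_mult b (U i) x) * (snd (U i x) \<bullet> b))"
        using integrable_L2_inner[OF square_integrable_fst[OF H10_L2[OF P[OF i]]]
            square_integrable_bounded_linear[OF square_integrable_snd[OF UL[OF i]] bounded_linear_inner_left]] by simp
      moreover have "integrable (lebesgue_on \<Omega>) (\<lambda>x. fst (U i x) * fst (U i x))"
        using integrable_L2_inner[OF square_integrable_fst[OF UL[OF i]] square_integrable_fst[OF UL[OF i]]] by simp
      moreover have "(snd (coord_mult b (U i) x) \<bullet> b) * fst (U i x)
          = fst (coord_mult b (U i) x) * (snd (U i x) \<bullet> b) + fst (U i x) * fst (U i x)" for x
        using b by (simp add: coord_mult_def inner_add_left algebra_simps)
      ultimately show ?thesis by (simp add: L2_inner_def val_inner_def)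
    qed
    ultimately show "L2_inner \<Omega> (\<lambda>x. fst (coord_mult b (U i) x)) (\<lambda>x. snd (U i x) \<bullet> b) = - 1 / 2"
      using orth[OF i i] by simp
    show "z * L2_inner \<Omega> p p \<le> lam i * L2_inner \<Omega> p p - 2 * L2_inner \<Omega> (\<lambda>x. snd (U i x) \<bullet> b) p"
      if p: "p = (\<lambda>x. fst (coord_mult b (U i) x)) - (\<Sum>j\<in>{1..n}.
        L2_inner \<Omega> (\<lambda>x. fst (coord_mult b (U i) x)) (\<lambda>x. fst (U j x)) *\<^sub>R (\<lambda>x. fst (U j x)))" for p
    proof -
      define c where "c j = val_inner \<Omega> (coord_mult b (U i)) (U j)" for j
      define S where "S = (\<Sum>j\<in>{1..n}. c j *\<^sub>R U j)"
      \<comment> \<open>The trial function lifted to a pair with its gradient. It is orthogonal to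
        \<open>S\<close> in both forms, so its energy reduces to a product with
        \<open>coord_mult b (U i)\<close>, where the commutator applies.\<close>
      define W where "W = coord_mult b (U i) - S"
      have SH: "S \<in> H10 \<Omega>" unfolding S_def by (intro H.s.mem_sum H.s.mem UH) simp
      have WH: "W \<in> H10 \<Omega>" unfolding W_def using P[OF i] SH by simp
      have pW: "p = (\<lambda>x. fst (W x))"
        unfolding p by (simp add: fun_eq_iff W_def S_def c_def sum_fun_apply fst_sum val_inner_def)
      have WU: "val_inner \<Omega> W (U j) = 0" if "j \<in> {1..n}" for j
        unfolding W_def S_def using P[OF i] SH[unfolded S_def] UH that
          H.s.orthonormal_coeff[of "{1..n}" U j c] orth
        by (simp add: H.s.diff_left c_def)
      have vSW: "val_inner \<Omega> S W = 0" unfolding S_def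
        using WU WH UH by (subst H.s.sum_left) (auto simp: H.s.scale_left H.s.commute[of "U _" W])
      have gSW: "grad_inner \<Omega> S W = 0" unfolding S_def
        using WU WH UH H.eigenspaceD[OF U WH]
        by (subst H.a.sum_left) (auto simp: H.a.scale_left H.s.commute[of "U _" W])
      have "z * val_inner \<Omega> W W \<le> lam (Suc n) * val_inner \<Omega> W W"
        using z H.s.nonneg[OF WH] by (rule mult_right_mono)
      also have "\<dots> \<le> grad_inner \<Omega> W W" using WH WU by (rule ray)
      also have "\<dots> = grad_inner \<Omega> (coord_mult b (U i)) W"
        using gSW P[OF i] SH WH by (subst (1) W_def) (simp add: H.a.diff_left)
      also have "\<dots> = lam i * val_inner \<Omega> (coord_mult b (U i)) W - 2 * L2_inner \<Omega> (\<lambda>x. snd (U i x) \<bullet> b) (\<lambda>x. fst (W x))"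
        by (rule grad_inner_coord_mult[OF b U[OF i] WH])
      also have "val_inner \<Omega> (coord_mult b (U i)) W = val_inner \<Omega> W W"
        using vSW P[OF i] SH WH by (subst (2) W_def) (simp add: H.s.diff_left)
      finally show ?thesis by (simp add: pW val_inner_def)
    qed
    fix j assume "j \<in> {1..n}"
    then have j: "1 \<le> j" by simp
    show "L2_inner \<Omega> (\<lambda>x. fst (U i x)) (\<lambda>x. fst (U j x)) = (if i = j then 1 else 0)"
      using orth[OF i j] by (simp add: val_inner_def)
    show "L2_inner \<Omega> (\<lambda>x. fst (coord_mult b (U i) x)) (\<lambda>x. fst (U j x))
        = L2_inner \<Omega> (\<lambda>x. fst (coord_mult b (U j) x)) (\<lambda>x. fst (U i x))"
      by (simp add: L2_inner_def coord_mult_def mult_ac)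
    \<comment> \<open>The same energy product is evaluated twice: by the eigenvalue equation of
      \<open>U j\<close> here, and by the commutator for \<open>U i\<close> below.\<close>
    have "grad_inner \<Omega> (coord_mult b (U i)) (U j) = lam j * val_inner \<Omega> (coord_mult b (U i)) (U j)"
      using H.eigenspaceD[OF U[OF j] P[OF i]] H.a.commute[OF P[OF i] UH[OF j]] H.s.commute[OF P[OF i] UH[OF j]]
      by simp
    then show "2 * L2_inner \<Omega> (\<lambda>x. snd (U i x) \<bullet> b) (\<lambda>x. fst (U j x))
        = (lam i - lam j) * L2_inner \<Omega> (\<lambda>x. fst (coord_mult b (U i) x)) (\<lambda>x. fst (U j x))"
      using grad_inner_coord_mult[OF b U[OF i] UH[OF j]] by (simp add: val_inner_def algebra_simps)
  qed simp
  \<comment> \<open>Summing over the basis recovers the energy of \<open>U i\<close>, which is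
    \<open>lam i\<close> by normalization.\<close>
  have parts: "(\<Sum>b\<in>Basis. L2_inner \<Omega> (\<lambda>x. snd (U i x) \<bullet> b) (\<lambda>x. snd (U i x) \<bullet> b)) = lam i"
    if "i \<in> {1..n}" for i
  proof -
    have i: "1 \<le> i" using that by simp
    note sq = square_integrable_bounded_linear[OF square_integrable_snd[OF UL[OF i]] bounded_linear_inner_left]
    have "(\<Sum>b\<in>Basis. L2_inner \<Omega> (\<lambda>x. snd (U i x) \<bullet> b) (\<lambda>x. snd (U i x) \<bullet> b))
        = (LINT x|lebesgue_on \<Omega>. (\<Sum>b\<in>Basis. (snd (U i x) \<bullet> b) * (snd (U i x) \<bullet> b)))"
      using integrable_L2_inner[OF sq sq] by (simp add: L2_inner_def)
    also have "\<dots> = grad_inner \<Omega> (U i) (U i)"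
      by (simp add: grad_inner_def L2_inner_def euclidean_inner[symmetric])
    finally show ?thesis using lam_eq[OF i] by simp
  qed
  have "real DIM('a) * (\<Sum>i=1..n. (z - lam i)\<^sup>2) = (\<Sum>b\<in>(Basis :: 'a set). \<Sum>i=1..n. (z - lam i)\<^sup>2)"
    by simp
  also have "\<dots> \<le> (\<Sum>b\<in>(Basis :: 'a set). 4 * (\<Sum>i=1..n. (z - lam i) * L2_inner \<Omega> (\<lambda>x. snd (U i x) \<bullet> b) (\<lambda>x. snd (U i x) \<bullet> b)))"
    by (rule sum_mono) (rule direction)
  also have "\<dots> = 4 * (\<Sum>i=1..n. \<Sum>b\<in>Basis. (z - lam i) * L2_inner \<Omega> (\<lambda>x. snd (U i x) \<bullet> b) (\<lambda>x. snd (U i x) \<bullet> b))"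
    by (subst sum.swap) (simp add: sum_distrib_left)
  also have "\<dots> = 4 * (\<Sum>i=1..n. (z - lam i) * lam i)"
    using parts by (simp add: sum_distrib_left[symmetric])
  finally show "real DIM('a) * (\<Sum>i=1..n. (z - lam i)\<^sup>2) \<le> 4 * (\<Sum>i=1..n. (z - lam i) * lam i)" .
qed

end

theorem corollary3p1:
  fixes \<Omega> :: "'a::euclidean_space set" and lam :: "nat \<Rightarrow> real" and j k :: nat and d :: real
  assumes "d = real DIM('a)"
    and "bounded_domain \<Omega>"
    and "dirichlet_eigenvalues \<Omega> lam"
    and "1 \<le> j" and "1 \<le> k"
    and "real k \<ge> real j * ((1 + d / 2) / (1 + d / 4))"
  shows "eigenvalue_mean lam k / eigenvalue_mean lam j
           \<le> 2 * ((1 + d / 4) / (1 + d / 2)) powr (1 + 2 / d) * (real k / real j) powr (2 / d)"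
proof -
  have \<Omega>: "open \<Omega>" "bounded \<Omega>" using assms(2) by (auto simp: bounded_domain_def)
  have d: "d > 0" using assms(1) by simp
  have mono: "mono_on {1..} lam" using assms(3) by (simp add: dirichlet_eigenvalues_def)
  \<comment> \<open>The quotient in the hypothesis is at least 1, which gives
    \<open>j \<le> k\<close>.\<close>
  have "real j * 1 \<le> real j * ((1 + d / 2) / (1 + d / 4))"
    using d by (intro mult_left_mono) (auto simp: field_simps)
  then have "j \<le> k" using assms(6) by simp
  then show ?thesis
    using yang_inequality_dirichlet[OF \<Omega> assms(3)] assms(1,4)
    by (intro eigenvalue_mean_ratio_bound[OF d mono]) simp_all
qed

end
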